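(* Let $\mu$ be a nonzero positive measure on $\mathbb{R}$ with density $\psi$, i.e. $\mu(dt)=\psi(t)\,dt$ with $\psi\ge 0$. (i) If $\psi\in L^2(\mathbb{R})$, then $P^{c}_\lambda<\infty$ for every $\lambda>0$. (ii) If moreover $\psi\in L^2(\mathbb{R})\cap L^4(\mathbb{R})\cap L^4(\mathbb{R},t^2dt)$, then for every $\lambda>0$ there exists $f\in L^2(\mathbb{R})$ with $\|f\|_{L^2}^2=\lambda$ and $$\mathcal{Q}^{c}_\mu(f,f,f,f)=\sup\big\{\mathcal{Q}^{c}_\mu(g,g,g,g):\ g\in L^2(\mathbb{R}),\ \|g\|_{L^2}^2=\lambda\big\}=P^c_\lambda.$$ Any such maximizer $f$ satisfies, with $\omega=P^c_\lambda/\lambda>0$, $$\omega\langle g,f\rangle=\mathcal{Q}^{c}_\mu(g,f,f,f)\quad\text{for all } g\in L^2(\mathbb{R}).$$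
   Context: For $r\in\mathbb{R}$ let $T_r=e^{ir\partial_x^2}$ be the unitary free Schrödinger propagator on $L^2(\mathbb{R})$, i.e. $\widehat{T_rf}(k)=e^{-irk^2}\hat f(k)$, where $\hat f(k)=(2\pi)^{-1/2}\int_{\mathbb{R}}e^{-ikx}f(x)\,dx$. For a positive Borel measure $\mu$ on $\mathbb{R}$ and $f_1,\dots,f_4\in L^2(\mathbb{R})$ define $$\mathcal{Q}^c_\mu(f_1,f_2,f_3,f_4)=\int_{\mathbb{R}}\int_{\mathbb{R}}\overline{(T_rf_1)(x)}\,(T_rf_2)(x)\,\overline{(T_rf_3)(x)}\,(T_rf_4)(x)\,dx\,\mu(dr),$$ and for $\lambda>0$, $P^c_\lambda=\sup\{\mathcal{Q}^c_\mu(f,f,f,f): f\in L^2(\mathbb{R}),\ \|f\|_{L^2}^2=\lambda\}$. The inner product is $\langle g,f\rangle=\int\overline{g(x)}f(x)\,dx$. $L^4(\mathbb{R},t^2dt)$ denotes the space with norm $(\int|\psi(t)|^4t^2\,dt)^{1/4}$. *)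

theory Defs
  imports "HOL-Analysis.Analysis"
begin

definition L2 :: "(real \<Rightarrow> complex) set" where
  "L2 = {f. f \<in> borel_measurable lborel \<and> integrable lborel (\<lambda>x. (cmod (f x))\<^sup>2)}"

definition L2norm_sq :: "(real \<Rightarrow> complex) \<Rightarrow> real" where
  "L2norm_sq f = (LINT x|lborel. (cmod (f x))\<^sup>2)"

definition L2inner :: "(real \<Rightarrow> complex) \<Rightarrow> (real \<Rightarrow> complex) \<Rightarrow> complex" where
  "L2inner g f = (LINT x|lborel. cnj (g x) * f x)"

definition fourier_trunc :: "real \<Rightarrow> (real \<Rightarrow> complex) \<Rightarrow> real \<Rightarrow> complex" where
  "fourier_trunc R f k =
     complex_of_real (1 / sqrt (2 * pi)) *
     (LINT x:{-R..R}|lborel. exp (- \<i> * complex_of_real (k * x)) * f x)"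

text \<open>Fourier--Plancherel transform on L2: g is (a representative of) the Fourier
  transform of f iff g is in L2 and the truncated Fourier integrals converge to g in L2.\<close>
definition is_fourier :: "(real \<Rightarrow> complex) \<Rightarrow> (real \<Rightarrow> complex) \<Rightarrow> bool" where
  "is_fourier f g \<longleftrightarrow> g \<in> L2 \<and>
     ((\<lambda>R. LINT k|lborel. (cmod (g k - fourier_trunc R f k))\<^sup>2) \<longlongrightarrow> 0) at_top"

text \<open>Free Schroedinger propagator T_r = exp(i r d^2/dx^2):
  (T_r f)^ (k) = exp(-i r k^2) f^(k). A representative is chosen.\<close>
definition schr_prop :: "real \<Rightarrow> (real \<Rightarrow> complex) \<Rightarrow> (real \<Rightarrow> complex)" where
  "schr_prop r f = (SOME h. h \<in> L2 \<and>
     (\<exists>fh. is_fourier f fh \<and>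
        is_fourier h (\<lambda>k. exp (- \<i> * complex_of_real (r * k\<^sup>2)) * fh k)))"

definition Qc :: "real measure \<Rightarrow> (real \<Rightarrow> complex) \<Rightarrow> (real \<Rightarrow> complex) \<Rightarrow>
                   (real \<Rightarrow> complex) \<Rightarrow> (real \<Rightarrow> complex) \<Rightarrow> complex" where
  "Qc \<mu> f1 f2 f3 f4 =
     (LINT r|\<mu>. (LINT x|lborel.
        cnj (schr_prop r f1 x) * schr_prop r f2 x * cnj (schr_prop r f3 x) * schr_prop r f4 x))"

text \<open>P^c_lambda, as an extended real (so that finiteness is a genuine claim).
  Q(f,f,f,f) is real, so its real part is taken.\<close>
definition Pc :: "real measure \<Rightarrow> real \<Rightarrow> ereal" where
  "Pc \<mu> lam = Sup {ereal (Re (Qc \<mu> f f f f)) | f. f \<in> L2 \<and> L2norm_sq f = lam}"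

end

theory Submission
  imports Defs "HOL-Probability.Probability" "HOL-Library.Diagonal_Subsequence"
begin

text \<open>
  Write \<open>F\<close> for the Fourier transform of \<open>f\<close> and
  \<open>A(\<xi>, s) = \<integral> exp (- i s k) cnj (F k) F (k + \<xi>) dk\<close> for its ambiguity function. The Fourier
  transform of \<open>|T\<^sub>t f|\<^sup>2\<close> at \<open>\<xi>\<close> is a unimodular multiple of \<open>A(\<xi>, 2 t \<xi>) / \<surd>(2\<pi>)\<close>, so
  \<open>Q(f, f, f, f)\<close> is, up to the factor \<open>1 / 2\<pi>\<close>, the integral of \<open>\<psi>(t) |A(\<xi>, 2 t \<xi>)|\<^sup>2\<close>
  over the plane. Now \<open>|A|\<close> is bounded by \<open>\<parallel>f\<parallel>\<^sup>2\<close> and \<open>|A|\<^sup>2\<close> has integral \<open>2\<pi> \<parallel>f\<parallel>\<^sup>4\<close>;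
  using the first bound where \<open>2\<delta>|\<xi>| < \<psi>(t)\<close>, a set of \<open>\<psi> dt d\<xi>\<close>-measure \<open>\<integral> \<psi>\<^sup>2 / \<delta>\<close>,
  and the second elsewhere shows that \<open>Q\<close> is finite.

  Both bounds survive in the compactness argument. Phase-space translations of \<open>F\<close> leave \<open>|A|\<close>
  unchanged, and a maximizing sequence translated suitably has a nonzero weak limit, because
  \<open>\<integral> |A\<^sub>F|\<^sup>2 |A\<^sub>\<phi>|\<^sup>2\<close> is the fourth power of the \<open>L\<^sup>4\<close> norm of the cross ambiguity function of
  \<open>F\<close> with a Gaussian \<open>\<phi>\<close>. The functional then splits along the weak limit and its remainder, and
  since the supremum is proportional to \<open>\<lambda>\<^sup>2\<close>, hence strictly superadditive, the remainder
  vanishes. The Euler--Lagrange equation is the first-order condition at the maximizer.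
\<close>

section \<open>Square-integrable functions on a measure space\<close>

text \<open>The propagator multiplies F by a chirp, which shears phase space: solutions at different
  times see one and the same ambiguity function along different lines through the origin. In the
  coordinates (\<xi>, s) of that plane the measure \<psi>(t) dt d\<xi> has density \<psi>(s / (2
  \<xi>)) / (2 |\<xi>|), which need not be bounded; the set cut out by \<delta> is the one where it
  exceeds \<delta>. As this set has finite measure, a constant is an integrable majorant there and
  pointwise convergence of A suffices; elsewhere the contribution is uniformly small. The Gaussian
  is chosen because its ambiguity function has no zeros, so that weighting by its square can be
  undone up to a set of small measure. A further obstacle is that for a given t the solution is not
  known beforehand to lie in L4, which the identity between Q and A requires; bounded approximants
  and Fatou's lemma supply this for almost every t. The L2 transform is built from indicators of
  intervals, whose inner products reduce to the integral of (1 - cos x) / x^2.\<close>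

definition sqint :: "'a measure \<Rightarrow> ('a \<Rightarrow> complex) set" where
  "sqint M = {f. f \<in> borel_measurable M \<and> integrable M (\<lambda>x. (cmod (f x))\<^sup>2)}"

definition l2norm :: "'a measure \<Rightarrow> ('a \<Rightarrow> complex) \<Rightarrow> real" where
  "l2norm M f = sqrt (LINT x|M. (cmod (f x))\<^sup>2)"

definition l2inner :: "'a measure \<Rightarrow> ('a \<Rightarrow> complex) \<Rightarrow> ('a \<Rightarrow> complex) \<Rightarrow> complex" where
  "l2inner M g f = (LINT x|M. cnj (g x) * f x)"

lemma sqintI: "f \<in> borel_measurable M \<Longrightarrow> integrable M (\<lambda>x. (cmod (f x))\<^sup>2) \<Longrightarrow> f \<in> sqint M"
  by (simp add: sqint_def)

lemma sqintD: "f \<in> sqint M \<Longrightarrow> f \<in> borel_measurable M"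
  "f \<in> sqint M \<Longrightarrow> integrable M (\<lambda>x. (cmod (f x))\<^sup>2)"
  by (simp_all add: sqint_def)

lemma L2_eq_sqint: "L2 = sqint lborel"
  by (simp add: L2_def sqint_def)

lemma l2norm_nonneg [simp]: "0 \<le> l2norm M f"
  by (simp add: l2norm_def)

lemma l2norm_power2: "(l2norm M f)\<^sup>2 = (LINT x|M. (cmod (f x))\<^sup>2)"
  by (simp add: l2norm_def)

lemma L2norm_sq_eq: "L2norm_sq f = (l2norm lborel f)\<^sup>2"
  by (simp add: L2norm_sq_def l2norm_power2)

lemma L2inner_eq: "L2inner g f = l2inner lborel g f"
  by (simp add: L2inner_def l2inner_def)

lemma nn_integral_l2norm:
  assumes "f \<in> sqint M"
  shows "(\<integral>\<^sup>+x. ennreal ((cmod (f x))\<^sup>2) \<partial>M) = ennreal ((l2norm M f)\<^sup>2)"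
  using assms unfolding l2norm_power2 by (intro nn_integral_eq_integral) (auto simp: sqint_def)

lemma sqintI_nn:
  assumes "f \<in> borel_measurable M" "(\<integral>\<^sup>+x. ennreal ((cmod (f x))\<^sup>2) \<partial>M) < \<infinity>"
  shows "f \<in> sqint M"
  using assms by (intro sqintI integrableI_nonneg) auto

lemma nn_integral_l2norm_le:
  assumes "f \<in> borel_measurable M" "(\<integral>\<^sup>+x. ennreal ((cmod (f x))\<^sup>2) \<partial>M) \<le> ennreal (C\<^sup>2)" "0 \<le> C"
  shows "f \<in> sqint M" "l2norm M f \<le> C"
proof -
  show f: "f \<in> sqint M" using assms by (intro sqintI_nn) (auto intro: le_less_trans)
  have "ennreal ((l2norm M f)\<^sup>2) \<le> ennreal (C\<^sup>2)"
    using assms nn_integral_l2norm[OF f] by simp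
  then show "l2norm M f \<le> C" using assms(3) by (simp add: ennreal_le_iff power2_le_iff_abs_le)
qed

lemma sqint_cong_AE:
  assumes "f \<in> sqint M" "g \<in> borel_measurable M" "AE x in M. f x = g x"
  shows "g \<in> sqint M"
  using assms by (auto simp: sqint_def elim!: integrable_cong_AE_imp)

lemma l2norm_cong_AE:
  assumes "f \<in> borel_measurable M" "g \<in> borel_measurable M" "AE x in M. f x = g x"
  shows "l2norm M f = l2norm M g"
  unfolding l2norm_def using assms by (intro arg_cong[where f=sqrt] integral_cong_AE) auto

lemma sqint_zero [simp]: "(\<lambda>x. 0) \<in> sqint M"
  by (simp add: sqint_def)

lemma l2norm_zero [simp]: "l2norm M (\<lambda>x. 0) = 0"
  by (simp add: l2norm_def)

lemma sqint_cmult: "f \<in> sqint M \<Longrightarrow> (\<lambda>x. c * f x) \<in> sqint M"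
  by (auto simp: sqint_def norm_mult power_mult_distrib)

lemma l2norm_cmult: "l2norm M (\<lambda>x. c * f x) = cmod c * l2norm M f"
  by (simp add: l2norm_def norm_mult power_mult_distrib real_sqrt_mult)

lemma borel_measurable_cnj [measurable (raw)]:
  assumes "f \<in> borel_measurable M"
  shows "(\<lambda>x. cnj (f x)) \<in> borel_measurable M"
  by (rule measurable_compose[OF assms borel_measurable_continuous_onI]) (intro continuous_intros)

lemma sqint_cnj: "f \<in> sqint M \<Longrightarrow> (\<lambda>x. cnj (f x)) \<in> sqint M"
  by (auto simp: sqint_def)

lemma l2norm_cnj: "l2norm M (\<lambda>x. cnj (f x)) = l2norm M f"
  by (simp add: l2norm_def)

lemma sqint_unimod:
  assumes "f \<in> sqint M" "e \<in> borel_measurable M" "\<And>x. cmod (e x) = 1"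
  shows "(\<lambda>x. e x * f x) \<in> sqint M" "l2norm M (\<lambda>x. e x * f x) = l2norm M f"
  using assms by (auto simp: sqint_def norm_mult l2norm_def)

lemma norm_add_sq_le: "(cmod (a + b))\<^sup>2 \<le> 2 * (cmod a)\<^sup>2 + 2 * (cmod b)\<^sup>2"
proof -
  have "(cmod (a + b))\<^sup>2 \<le> (cmod a + cmod b)\<^sup>2" by (intro power_mono norm_triangle_ineq) auto
  also have "\<dots> \<le> 2 * (cmod a)\<^sup>2 + 2 * (cmod b)\<^sup>2"
    using sum_squares_bound[of "cmod a" "cmod b"] by (simp add: power2_sum)
  finally show ?thesis .
qed

lemma sqint_add:
  assumes "f \<in> sqint M" "g \<in> sqint M"
  shows "(\<lambda>x. f x + g x) \<in> sqint M"
proof (intro sqintI)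
  have [measurable]: "f \<in> borel_measurable M" "g \<in> borel_measurable M" using assms by (auto simp: sqint_def)
  show "(\<lambda>x. f x + g x) \<in> borel_measurable M" by simp
  show "integrable M (\<lambda>x. (cmod (f x + g x))\<^sup>2)"
    by (rule Bochner_Integration.integrable_bound[where f="\<lambda>x. 2 * (cmod (f x))\<^sup>2 + 2 * (cmod (g x))\<^sup>2"])
      (use assms norm_add_sq_le in \<open>auto simp: sqint_def\<close>)
qed

lemma sqint_diff:
  assumes "f \<in> sqint M" "g \<in> sqint M"
  shows "(\<lambda>x. f x - g x) \<in> sqint M"
  using sqint_add[OF assms(1) sqint_cmult[OF assms(2), of "-1"]] by simp

lemma sqint_bounded_mult:
  assumes "f \<in> sqint M" "h \<in> borel_measurable M" "\<And>x. cmod (h x) \<le> C"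
  shows "(\<lambda>x. h x * f x) \<in> sqint M" "l2norm M (\<lambda>x. h x * f x) \<le> C * l2norm M f"
proof -
  have [measurable]: "f \<in> borel_measurable M" "h \<in> borel_measurable M" using assms by (auto simp: sqint_def)
  have C: "0 \<le> C" using assms(3)[of undefined] norm_ge_zero order_trans by blast
  have "(\<integral>\<^sup>+x. ennreal ((cmod (h x * f x))\<^sup>2) \<partial>M) \<le> (\<integral>\<^sup>+x. ennreal ((cmod (of_real C * f x))\<^sup>2) \<partial>M)"
    using C assms(3) by (intro nn_integral_mono ennreal_leI power_mono) (auto simp: norm_mult intro!: mult_right_mono)
  also have "\<dots> = ennreal ((C * l2norm M f)\<^sup>2)"
    using C nn_integral_l2norm[OF sqint_cmult[OF assms(1), of "of_real C"]] by (simp add: l2norm_cmult)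
  finally show "(\<lambda>x. h x * f x) \<in> sqint M" "l2norm M (\<lambda>x. h x * f x) \<le> C * l2norm M f"
    using C by (auto intro!: nn_integral_l2norm_le)
qed

lemma sqint_mult_integrable:
  assumes "f \<in> sqint M" "g \<in> sqint M"
  shows "integrable M (\<lambda>x. f x * g x)"
proof (rule Bochner_Integration.integrable_bound[where f="\<lambda>x. (cmod (f x))\<^sup>2 + (cmod (g x))\<^sup>2"])
  show "AE x in M. cmod (f x * g x) \<le> norm ((cmod (f x))\<^sup>2 + (cmod (g x))\<^sup>2)"
  proof (intro AE_I2)
    fix x
    have "cmod (f x) * cmod (g x) \<le> 2 * cmod (f x) * cmod (g x)" by simp
    also have "\<dots> \<le> (cmod (f x))\<^sup>2 + (cmod (g x))\<^sup>2" by (rule sum_squares_bound)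
    finally show "cmod (f x * g x) \<le> norm ((cmod (f x))\<^sup>2 + (cmod (g x))\<^sup>2)" by (simp add: norm_mult)
  qed
qed (use assms in \<open>auto simp: sqint_def\<close>)

lemma l2inner_integrable:
  "f \<in> sqint M \<Longrightarrow> g \<in> sqint M \<Longrightarrow> integrable M (\<lambda>x. cnj (g x) * f x)"
  by (intro sqint_mult_integrable sqint_cnj)

lemma l2inner_add_right:
  assumes "f \<in> sqint M" "g \<in> sqint M" "h \<in> sqint M"
  shows "l2inner M h (\<lambda>x. f x + g x) = l2inner M h f + l2inner M h g"
  unfolding l2inner_def using assms
  by (simp add: distrib_left Bochner_Integration.integral_add l2inner_integrable)

lemma l2inner_cmult_right:
  "l2inner M h (\<lambda>x. c * f x) = c * l2inner M h f"
  unfolding l2inner_def by (simp add: mult.left_commute)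

lemma l2inner_cnj: "cnj (l2inner M f g) = l2inner M g f"
  unfolding l2inner_def by (subst Bochner_Integration.integral_cnj[symmetric]) (simp add: mult.commute)

lemma l2inner_add_left:
  assumes "f \<in> sqint M" "g \<in> sqint M" "h \<in> sqint M"
  shows "l2inner M (\<lambda>x. f x + g x) h = l2inner M f h + l2inner M g h"
  using l2inner_add_right[OF assms] by (metis l2inner_cnj complex_cnj_add)

lemma l2inner_cmult_left:
  "l2inner M (\<lambda>x. c * f x) h = cnj c * l2inner M f h"
  unfolding l2inner_def by (simp add: mult.assoc)

lemma l2inner_diff_right:
  assumes "f \<in> sqint M" "g \<in> sqint M" "h \<in> sqint M"
  shows "l2inner M h (\<lambda>x. f x - g x) = l2inner M h f - l2inner M h g"
  using l2inner_add_right[OF assms(1) sqint_cmult[OF assms(2), of "-1"] assms(3)] l2inner_cmult_right[of M h "-1" g]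
  by simp

lemma l2inner_diff_left:
  assumes "f \<in> sqint M" "g \<in> sqint M" "h \<in> sqint M"
  shows "l2inner M (\<lambda>x. f x - g x) h = l2inner M f h - l2inner M g h"
  using l2inner_diff_right[OF assms] by (metis l2inner_cnj complex_cnj_diff)

section \<open>Norm identities, the Cauchy--Schwarz and triangle inequalities\<close>

lemma l2inner_self: "l2inner M f f = of_real ((l2norm M f)\<^sup>2)"
proof -
  have "cnj (f x) * f x = of_real ((cmod (f x))\<^sup>2)" for x
    by (metis complex_norm_square mult.commute)
  then show ?thesis unfolding l2inner_def l2norm_power2 by (simp del: of_real_power)
qed

lemma l2norm_add_sq:
  assumes "f \<in> sqint M" "g \<in> sqint M"
  shows "(l2norm M (\<lambda>x. f x + g x))\<^sup>2 = (l2norm M f)\<^sup>2 + (l2norm M g)\<^sup>2 + 2 * Re (l2inner M f g)"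
proof -
  let ?s = "\<lambda>x. f x + g x"
  have s: "?s \<in> sqint M" using assms by (rule sqint_add)
  have "l2inner M ?s ?s = l2inner M f f + l2inner M g g + (l2inner M f g + cnj (l2inner M f g))"
    using assms s by (simp add: l2inner_add_left l2inner_add_right l2inner_cnj)
  then have "complex_of_real ((l2norm M ?s)\<^sup>2) = of_real ((l2norm M f)\<^sup>2 + (l2norm M g)\<^sup>2 + 2 * Re (l2inner M f g))"
    unfolding l2inner_self complex_add_cnj by simp
  then show ?thesis using of_real_eq_iff by blast
qed

lemma l2norm_uminus: "l2norm M (\<lambda>x. - f x) = l2norm M f"
  by (simp add: l2norm_def)

lemma l2norm_minus_commute: "l2norm M (\<lambda>x. f x - g x) = l2norm M (\<lambda>x. g x - f x)"
  by (simp add: l2norm_def norm_minus_commute)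

lemma l2norm_diff_sq:
  assumes "f \<in> sqint M" "g \<in> sqint M"
  shows "(l2norm M (\<lambda>x. f x - g x))\<^sup>2 = (l2norm M f)\<^sup>2 + (l2norm M g)\<^sup>2 - 2 * Re (l2inner M f g)"
  using l2norm_add_sq[OF assms(1) sqint_cmult[OF assms(2), of "-1"]] l2inner_cmult_right[of M f "-1" g]
  by (simp add: l2norm_uminus)

text \<open>The multiple of g subtracted from f carries the conjugate of the inner product, so that
  the cross term is real and the squared norm becomes a real quadratic polynomial in t.\<close>

lemma l2inner_CS:
  assumes f: "f \<in> sqint M" and g: "g \<in> sqint M"
  shows "cmod (l2inner M f g) \<le> l2norm M f * l2norm M g"
proof -
  let ?a = "l2norm M f" and ?b = "l2norm M g" and ?c = "l2inner M f g"
  have *: "0 \<le> ?a\<^sup>2 + (t * cmod ?c)\<^sup>2 * ?b\<^sup>2 - 2 * t * (cmod ?c)\<^sup>2" for t :: real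
  proof -
    let ?z = "of_real t * cnj ?c"
    have "Re (?z * ?c) = t * (cmod ?c)\<^sup>2"
      by (metis (no_types, opaque_lifting) Re_complex_of_real complex_norm_square mult.assoc mult.commute of_real_mult)
    moreover have "cmod ?z ^ 2 = (t * cmod ?c)\<^sup>2" by (simp add: norm_mult power_mult_distrib)
    moreover have "0 \<le> (l2norm M (\<lambda>x. f x - ?z * g x))\<^sup>2" by simp
    ultimately show ?thesis
      unfolding l2norm_diff_sq[OF f sqint_cmult[OF g]] l2inner_cmult_right l2norm_cmult
      by (simp add: power_mult_distrib)
  qed
  show ?thesis
  proof (cases "?b = 0")
    case True
    show ?thesis
    proof (rule ccontr)
      assume "\<not> ?thesis"
      \<comment> \<open>With b = 0 the quadratic reduces to a^2 - 2 t |c|^2, which is negative at t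
        = (a^2 + 1) / |c|^2.\<close>
      then have c: "(cmod ?c)\<^sup>2 > 0" using True by simp
      have "(?a\<^sup>2 + 1) / (cmod ?c)\<^sup>2 * (cmod ?c)\<^sup>2 = ?a\<^sup>2 + 1" using c by simp
      then show False using *[of "(?a\<^sup>2 + 1) / (cmod ?c)\<^sup>2"] True zero_le_power2[of ?a]
        by (simp only: mult.assoc) simp
    qed
  next
    case False
    then have b: "?b\<^sup>2 > 0" by simp
    have "0 \<le> ?a\<^sup>2 - (cmod ?c)\<^sup>2 / ?b\<^sup>2"
    proof -
      have "((1 / ?b\<^sup>2) * cmod ?c)\<^sup>2 * ?b\<^sup>2 = (cmod ?c)\<^sup>2 / ?b\<^sup>2" using b by (simp add: power2_eq_square field_simps)
      then show ?thesis using *[of "1 / ?b\<^sup>2"] by simp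
    qed
    then have "(cmod ?c)\<^sup>2 \<le> (?a * ?b)\<^sup>2" using b by (simp add: field_simps power_mult_distrib)
    then show ?thesis by (rule power2_le_imp_le) simp
  qed
qed

lemma l2norm_triangle:
  assumes "f \<in> sqint M" "g \<in> sqint M"
  shows "l2norm M (\<lambda>x. f x + g x) \<le> l2norm M f + l2norm M g"
proof (rule power2_le_imp_le)
  have "Re (l2inner M f g) \<le> l2norm M f * l2norm M g"
    using l2inner_CS[OF assms] complex_Re_le_cmod order_trans by blast
  then show "(l2norm M (\<lambda>x. f x + g x))\<^sup>2 \<le> (l2norm M f + l2norm M g)\<^sup>2"
    using l2norm_add_sq[OF assms] by (simp add: power2_sum)
qed simp

lemma l2norm_triangle_diff:
  assumes "f \<in> sqint M" "g \<in> sqint M" "h \<in> sqint M"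
  shows "l2norm M (\<lambda>x. f x - h x) \<le> l2norm M (\<lambda>x. f x - g x) + l2norm M (\<lambda>x. g x - h x)"
  using l2norm_triangle[OF sqint_diff[OF assms(1,2)] sqint_diff[OF assms(2,3)]] by simp

lemma l2norm_triangle_rev:
  assumes "f \<in> sqint M" "g \<in> sqint M"
  shows "\<bar>l2norm M f - l2norm M g\<bar> \<le> l2norm M (\<lambda>x. f x - g x)"
  using l2norm_triangle[OF sqint_diff[OF assms] assms(2)] l2norm_triangle[OF sqint_diff[OF assms(2,1)] assms(1)]
    l2norm_minus_commute[of M f g] by simp

lemma l2norm_eq_0_iff:
  assumes "f \<in> sqint M"
  shows "l2norm M f = 0 \<longleftrightarrow> (AE x in M. f x = 0)"
  using assms unfolding l2norm_def by (subst real_sqrt_eq_zero_cancel_iff, subst integral_nonneg_eq_0_iff_AE) (auto simp: sqint_def)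

lemma l2norm_integral_mult_le:
  assumes "f \<in> sqint M" "g \<in> sqint M"
  shows "(LINT x|M. cmod (f x) * cmod (g x)) \<le> l2norm M f * l2norm M g"
proof -
  have m[measurable]: "f \<in> borel_measurable M" "g \<in> borel_measurable M" using assms by (auto simp: sqint_def)
  have s: "(\<lambda>x. of_real (cmod (f x))) \<in> sqint M" "(\<lambda>x. of_real (cmod (g x))) \<in> sqint M"
    using assms by (auto simp: sqint_def)
  have "complex_of_real (LINT x|M. cmod (f x) * cmod (g x)) = l2inner M (\<lambda>x. of_real (cmod (f x))) (\<lambda>x. of_real (cmod (g x)))"
    unfolding l2inner_def by (subst integral_complex_of_real[symmetric]) simp
  then have "\<bar>LINT x|M. cmod (f x) * cmod (g x)\<bar> \<le> l2norm M (\<lambda>x. of_real (cmod (f x))) * l2norm M (\<lambda>x. of_real (cmod (g x)))"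
    using l2inner_CS[OF s] by (metis norm_of_real)
  then show ?thesis by (simp add: l2norm_def)
qed

section \<open>Fatou's lemma and completeness of L2\<close>

lemma l2norm_Fatou:
  assumes f: "f \<in> borel_measurable M" and fn: "\<And>n. g n \<in> sqint M"
    and lim: "AE x in M. (\<lambda>n. g n x) \<longlonglongrightarrow> f x" and C: "\<And>n. l2norm M (g n) \<le> C"
  shows "f \<in> sqint M" "l2norm M f \<le> C"
proof -
  have [measurable]: "f \<in> borel_measurable M" "\<And>n. g n \<in> borel_measurable M" using f fn by (auto simp: sqint_def)
  have C0: "0 \<le> C" using C[of 0] l2norm_nonneg order_trans by blast
  have "(\<integral>\<^sup>+x. ennreal ((cmod (f x))\<^sup>2) \<partial>M) = (\<integral>\<^sup>+x. liminf (\<lambda>n. ennreal ((cmod (g n x))\<^sup>2)) \<partial>M)"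
  proof (rule nn_integral_cong_AE)
    show "AE x in M. ennreal ((cmod (f x))\<^sup>2) = liminf (\<lambda>n. ennreal ((cmod (g n x))\<^sup>2))"
      using lim
    proof eventually_elim
      case (elim x)
      have "(\<lambda>n. ennreal ((cmod (g n x))\<^sup>2)) \<longlonglongrightarrow> ennreal ((cmod (f x))\<^sup>2)"
        by (intro tendsto_ennrealI tendsto_intros elim)
      then show ?case by (intro lim_imp_Liminf[symmetric]) auto
    qed
  qed
  also have "\<dots> \<le> liminf (\<lambda>n. \<integral>\<^sup>+x. ennreal ((cmod (g n x))\<^sup>2) \<partial>M)"
    by (rule nn_integral_liminf) simp
  also have "\<dots> \<le> ennreal (C\<^sup>2)"
  proof (rule Liminf_le)
    show "\<forall>\<^sub>F n in sequentially. (\<integral>\<^sup>+x. ennreal ((cmod (g n x))\<^sup>2) \<partial>M) \<le> ennreal (C\<^sup>2)"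
      using C by (auto simp: nn_integral_l2norm[OF fn] intro!: always_eventually ennreal_leI power_mono)
  qed simp
  finally show "f \<in> sqint M" "l2norm M f \<le> C" using C0 by (auto intro!: nn_integral_l2norm_le)
qed

text \<open>The measure may be infinite, so L2 bounds on the increments give no L1 bounds. Instead
  the series of \<open>2^n * (cmod (d n x))\<^sup>2\<close> has finite integral, and y \<le> (1/2)^n
  + 2^n y^2 holds for every y \<ge> 0.\<close>

lemma summable_AE_l2:
  assumes d: "\<And>n. d n \<in> sqint M" and le: "\<And>n. l2norm M (d n) \<le> (1/2)^n"
  shows "AE x in M. summable (\<lambda>n. cmod (d n x))"
proof -
  have [measurable]: "\<And>n. d n \<in> borel_measurable M" using d by (auto simp: sqint_def)
  have "(\<integral>\<^sup>+x. (\<Sum>n. ennreal (2^n * (cmod (d n x))\<^sup>2)) \<partial>M) = (\<Sum>n. \<integral>\<^sup>+x. ennreal (2^n * (cmod (d n x))\<^sup>2) \<partial>M)"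
    by (rule nn_integral_suminf) simp
  also have "\<dots> \<le> (\<Sum>n. ennreal ((1/2)^n))"
  proof (intro suminf_le)
    fix n
    have "(\<integral>\<^sup>+x. ennreal (2^n * (cmod (d n x))\<^sup>2) \<partial>M) = ennreal (2^n * (l2norm M (d n))\<^sup>2)"
      using nn_integral_l2norm[OF d, of n] by (simp add: ennreal_mult nn_integral_cmult)
    also have "\<dots> \<le> ennreal (2^n * ((1/2)^n)\<^sup>2)"
      using le by (intro ennreal_leI mult_left_mono power_mono) auto
    also have "2^n * ((1/2)^n)\<^sup>2 = (1/2::real)^n"
      by (simp add: power2_eq_square power_divide field_simps flip: power_mult_distrib)
    finally show "(\<integral>\<^sup>+x. ennreal (2^n * (cmod (d n x))\<^sup>2) \<partial>M) \<le> ennreal ((1/2)^n)" .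
  qed auto
  also have "\<dots> < \<infinity>"
    by (subst suminf_ennreal_eq[OF _ geometric_sums[of "1/2::real"]]) auto
  finally have "AE x in M. (\<Sum>n. ennreal (2^n * (cmod (d n x))\<^sup>2)) \<noteq> \<infinity>"
    by (intro nn_integral_noteq_infinite) auto
  then show ?thesis
  proof eventually_elim
    case (elim x)
    then have 1: "summable (\<lambda>n. 2^n * (cmod (d n x))\<^sup>2)"
      by (intro summable_suminf_not_top) auto
    show ?case
    proof (rule summable_comparison_test[OF exI, of 0])
      show "summable (\<lambda>n. (1/2)^n + 2^n * (cmod (d n x))\<^sup>2)" by (intro summable_add 1) (simp add: summable_geometric)
      show "\<forall>n\<ge>0. norm (cmod (d n x)) \<le> (1/2)^n + 2^n * (cmod (d n x))\<^sup>2"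
      proof (intro allI impI)
        fix n
        let ?y = "cmod (d n x)"
        show "norm ?y \<le> (1/2)^n + 2^n * ?y\<^sup>2"
        proof (cases "?y \<le> (1/2)^n")
          case True then show ?thesis by (simp add: add_increasing2)
        next
          case False
          then have "1 \<le> 2^n * ?y" by (simp add: power_divide field_simps)
          then have "?y * 1 \<le> ?y * (2^n * ?y)" by (intro mult_left_mono) auto
          then have "?y \<le> 2^n * ?y\<^sup>2" by (simp add: power2_eq_square ac_simps)
          moreover have "0 \<le> (1/2::real)^n" by simp
          ultimately show ?thesis unfolding real_norm_def abs_norm_cancel by linarith
        qed
      qed
    qed
  qed
qed

text \<open>Along a subsequence with increments below \<open>(1/2)^n\<close> the functions converge
  almost everywhere; \<open>lim\<close> takes an irrelevant value on the exceptional null set.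
  Fatou's lemma, applied to the differences from a fixed \<open>f m\<close>, turns this into
  convergence in norm of the whole sequence.\<close>

lemma l2_complete:
  assumes f: "\<And>n. f n \<in> sqint M"
    and cauchy: "\<And>e. e > 0 \<Longrightarrow> \<exists>N. \<forall>m\<ge>N. \<forall>n\<ge>N. l2norm M (\<lambda>x. f m x - f n x) < e"
  shows "\<exists>g\<in>sqint M. (\<lambda>n. l2norm M (\<lambda>x. f n x - g x)) \<longlonglongrightarrow> 0"
proof -
  have fm[measurable]: "\<And>n. f n \<in> borel_measurable M" using f by (auto simp: sqint_def)
  have "\<exists>r::nat\<Rightarrow>nat. \<forall>n. (\<forall>m\<ge>r n. \<forall>k\<ge>r n. l2norm M (\<lambda>x. f m x - f k x) < (1/2)^n) \<and> r n < r (Suc n)"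
  proof (rule dependent_nat_choice)
    show "\<exists>r. \<forall>m\<ge>r. \<forall>k\<ge>r. l2norm M (\<lambda>x. f m x - f k x) < (1/2)^0" using cauchy[of "(1/2)^0"] by auto
    fix r n
    obtain N where "\<forall>m\<ge>N. \<forall>k\<ge>N. l2norm M (\<lambda>x. f m x - f k x) < (1/2)^Suc n" using cauchy[of "(1/2)^Suc n"] by auto
    then show "\<exists>y. (\<forall>m\<ge>y. \<forall>k\<ge>y. l2norm M (\<lambda>x. f m x - f k x) < (1/2)^Suc n) \<and> r < y"
      by (intro exI[of _ "max N (Suc r)"]) auto
  qed
  then obtain r :: "nat \<Rightarrow> nat" where r: "\<And>n. r n < r (Suc n)"
    and rc: "\<And>n m k. m \<ge> r n \<Longrightarrow> k \<ge> r n \<Longrightarrow> l2norm M (\<lambda>x. f m x - f k x) < (1/2)^n" by blast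
  have rm: "strict_mono r" using r by (simp add: strict_mono_Suc_iff)
  define g where "g x = lim (\<lambda>n. f (r n) x)" for x
  have gm[measurable]: "g \<in> borel_measurable M" unfolding g_def by measurable
  have "AE x in M. summable (\<lambda>n. cmod (f (r (Suc n)) x - f (r n) x))"
    using rc r by (intro summable_AE_l2 sqint_diff f less_imp_le) (auto simp: less_imp_le)
  then have lim: "AE x in M. (\<lambda>n. f (r n) x) \<longlonglongrightarrow> g x"
  proof eventually_elim
    case (elim x)
    then have "summable (\<lambda>n. f (r (Suc n)) x - f (r n) x)" by (rule summable_norm_cancel)
    then have "convergent (\<lambda>n. \<Sum>i<n. f (r (Suc i)) x - f (r i) x)" by (simp add: summable_iff_convergent)
    then have "convergent (\<lambda>n. f (r n) x - f (r 0) x)" by (simp add: sum_lessThan_telescope[of "\<lambda>i. f (r i) x"])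
    then have "convergent (\<lambda>n. f (r n) x - f (r 0) x + f (r 0) x)" by (intro convergent_add convergent_const)
    then have "convergent (\<lambda>n. f (r n) x)" by simp
    then show ?case unfolding g_def by (simp add: convergent_LIMSEQ_iff)
  qed
  have *: "(\<lambda>x. f m x - g x) \<in> sqint M \<and> l2norm M (\<lambda>x. f m x - g x) \<le> (1/2)^n" if "m \<ge> r n" for m n
  proof -
    have "(\<lambda>x. f m x - g x) \<in> sqint M" "l2norm M (\<lambda>x. f m x - g x) \<le> (1/2)^n"
    proof (rule_tac [1-2] l2norm_Fatou[where g="\<lambda>k x. f m x - f (r (k + n)) x"])
      show "l2norm M (\<lambda>x. f m x - f (r (k + n)) x) \<le> (1/2)^n" for k
        using rc[OF that] rm by (simp add: strict_mono_less_eq less_imp_le)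
      then show "l2norm M (\<lambda>x. f m x - f (r (k + n)) x) \<le> (1/2)^n" for k .
      show "AE x in M. (\<lambda>k. f m x - f (r (k + n)) x) \<longlonglongrightarrow> f m x - g x"
        using lim by eventually_elim (auto intro!: tendsto_intros LIMSEQ_ignore_initial_segment)
      then show "AE x in M. (\<lambda>k. f m x - f (r (k + n)) x) \<longlonglongrightarrow> f m x - g x" .
    qed (auto intro!: sqint_diff f)
    then show ?thesis ..
  qed
  have "(\<lambda>x. f (r 0) x - (f (r 0) x - g x)) \<in> sqint M"
    by (rule sqint_diff[OF f]) (use *[of 0 "r 0"] in simp)
  then have g: "g \<in> sqint M" by simp
  moreover have "(\<lambda>n. l2norm M (\<lambda>x. f n x - g x)) \<longlonglongrightarrow> 0"
  proof (rule LIMSEQ_I)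
    fix e :: real assume "0 < e"
    then obtain n where "(1/2)^n < e" using real_arch_pow_inv[of e "1/2"] by auto
    then show "\<exists>no. \<forall>n\<ge>no. norm (l2norm M (\<lambda>x. f n x - g x) - 0) < e"
      using * by (intro exI[of _ "r n"]) (auto intro: le_less_trans)
  qed
  ultimately show ?thesis by blast
qed

lemma tendsto_l2norm:
  assumes "\<And>n. f n \<in> sqint M" "g \<in> sqint M" "(\<lambda>n. l2norm M (\<lambda>x. f n x - g x)) \<longlonglongrightarrow> 0"
  shows "(\<lambda>n. l2norm M (f n)) \<longlonglongrightarrow> l2norm M g"
proof (rule LIM_zero_cancel, rule Lim_null_comparison[OF _ assms(3)])
  show "\<forall>\<^sub>F n in sequentially. norm (l2norm M (f n) - l2norm M g) \<le> l2norm M (\<lambda>x. f n x - g x)"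
    using assms by (intro always_eventually allI) (simp add: l2norm_triangle_rev)
qed

lemma tendsto_l2inner:
  assumes f: "\<And>n. f n \<in> sqint M" "f' \<in> sqint M" "(\<lambda>n. l2norm M (\<lambda>x. f n x - f' x)) \<longlonglongrightarrow> 0"
    and g: "\<And>n. g n \<in> sqint M" "g' \<in> sqint M" "(\<lambda>n. l2norm M (\<lambda>x. g n x - g' x)) \<longlonglongrightarrow> 0"
  shows "(\<lambda>n. l2inner M (f n) (g n)) \<longlonglongrightarrow> l2inner M f' g'"
proof (rule LIM_zero_cancel, rule Lim_null_comparison)
  have "l2inner M (f n) (g n) - l2inner M f' g' = l2inner M (f n) (\<lambda>x. g n x - g' x) + l2inner M (\<lambda>x. f n x - f' x) g'" for n
    using f g by (simp add: l2inner_diff_left l2inner_diff_right)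
  then have "cmod (l2inner M (f n) (g n) - l2inner M f' g') \<le>
     l2norm M (f n) * l2norm M (\<lambda>x. g n x - g' x) + l2norm M (\<lambda>x. f n x - f' x) * l2norm M g'" for n
    using f g by (auto intro!: norm_triangle_le add_mono l2inner_CS sqint_diff)
  then show "\<forall>\<^sub>F n in sequentially. cmod (l2inner M (f n) (g n) - l2inner M f' g') \<le>
     l2norm M (f n) * l2norm M (\<lambda>x. g n x - g' x) + l2norm M (\<lambda>x. f n x - f' x) * l2norm M g'" by auto
  have "(\<lambda>n. l2norm M (f n) * l2norm M (\<lambda>x. g n x - g' x) + l2norm M (\<lambda>x. f n x - f' x) * l2norm M g') \<longlonglongrightarrow>
     l2norm M f' * 0 + 0 * l2norm M g'"
    by (intro tendsto_intros tendsto_l2norm f g)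
  then show "(\<lambda>n. l2norm M (f n) * l2norm M (\<lambda>x. g n x - g' x) + l2norm M (\<lambda>x. f n x - f' x) * l2norm M g') \<longlonglongrightarrow> 0"
    by simp
qed

section \<open>Density of step functions and weak compactness\<close>

lemma l2_dominated_convergence:
  fixes s :: "nat \<Rightarrow> 'a \<Rightarrow> complex"
  assumes s: "\<And>n. s n \<in> borel_measurable M" and f: "f \<in> borel_measurable M"
    and w: "w \<in> borel_measurable M" "integrable M (\<lambda>x. (w x :: real)\<^sup>2)"
    and lim: "AE x in M. (\<lambda>n. s n x) \<longlonglongrightarrow> f x" and le: "\<And>n x. cmod (s n x) \<le> w x"
  shows "f \<in> sqint M" "\<And>n. s n \<in> sqint M" "(\<lambda>n. l2norm M (\<lambda>x. s n x - f x)) \<longlonglongrightarrow> 0"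
proof -
  note [measurable] = s f w(1)
  have w0: "0 \<le> w x" for x using le[of 0 x] norm_ge_zero order_trans by blast
  have sq: "(cmod (s n x))\<^sup>2 \<le> (w x)\<^sup>2" for n x using le by (intro power_mono) auto
  show s2: "s n \<in> sqint M" for n
    by (intro sqintI Bochner_Integration.integrable_bound[OF w(2)]) (use sq in auto)
  have lef: "AE x in M. cmod (f x) \<le> w x"
    using lim by eventually_elim (auto intro: LIMSEQ_le_const2[OF tendsto_norm] le)
  then have "AE x in M. (cmod (f x))\<^sup>2 \<le> (w x)\<^sup>2"
    by eventually_elim (auto intro: power_mono)
  then show f2: "f \<in> sqint M"
    by (intro sqintI Bochner_Integration.integrable_bound[OF w(2)]) auto
  have "(\<lambda>n. LINT x|M. (cmod (s n x - f x))\<^sup>2) \<longlonglongrightarrow> (LINT x|M. 0)"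
  proof (rule integral_dominated_convergence[where w="\<lambda>x. 4 * (w x)\<^sup>2"])
    show "AE x in M. (\<lambda>n. (cmod (s n x - f x))\<^sup>2) \<longlonglongrightarrow> 0"
      using lim
    proof eventually_elim
      case (elim x)
      have "(\<lambda>n. (cmod (s n x - f x))\<^sup>2) \<longlonglongrightarrow> (cmod (f x - f x))\<^sup>2" by (intro tendsto_intros elim)
      then show ?case by simp
    qed
    show "AE x in M. norm ((cmod (s n x - f x))\<^sup>2) \<le> 4 * (w x)\<^sup>2" for n
      using lef
    proof eventually_elim
      case (elim x)
      have "(cmod (s n x - f x))\<^sup>2 \<le> (2 * w x)\<^sup>2"
        using elim le[of n x] by (intro power_mono) (auto intro: order_trans[OF norm_triangle_ineq4])
      then show ?case by (simp add: power_mult_distrib)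
    qed
  qed (use w in auto)
  then have "(\<lambda>n. sqrt (LINT x|M. (cmod (s n x - f x))\<^sup>2)) \<longlonglongrightarrow> sqrt 0"
    by (intro tendsto_real_sqrt) simp
  then show "(\<lambda>n. l2norm M (\<lambda>x. s n x - f x)) \<longlonglongrightarrow> 0" by (simp add: l2norm_def)
qed

lemma sqint_indicator_Ioc [simp]: "(indicator {a<..b::real} :: real \<Rightarrow> complex) \<in> sqint lborel"
proof (intro sqintI)
  have "(\<lambda>x. (cmod (indicator {a<..b} x))\<^sup>2) = (indicator {a<..b} :: real \<Rightarrow> real)"
    by (auto simp: indicator_def)
  then show "integrable lborel (\<lambda>x. (cmod (indicator {a<..b} x :: complex))\<^sup>2)"
    by (cases "a \<le> b") (auto intro!: integrable_real_indicator)
qed simp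

lemma integrable_indicator_Ioc_sq: "integrable lborel (\<lambda>x. (indicator {a<..b::real} x :: real)\<^sup>2)"
proof -
  have "(\<lambda>x. (indicator {a<..b} x :: real)\<^sup>2) = indicator {a<..b}" by (auto simp: indicator_def)
  then show ?thesis by (cases "a \<le> b") (auto intro!: integrable_real_indicator)
qed

lemma sqint_indicator_Int_Ioc:
  assumes "A \<in> sets borel"
  shows "(indicator (A \<inter> {a<..b::real}) :: real \<Rightarrow> complex) \<in> sqint lborel"
proof -
  have "indicator (A \<inter> {a<..b}) = (\<lambda>x. indicator A x * indicator {a<..b} x :: complex)"
    by (auto simp: indicator_def)
  moreover have "(\<lambda>x. indicator A x * indicator {a<..b} x :: complex) \<in> sqint lborel"
    by (rule sqint_bounded_mult(1)[OF sqint_indicator_Ioc, where C=1]) (use assms in \<open>auto simp: indicator_def\<close>)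
  ultimately show ?thesis by simp
qed

text \<open>Density of step functions in the form of an induction rule. Half-open intervals are an
  intersection-stable generator, so Dynkin's argument passes from them to Borel sets; every set is
  cut down to \<open>{-N<..N}\<close>, since the indicator of a Borel set alone need not be square
  integrable. Simple functions and dominated convergence do the rest.\<close>

lemma sqint_lborel_induct [consumes 1, case_names interval add cmult limit]:
  assumes f: "f \<in> sqint lborel"
    and int: "\<And>a b::real. a \<le> b \<Longrightarrow> P (indicator {a<..b})"
    and add: "\<And>f g. f \<in> sqint lborel \<Longrightarrow> g \<in> sqint lborel \<Longrightarrow> P f \<Longrightarrow> P g \<Longrightarrow> P (\<lambda>x. f x + g x)"
    and cmult: "\<And>c f. f \<in> sqint lborel \<Longrightarrow> P f \<Longrightarrow> P (\<lambda>x. c * f x)"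
    and limit: "\<And>s f. (\<And>n. s n \<in> sqint lborel) \<Longrightarrow> (\<And>n. P (s n)) \<Longrightarrow> f \<in> sqint lborel \<Longrightarrow>
       (\<lambda>n. l2norm lborel (\<lambda>x. s n x - f x)) \<longlonglongrightarrow> 0 \<Longrightarrow> P f"
  shows "P f"
proof -
  \<comment> \<open>For b < a the interval is empty and equals \<open>{a<..a}\<close>.\<close>
  have int': "P (indicator {a<..b})" for a b :: real
    using int[of a b] int[of a a] by (cases "a \<le> b") auto
  have zero: "P (\<lambda>x. 0)" using cmult[OF sqint_indicator_Ioc int'[of 0 0], of 0] by simp
  have sets: "P (indicator (A \<inter> {-N<..N}))" if A: "A \<in> sets borel" for A and N :: real
  proof -
    let ?G = "range (\<lambda>(a, b). {a<..b::real})"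
    have stable: "Int_stable ?G" by (auto simp: Int_stable_def)
    have sub: "?G \<subseteq> Pow UNIV" by auto
    have sg: "A \<in> sigma_sets UNIV ?G" using A unfolding borel_sigma_sets_Ioc by simp
    have sb: "A \<in> sets borel" if "A \<in> sigma_sets UNIV ?G" for A
      using that unfolding borel_sigma_sets_Ioc by simp
    show ?thesis
      using stable sub sg
    proof (induction rule: sigma_sets_induct_disjoint)
      case (basic A)
      then obtain a b where "A \<inter> {-N<..N} = {max a (-N)<..min b N}" by auto
      then show ?case using int' by metis
    next
      case empty then show ?case using zero by (simp add: indicator_def[abs_def])
    next
      case (compl A)
      have "indicator ((UNIV - A) \<inter> {-N<..N}) =
        (\<lambda>x. indicator {-N<..N} x + (-1) * indicator (A \<inter> {-N<..N}) x :: complex)"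
        by (auto simp: indicator_def)
      moreover have "P (\<lambda>x. indicator {-N<..N} x + (-1) * indicator (A \<inter> {-N<..N}) x)"
        using sqint_indicator_Int_Ioc[OF sb[OF compl(1)]]
        by (intro add[OF sqint_indicator_Ioc sqint_cmult int' cmult[OF _ compl(2)]])
      ultimately show ?case by simp
    next
      case (union A)
      have Ab: "A i \<in> sets borel" for i using union sb by auto
      have dis: "x \<notin> A n" if "x \<in> A i" "i < n" for x i n
        using disjoint_family_onD[OF union(1), of i n] that by auto
      let ?I = "{-N<..N}"
      have *: "(\<lambda>x. indicator ((\<Union>i<n. A i) \<inter> ?I) x) \<in> sqint lborel \<and> P (indicator ((\<Union>i<n. A i) \<inter> ?I))" for n
      proof (induction n)
        case 0 then show ?case using zero by (simp add: indicator_def[abs_def])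
      next
        case (Suc n)
        have "indicator ((\<Union>i<Suc n. A i) \<inter> ?I) = (\<lambda>x. indicator ((\<Union>i<n. A i) \<inter> ?I) x + indicator (A n \<inter> ?I) x :: complex)"
          using dis by (auto simp: indicator_def fun_eq_iff lessThan_Suc)
        then show ?case using Suc union sqint_indicator_Int_Ioc[OF Ab] by (auto intro!: add sqint_add)
      qed
      show ?case
      proof (rule limit[where s="\<lambda>n. indicator ((\<Union>i<n. A i) \<inter> ?I)"])
        show "(\<lambda>n. l2norm lborel (\<lambda>x. indicator ((\<Union>i<n. A i) \<inter> ?I) x - indicator ((\<Union>i. A i) \<inter> ?I) x)) \<longlonglongrightarrow> 0"
        proof (rule l2_dominated_convergence(3)[where w="indicator ?I"])
          show "AE x in lborel. (\<lambda>n. indicator ((\<Union>i<n. A i) \<inter> ?I) x) \<longlonglongrightarrow> (indicator ((\<Union>i. A i) \<inter> ?I) x :: complex)"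
          proof (intro AE_I2)
            fix x
            show "(\<lambda>n. indicator ((\<Union>i<n. A i) \<inter> ?I) x) \<longlonglongrightarrow> (indicator ((\<Union>i. A i) \<inter> ?I) x :: complex)"
            proof (cases "x \<in> (\<Union>i. A i)")
              case True
              then obtain i where "x \<in> A i" by auto
              then have "\<forall>\<^sub>F n in sequentially. indicator ((\<Union>i<n. A i) \<inter> ?I) x = (indicator ((\<Union>i. A i) \<inter> ?I) x :: complex)"
                by (intro eventually_sequentiallyI[of "Suc i"]) (auto simp: indicator_def)
              then show ?thesis by (rule tendsto_eventually)
            qed (auto simp: indicator_def)
          qed
          show "integrable lborel (\<lambda>x. (indicator ?I x :: real)\<^sup>2)" by (rule integrable_indicator_Ioc_sq)
        qed (use Ab in \<open>auto simp: indicator_def\<close>)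
      qed (use * Ab in \<open>auto intro!: sqint_indicator_Int_Ioc\<close>)
    qed
  qed
  have simple: "P (\<lambda>x. s x * indicator {-N<..N} x)" if s: "simple_function borel s" for s and N :: real
  proof -
    have fin: "finite (range s)" using s by (simp add: simple_function_def)
    have vm: "s -` {y} \<in> sets borel" if "y \<in> range s" for y
      using s that by (auto simp: simple_function_def)
    have *: "P (\<lambda>x. \<Sum>y\<in>Y. y * indicator (s -` {y} \<inter> {-N<..N}) x) \<and>
       (\<lambda>x. \<Sum>y\<in>Y. y * indicator (s -` {y} \<inter> {-N<..N}) x) \<in> sqint lborel" if "finite Y" "Y \<subseteq> range s" for Y
      using that
    proof (induction Y rule: finite_induct)
      case empty then show ?case using zero by simp
    next
      case (insert y Y)
      have m: "s -` {y} \<in> sets borel" using insert vm by auto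
      have eq: "(\<lambda>x. \<Sum>y\<in>insert y Y. y * indicator (s -` {y} \<inter> {-N<..N}) x) =
        (\<lambda>x. y * indicator (s -` {y} \<inter> {-N<..N}) x + (\<Sum>y\<in>Y. y * indicator (s -` {y} \<inter> {-N<..N}) x :: complex))"
        by (rule ext) (simp only: sum.insert[OF insert(1,2)])
      have IH: "P (\<lambda>x. \<Sum>y\<in>Y. y * indicator (s -` {y} \<inter> {-N<..N}) x)"
        "(\<lambda>x. \<Sum>y\<in>Y. y * indicator (s -` {y} \<inter> {-N<..N}) x) \<in> sqint lborel"
        using insert by blast+
      show ?case unfolding eq
        by (intro conjI add sqint_add cmult sqint_cmult IH sets[OF m] sqint_indicator_Int_Ioc[OF m])
    qed
    have "(\<lambda>x. s x * indicator {-N<..N} x) = (\<lambda>x. \<Sum>y\<in>range s. y * indicator (s -` {y} \<inter> {-N<..N}) x)"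
    proof
      fix x
      have "(\<Sum>y\<in>range s. y * indicator (s -` {y} \<inter> {-N<..N}) x) =
        (\<Sum>y\<in>range s. if y = s x then s x * indicator {-N<..N} x else 0)"
        by (intro sum.cong) (auto simp: indicator_def)
      also have "\<dots> = s x * indicator {-N<..N} x" using fin by simp
      finally show "s x * indicator {-N<..N} x = (\<Sum>y\<in>range s. y * indicator (s -` {y} \<inter> {-N<..N}) x)" ..
    qed
    then show ?thesis using *[OF fin] by simp
  qed
  have fm[measurable]: "f \<in> borel_measurable borel" using f by (simp add: sqint_def)
  obtain s where s: "\<And>i. simple_function borel (s i)" "\<And>x. (\<lambda>i. s i x) \<longlonglongrightarrow> f x" "\<And>i x. cmod (s i x) \<le> 2 * cmod (f x)"
    using borel_measurable_implies_sequence_metric[OF fm, of 0] by (auto simp: dist_norm)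
  have sm[measurable]: "s i \<in> borel_measurable borel" for i using s(1) borel_measurable_simple_function by blast
  let ?t = "\<lambda>i x. s i x * indicator {- real i<..real i} x"
  have lim: "AE x in lborel. (\<lambda>n. ?t n x) \<longlonglongrightarrow> f x"
  proof (intro AE_I2)
    fix x :: real
    obtain n where n: "\<bar>x\<bar> < real n" using reals_Archimedean2 by blast
    have "(\<lambda>n. indicator {- real n<..real n} x :: complex) \<longlonglongrightarrow> 1"
      by (rule tendsto_eventually, rule eventually_sequentiallyI[of n]) (use n in \<open>auto simp: indicator_def\<close>)
    from tendsto_mult[OF s(2) this] show "(\<lambda>n. ?t n x) \<longlonglongrightarrow> f x" by simp
  qed
  have le: "cmod (?t n x) \<le> 2 * cmod (f x)" for n x using s(3)[of n x] by (auto simp: indicator_def)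
  have int: "integrable lborel (\<lambda>x. (2 * cmod (f x))\<^sup>2)"
    using f by (simp add: power_mult_distrib sqint_def)
  note dom = l2_dominated_convergence[where s="?t" and M=lborel, OF _ _ _ int lim le]
  show ?thesis by (rule limit[OF dom(2) simple[OF s(1)] f dom(3)]) auto
qed

section \<open>Riesz representation and weak sequential compactness\<close>

lemma convergent_uniform_approx:
  fixes x :: "nat \<Rightarrow> 'a :: banach"
  assumes "\<And>e. 0 < e \<Longrightarrow> \<exists>y. convergent y \<and> (\<forall>n. norm (x n - y n) \<le> e)"
  shows "convergent x"
proof (rule Cauchy_convergent, rule metric_CauchyI)
  fix e :: real assume "0 < e"
  then obtain y where y: "convergent y" "\<And>n. norm (x n - y n) \<le> e / 4" using assms[of "e/4"] by auto
  then obtain N where N: "\<And>m n. m \<ge> N \<Longrightarrow> n \<ge> N \<Longrightarrow> dist (y m) (y n) < e / 4"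
    using metric_CauchyD[OF convergent_Cauchy[OF y(1)], of "e/4"] \<open>0 < e\<close> by auto
  have "dist (x m) (x n) < e" if "m \<ge> N" "n \<ge> N" for m n
  proof -
    have "x m - x n = (x m - y m) + (y m - y n) + (y n - x n)" by simp
    then have "norm (x m - x n) \<le> norm (x m - y m) + norm (y m - y n) + norm (y n - x n)"
      by (metis norm_triangle_le norm_triangle_ineq add_right_mono)
    also have "\<dots> < e" using y(2)[of m] y(2)[of n] N[OF that] \<open>0 < e\<close>
      by (simp add: norm_minus_commute[of "y n"] dist_norm)
    finally show ?thesis by (simp add: dist_norm)
  qed
  then show "\<exists>M. \<forall>m\<ge>M. \<forall>n\<ge>M. dist (x m) (x n) < e" by blast
qed

text \<open>The first-order condition at a minimum, without derivatives. It asks for |t| \<le> 1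
  only, because in the Euler--Lagrange argument the quadratic coefficient is bounded only for such
  t.\<close>

lemma quadratic_nonneg_imp_linear_coeff_zero:
  fixes a b :: real
  assumes "\<And>t. \<bar>t\<bar> \<le> 1 \<Longrightarrow> 0 \<le> t * b + t\<^sup>2 * a"
  shows "b = 0"
proof (rule ccontr)
  assume "b \<noteq> 0"
  \<comment> \<open>Larger than a, so that the value at t = -b/c is negative, and larger than |b|,
    so that this t is admissible.\<close>
  define c where "c = \<bar>a\<bar> + \<bar>b\<bar> + 1"
  have c: "c > 0" "a < c" by (auto simp: c_def)
  have "0 \<le> (- b / c) * b + (- b / c)\<^sup>2 * a"
    by (rule assms) (use c(1) in \<open>simp add: c_def\<close>)
  also have "\<dots> < (- b / c) * b + (- b / c)\<^sup>2 * c"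
    using c \<open>b \<noteq> 0\<close> by (intro add_strict_left_mono mult_strict_left_mono) auto
  also have "\<dots> = 0" using c by (simp add: power2_eq_square)
  finally show False by simp
qed

text \<open>The representing element minimizes \<open>\<parallel>h\<parallel>\<^sup>2 - 2 Re (l h)\<close>; minimizing sequences are Cauchy by the
  parallelogram law.\<close>

lemma l2_Riesz:
  fixes l :: "('a \<Rightarrow> complex) \<Rightarrow> complex"
  assumes add: "\<And>f g. f \<in> sqint M \<Longrightarrow> g \<in> sqint M \<Longrightarrow> l (\<lambda>x. f x + g x) = l f + l g"
    and cmult: "\<And>c f. f \<in> sqint M \<Longrightarrow> l (\<lambda>x. c * f x) = cnj c * l f"
    and bdd: "\<And>f. f \<in> sqint M \<Longrightarrow> cmod (l f) \<le> C * l2norm M f"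
  shows "\<exists>g\<in>sqint M. \<forall>f\<in>sqint M. l f = l2inner M f g"
proof -
  define J where "J h = (l2norm M h)\<^sup>2 - 2 * Re (l h)" for h
  have J_ge: "- C\<^sup>2 \<le> J h" if "h \<in> sqint M" for h
  proof -
    have "Re (l h) \<le> C * l2norm M h" using bdd[OF that] complex_Re_le_cmod order_trans by blast
    moreover have "0 \<le> (l2norm M h - C)\<^sup>2" by simp
    then have "2 * (C * l2norm M h) \<le> (l2norm M h)\<^sup>2 + C\<^sup>2" by (simp add: power2_diff algebra_simps)
    ultimately show ?thesis unfolding J_def by linarith
  qed
  define m where "m = Inf (J ` sqint M)"
  have bb: "bdd_below (J ` sqint M)" using J_ge by (auto intro!: bdd_belowI)
  have mle: "m \<le> J h" if "h \<in> sqint M" for h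
    unfolding m_def using that bb by (intro cInf_lower) auto
  have "\<exists>h\<in>sqint M. J h < m + inverse (real (Suc n))" for n
  proof -
    have "Inf (J ` sqint M) < m + inverse (real (Suc n))" by (simp add: m_def)
    moreover have "J ` sqint M \<noteq> {}" using sqint_zero[of M] by blast
    ultimately obtain y where "y \<in> J ` sqint M" "y < m + inverse (real (Suc n))" using cInf_lessD by metis
    then show ?thesis by auto
  qed
  then obtain h where h: "\<And>n. h n \<in> sqint M" "\<And>n. J (h n) < m + inverse (real (Suc n))" by metis
  \<comment> \<open>The midpoint of f and g is a competitor too, with value at least m.\<close>
  have par: "(l2norm M (\<lambda>x. f x - g x))\<^sup>2 \<le> 2 * J f + 2 * J g - 4 * m" if "f \<in> sqint M" "g \<in> sqint M" for f g
  proof -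
    let ?c = "1 / 2 :: complex"
    have s: "(\<lambda>x. f x + g x) \<in> sqint M" using that by (rule sqint_add)
    have "m \<le> J (\<lambda>x. ?c * (f x + g x))" using s by (intro mle sqint_cmult)
    also have "\<dots> = (l2norm M (\<lambda>x. f x + g x))\<^sup>2 / 4 - (Re (l f) + Re (l g))"
      unfolding J_def l2norm_cmult cmult[OF s] add[OF that] by (simp add: power_divide field_simps)
    finally show ?thesis unfolding J_def l2norm_diff_sq[OF that] l2norm_add_sq[OF that] by (simp add: field_simps)
  qed
  have "\<exists>g\<in>sqint M. (\<lambda>n. l2norm M (\<lambda>x. h n x - g x)) \<longlonglongrightarrow> 0"
  proof (rule l2_complete[OF h(1)])
    fix e :: real assume "0 < e"
    then obtain N where N: "inverse (real (Suc N)) < e\<^sup>2 / 4" using reals_Archimedean[of "e\<^sup>2/4"] by auto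
    have "l2norm M (\<lambda>x. h k x - h n x) < e" if "k \<ge> N" "n \<ge> N" for k n
    proof -
      have "inverse (real (Suc k)) \<le> inverse (real (Suc N))" "inverse (real (Suc n)) \<le> inverse (real (Suc N))"
        using that by (auto intro!: le_imp_inverse_le)
      then have "(l2norm M (\<lambda>x. h k x - h n x))\<^sup>2 < e\<^sup>2"
        using par[OF h(1) h(1), of k n] h(2)[of k] h(2)[of n] N by linarith
      then show ?thesis using \<open>0 < e\<close> by (intro power2_less_imp_less[of _ e]) auto
    qed
    then show "\<exists>N. \<forall>m\<ge>N. \<forall>n\<ge>N. l2norm M (\<lambda>x. h m x - h n x) < e" by blast
  qed
  then obtain g where g: "g \<in> sqint M" and lim: "(\<lambda>n. l2norm M (\<lambda>x. h n x - g x)) \<longlonglongrightarrow> 0" by blast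
  have "(\<lambda>n. l (h n)) \<longlonglongrightarrow> l g"
  proof (rule LIM_zero_cancel, rule Lim_null_comparison)
    have "l (h n) - l g = l (\<lambda>x. h n x - g x)" for n
      using add[OF h(1) sqint_cmult[OF g, of "-1"], of n] cmult[OF g, of "-1"] by simp
    then show "\<forall>\<^sub>F n in sequentially. cmod (l (h n) - l g) \<le> C * l2norm M (\<lambda>x. h n x - g x)"
      using bdd[OF sqint_diff[OF h(1) g]] by simp
    show "(\<lambda>n. C * l2norm M (\<lambda>x. h n x - g x)) \<longlonglongrightarrow> 0" using tendsto_mult_left[OF lim, of C] by simp
  qed
  then have "(\<lambda>n. J (h n)) \<longlonglongrightarrow> J g"
    unfolding J_def by (intro tendsto_intros tendsto_l2norm h g lim)
  moreover have "(\<lambda>n. m + inverse (real (Suc n))) \<longlonglongrightarrow> m + 0"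
    by (intro tendsto_intros LIMSEQ_inverse_real_of_nat)
  ultimately have Jg: "J g \<le> m" using h(2) by (intro LIMSEQ_le[where X="\<lambda>n. J (h n)"]) (auto intro: less_imp_le)
  have Re0: "Re (l2inner M f g - l f) = 0" if f: "f \<in> sqint M" for f
  proof -
    have "2 * Re (l2inner M f g - l f) = 0"
    proof (rule quadratic_nonneg_imp_linear_coeff_zero[where a="(l2norm M f)\<^sup>2"])
      fix t :: real
      let ?tf = "\<lambda>x. of_real t * f x"
      have tf: "?tf \<in> sqint M" using f by (rule sqint_cmult)
      have "m \<le> J (\<lambda>x. g x + ?tf x)" by (intro mle sqint_add g tf)
      moreover have "J (\<lambda>x. g x + ?tf x) = J g + (t * (2 * Re (l2inner M f g - l f)) + t\<^sup>2 * (l2norm M f)\<^sup>2)"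
      proof -
        have "Re (l2inner M g ?tf) = t * Re (l2inner M f g)"
          unfolding l2inner_cmult_right by (subst l2inner_cnj[symmetric]) simp
        then show ?thesis
          unfolding J_def l2norm_add_sq[OF g tf] add[OF g tf] cmult[OF f] l2norm_cmult
          by (simp add: algebra_simps)
      qed
      ultimately show "0 \<le> t * (2 * Re (l2inner M f g - l f)) + t\<^sup>2 * (l2norm M f)\<^sup>2" using Jg by linarith
    qed
    then show ?thesis by simp
  qed
  have "l f = l2inner M f g" if f: "f \<in> sqint M" for f
  proof (rule complex_eqI)
    show "Re (l f) = Re (l2inner M f g)" using Re0[OF f] by simp
    \<comment> \<open>The variation sees real parts; replacing f by \<i> f gives the imaginary
      part.\<close>
    show "Im (l f) = Im (l2inner M f g)"
      using Re0[OF sqint_cmult[OF f, of \<i>]] unfolding cmult[OF f] l2inner_cmult_left by simp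
  qed
  then show ?thesis using g by blast
qed

text \<open>A diagonal subsequence makes the inner products with the countably many intervals with
  rational endpoints converge. Density of step functions and the uniform norm bound extend this to
  every test function, and the limit is a bounded conjugate-linear functional, hence represented by
  an element of L2.\<close>

lemma l2_weak_compact:
  fixes f :: "nat \<Rightarrow> real \<Rightarrow> complex"
  assumes f: "\<And>n. f n \<in> sqint lborel" and C: "\<And>n. l2norm lborel (f n) \<le> C"
  shows "\<exists>r g. strict_mono r \<and> g \<in> sqint lborel \<and>
    (\<forall>h\<in>sqint lborel. (\<lambda>n. l2inner lborel h (f (r n))) \<longlonglongrightarrow> l2inner lborel h g)"
proof -
  let ?ip = "l2inner lborel" and ?nm = "l2norm lborel"
  have C0: "0 \<le> C" using C[of 0] l2norm_nonneg order_trans by blast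
  have ip_le: "cmod (?ip h (f n)) \<le> C * ?nm h" if "h \<in> sqint lborel" for h n
    using l2inner_CS[OF that f] mult_left_mono[OF C l2norm_nonneg] by (metis order_trans mult.commute)
  define I :: "nat \<Rightarrow> real \<Rightarrow> complex" where
    "I n = (case from_nat n :: rat \<times> rat of (a, b) \<Rightarrow> indicator {of_rat a<..of_rat b})" for n
  have I: "I n \<in> sqint lborel" for n by (auto simp: I_def split: prod.split)
  interpret subseqs "\<lambda>n s. convergent (\<lambda>i. ?ip (I n) (f (s i)))"
  proof
    fix n and s :: "nat \<Rightarrow> nat"
    have "bounded (range (\<lambda>i. ?ip (I n) (f (s i))))"
      using ip_le[OF I] by (intro boundedI) auto
    then show "\<exists>r'. strict_mono r' \<and> convergent (\<lambda>i. ?ip (I n) (f ((s \<circ> r') i)))"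
      using bounded_imp_convergent_subsequence by (fastforce simp: convergent_def o_def)
  qed
  define r where "r = diagseq"
  have r: "strict_mono r" unfolding r_def by (rule subseq_diagseq)
  have conv_I: "convergent (\<lambda>i. ?ip (I k) (f (r i)))" for k
  proof -
    \<comment> \<open>The diagonal sequence is a subsequence of the k-th stage only from index
      \<open>Suc k\<close> on; convergence is not affected by the initial terms.\<close>
    have "convergent (\<lambda>i. ?ip (I k) (f ((diagseq \<circ> (+) (Suc k)) i)))"
    proof (rule diagseq_holds)
      fix r s n assume r: "strict_mono (r :: nat \<Rightarrow> nat)" and c: "convergent (\<lambda>i. ?ip (I n) (f (s i)))"
      show "convergent (\<lambda>i. ?ip (I n) (f ((s \<circ> r) i)))"
        using convergent_subseq_convergent[OF c r] by (simp add: o_def)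
    qed
    then have "convergent (\<lambda>i. ?ip (I k) (f (r (i + Suc k))))" by (simp add: r_def o_def add.commute)
    then show ?thesis by (subst (asm) convergent_ignore_initial_segment)
  qed
  have conv: "convergent (\<lambda>i. ?ip h (f (r i)))" if "h \<in> sqint lborel" for h
    using that
  proof (induction rule: sqint_lborel_induct)
    case (add g h)
    then show ?case using f by (simp add: l2inner_add_left convergent_add)
  next
    case (cmult c h)
    then show ?case unfolding l2inner_cmult_left by (intro convergent_mult convergent_const)
  next
    case (limit s h)
    show ?case
    proof (rule convergent_uniform_approx)
      fix e :: real assume "0 < e"
      \<comment> \<open>\<open>C + 1\<close> instead of \<open>C\<close>, which may be 0.\<close>
      then obtain k where k: "norm (?nm (\<lambda>x. s k x - h x) - 0) < e / (C + 1)"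
        using LIMSEQ_D[OF limit(3), of "e / (C + 1)"] C0 by auto
      have "cmod (?ip h (f (r n)) - ?ip (s k) (f (r n))) \<le> e" for n
      proof -
        have "cmod (?ip h (f (r n)) - ?ip (s k) (f (r n))) = cmod (?ip (\<lambda>x. s k x - h x) (f (r n)))"
          using limit f by (simp add: l2inner_diff_left norm_minus_commute)
        also have "\<dots> \<le> C * ?nm (\<lambda>x. s k x - h x)" by (intro ip_le sqint_diff limit)
        also have "\<dots> \<le> (C + 1) * ?nm (\<lambda>x. s k x - h x)" by (intro mult_right_mono) auto
        also have "\<dots> \<le> e" using k C0 by (simp add: field_simps)
        finally show ?thesis .
      qed
      then show "\<exists>y. convergent y \<and> (\<forall>n. norm (?ip h (f (r n)) - y n) \<le> e)"
        using limit(4)[of k] by blast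
    qed
  next
    case (interval a b)
    \<comment> \<open>Both endpoints are approximated from the right: then a stays excluded and b
      stays included, so the indicators of half-open intervals converge at every point.\<close>
    have "\<exists>q. a < of_rat q \<and> of_rat q < a + inverse (real (Suc n))" for n and a :: real
      by (intro of_rat_dense) auto
    then have "\<forall>n a. \<exists>q. a < of_rat q \<and> of_rat q < a + inverse (real (Suc n))" by blast
    then obtain p where p: "\<And>n a. a < of_rat (p n a)" "\<And>n a. of_rat (p n a) < a + inverse (real (Suc n))"
      unfolding choice_iff by blast
    have pl: "(\<lambda>n. real_of_rat (p n a)) \<longlonglongrightarrow> a" for a
    proof (rule real_tendsto_sandwich[where f="\<lambda>_. a" and h="\<lambda>n. a + inverse (real (Suc n))"])
      show "(\<lambda>n. a + inverse (real (Suc n))) \<longlonglongrightarrow> a"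
        using tendsto_add[OF tendsto_const LIMSEQ_inverse_real_of_nat, of a] by simp
    qed (use p in \<open>auto intro!: always_eventually less_imp_le\<close>)
    let ?s = "\<lambda>n. indicator {real_of_rat (p n a)<..real_of_rat (p n b)} :: real \<Rightarrow> complex"
    have sI: "?s n = I (to_nat (p n a, p n b))" for n by (simp add: I_def)
    have lim: "(\<lambda>n. ?nm (\<lambda>x. ?s n x - indicator {a<..b} x)) \<longlonglongrightarrow> 0"
    proof (rule l2_dominated_convergence(3)[where w="indicator {a<..b + 1}"])
      show "AE x in lborel. (\<lambda>n. ?s n x) \<longlonglongrightarrow> indicator {a<..b} x"
      proof (intro AE_I2 tendsto_eventually)
        fix x
        consider "x \<le> a" | "a < x" "x \<le> b" | "b < x" by linarith
        then show "\<forall>\<^sub>F n in sequentially. ?s n x = indicator {a<..b} x"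
        proof cases
          case 1
          then show ?thesis using p(1)[of a] by (auto simp: indicator_def not_less intro!: always_eventually) (meson less_le_trans not_le less_imp_le order.strict_trans)
        next
          case 2
          have "\<forall>\<^sub>F n in sequentially. real_of_rat (p n a) < x" using order_tendstoD(2)[OF pl] 2 by auto
          then show ?thesis by eventually_elim (use 2 p(1)[of b] in \<open>auto simp: indicator_def intro: less_imp_le order.strict_trans1\<close>)
        next
          case 3
          have "\<forall>\<^sub>F n in sequentially. real_of_rat (p n b) < x" using order_tendstoD(2)[OF pl] 3 by auto
          then show ?thesis by eventually_elim (use 3 in \<open>auto simp: indicator_def\<close>)
        qed
      qed
      show "cmod (?s n x) \<le> indicator {a<..b + 1} x" for n x
      proof -
        have "of_rat (p n b) \<le> b + 1"
          using p(2)[of n b] inverse_le_1_iff[of "real (Suc n)"] by simp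
        then show ?thesis using p(1)[of a n] by (auto simp: indicator_def)
      qed
    qed (auto simp: integrable_indicator_Ioc_sq)
    show ?case
    proof (rule convergent_uniform_approx)
      fix e :: real assume "0 < e"
      then obtain k where k: "norm (?nm (\<lambda>x. ?s k x - indicator {a<..b} x) - 0) < e / (C + 1)"
        using LIMSEQ_D[OF lim, of "e / (C + 1)"] C0 by auto
      have "cmod (?ip (indicator {a<..b}) (f (r n)) - ?ip (?s k) (f (r n))) \<le> e" for n
      proof -
        have "cmod (?ip (indicator {a<..b}) (f (r n)) - ?ip (?s k) (f (r n))) = cmod (?ip (\<lambda>x. ?s k x - indicator {a<..b} x) (f (r n)))"
          using f by (simp add: l2inner_diff_left norm_minus_commute)
        also have "\<dots> \<le> C * ?nm (\<lambda>x. ?s k x - indicator {a<..b} x)" by (intro ip_le sqint_diff) auto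
        also have "\<dots> \<le> (C + 1) * ?nm (\<lambda>x. ?s k x - indicator {a<..b} x)" by (intro mult_right_mono) auto
        also have "\<dots> \<le> e" using k C0 by (simp add: field_simps)
        finally show ?thesis .
      qed
      then show "\<exists>y. convergent y \<and> (\<forall>n. norm (?ip (indicator {a<..b}) (f (r n)) - y n) \<le> e)"
        using conv_I[of "to_nat (p k a, p k b)"] sI by metis
    qed
  qed
  define l where "l h = lim (\<lambda>i. ?ip h (f (r i)))" for h
  have l: "(\<lambda>i. ?ip h (f (r i))) \<longlonglongrightarrow> l h" if "h \<in> sqint lborel" for h
    using conv[OF that] by (simp add: l_def convergent_LIMSEQ_iff)
  have "\<exists>g\<in>sqint lborel. \<forall>h\<in>sqint lborel. l h = ?ip h g"
  proof (rule l2_Riesz)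
    fix g h :: "real \<Rightarrow> complex" assume gh: "g \<in> sqint lborel" "h \<in> sqint lborel"
    show "l (\<lambda>x. g x + h x) = l g + l h"
      using tendsto_add[OF l[OF gh(1)] l[OF gh(2)]] l[OF sqint_add[OF gh]] gh f
      by (auto simp: l2inner_add_left intro: LIMSEQ_unique)
  next
    fix c and h :: "real \<Rightarrow> complex" assume h: "h \<in> sqint lborel"
    show "l (\<lambda>x. c * h x) = cnj c * l h"
      using tendsto_mult_left[OF l[OF h], of "cnj c"] l[OF sqint_cmult[OF h, of c]]
      by (auto simp: l2inner_cmult_left intro: LIMSEQ_unique)
    show "cmod (l h) \<le> C * ?nm h"
      using ip_le[OF h] by (intro LIMSEQ_le_const2[OF tendsto_norm[OF l[OF h]]]) auto
  qed
  then show ?thesis using r l by metis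
qed

section \<open>The Fourier transform of integrable square-integrable functions\<close>

text \<open>The antiderivative comes from integration by parts, \<open>Si\<close> being the integral
  of sin x / x, whose limit at infinity is pi / 2. As the integrand is nonnegative, the fundamental
  theorem on the half line yields integrability along with the value.\<close>

lemma integrable_one_minus_cos_pos:
  "set_integrable lborel {0<..} (\<lambda>x::real. (1 - cos x) / x\<^sup>2)"
  "(LINT x:{0<..}|lborel. (1 - cos x) / x\<^sup>2) = pi / 2"
proof -
  let ?F = "\<lambda>x. Si x - (1 - cos x) / x"
  have cosb: "\<bar>(1 - cos x) / x\<bar> \<le> \<bar>x\<bar> / 2" for x :: real
  proof -
    have "1 - cos x = 2 * (sin (x/2))\<^sup>2" using cos_double_sin[of "x/2"] by simp
    also have "\<dots> \<le> 2 * (x/2)\<^sup>2"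
      using power_mono[OF abs_sin_x_le_abs_x[of "x/2"], of 2] by (simp add: power_divide)
    finally have "\<bar>1 - cos x\<bar> \<le> x\<^sup>2 / 2" by (simp add: power_divide)
    then show ?thesis by (cases "x = 0") (auto simp: divide_simps power2_eq_square abs_mult)
  qed
  have d: "DERIV ?F x :> (1 - cos x) / x\<^sup>2" if "x > 0" for x
    using that by (auto intro!: derivative_eq_intros DERIV_Si simp: field_simps power2_eq_square)
  have z: "((\<lambda>x::real. (1 - cos x) / x) \<longlongrightarrow> 0) (at_right 0)"
  proof (rule Lim_null_comparison)
    show "\<forall>\<^sub>F x in at_right 0. norm ((1 - cos x) / x) \<le> \<bar>x\<bar> / 2" using cosb by (simp add: always_eventually)
    show "((\<lambda>x::real. \<bar>x\<bar> / 2) \<longlongrightarrow> 0) (at_right 0)" by (auto intro!: tendsto_eq_intros)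
  qed
  have i: "((\<lambda>x::real. (1 - cos x) / x) \<longlongrightarrow> 0) at_top"
  proof (rule Lim_null_comparison)
    show "\<forall>\<^sub>F x in at_top. norm ((1 - cos x) / x) \<le> 2 / x"
      using eventually_gt_at_top[of 0]
    proof eventually_elim
      case (elim x)
      have "\<bar>1 - cos x\<bar> \<le> 2" using cos_ge_minus_one[of x] cos_le_one[of x] by simp
      then show ?case using elim by (simp add: divide_right_mono)
    qed
    show "((\<lambda>x::real. 2 / x) \<longlongrightarrow> 0) at_top"
      by (rule tendsto_divide_0[OF tendsto_const]) (simp add: filterlim_at_top_imp_at_infinity filterlim_ident)
  qed
  have Si0: "(Si \<longlongrightarrow> 0) (at_right 0)"
    using isCont_Si[of 0] Si_neg[of 0] by (simp add: isCont_def filterlim_at_split)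
  have A: "((?F \<circ> real_of_ereal) \<longlongrightarrow> 0) (at_right 0)"
    using tendsto_diff[OF Si0 z] by (simp add: zero_ereal_def ereal_tendsto_simps)
  have B: "((?F \<circ> real_of_ereal) \<longlongrightarrow> pi / 2) (at_left \<infinity>)"
    using tendsto_diff[OF Si_at_top i] by (simp add: ereal_tendsto_simps)
  note FTC = interval_integral_FTC_nonneg[of 0 \<infinity> ?F "\<lambda>x. (1 - cos x) / x\<^sup>2", OF _ _ _ _ A B]
  show "set_integrable lborel {0<..} (\<lambda>x::real. (1 - cos x) / x\<^sup>2)"
    using FTC(1) d by (simp add: zero_ereal_def)
  show "(LINT x:{0<..}|lborel. (1 - cos x) / x\<^sup>2) = pi / 2"
    using FTC(2) d by (simp add: zero_ereal_def interval_integral_to_infinity_eq)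
qed

text \<open>Inner products of transformed intervals are combinations of these integrals; the factor
  |a| is what turns them into lengths of overlaps.\<close>

lemma has_bochner_integral_one_minus_cos:
  "has_bochner_integral lborel (\<lambda>x::real. (1 - cos (a * x)) / x\<^sup>2) (pi * \<bar>a\<bar>)"
proof (cases "a = 0")
  case False
  let ?f = "\<lambda>x::real. (1 - cos x) / x\<^sup>2"
  have "has_bochner_integral lborel (\<lambda>x. indicator {0<..} x *\<^sub>R ?f x) (pi / 2)"
    using integrable_one_minus_cos_pos by (auto simp: has_bochner_integral_iff set_integrable_def set_lebesgue_integral_def)
  \<comment> \<open>At 0 the integrand is 0, as division by 0 gives 0, so adding the endpoint
    changes nothing.\<close>
  moreover have "(\<lambda>x::real. indicator {0<..} x *\<^sub>R ?f x) = (\<lambda>x. indicator {0..} x *\<^sub>R ?f x)"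
    by (auto simp: indicator_def fun_eq_iff)
  ultimately have "has_bochner_integral lborel ?f (2 *\<^sub>R (pi / 2))"
    by (intro has_bochner_integral_even_function) auto
  then have "has_bochner_integral lborel (\<lambda>x. ?f (0 + a * x)) (pi /\<^sub>R \<bar>a\<bar>)"
    using lborel_has_bochner_integral_real_affine_iff[OF False, of ?f pi 0] by simp
  then have "has_bochner_integral lborel (\<lambda>x. a\<^sup>2 * ?f (0 + a * x)) (a\<^sup>2 * (pi /\<^sub>R \<bar>a\<bar>))"
    by (rule has_bochner_integral_mult_right)
  moreover have "a\<^sup>2 * (pi /\<^sub>R \<bar>a\<bar>) = pi * \<bar>a\<bar>"
    using False by (simp add: field_simps power2_eq_square abs_mult_self_eq flip: abs_mult)
  moreover have "(\<lambda>x. a\<^sup>2 * ?f (0 + a * x)) = (\<lambda>x. (1 - cos (a * x)) / x\<^sup>2)"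
    using False by (simp add: power_mult_distrib)
  ultimately show ?thesis by (simp only:)
qed (simp add: has_bochner_integral_zero)

section \<open>The transform of integrable functions, and of intervals in particular\<close>

abbreviation expi :: "real \<Rightarrow> complex" where
  "expi r \<equiv> exp (- \<i> * complex_of_real r)"

definition ft :: "(real \<Rightarrow> complex) \<Rightarrow> real \<Rightarrow> complex" where
  "ft f k = complex_of_real (1 / sqrt (2 * pi)) * (LINT x|lborel. expi (k * x) * f x)"

lemma cmod_exp_minus_i [simp]: "cmod (expi r) = 1"
  by simp

lemma borel_measurable_ft [measurable (raw)]:
  assumes [measurable]: "f \<in> borel_measurable borel"
  shows "ft f \<in> borel_measurable borel"
  unfolding ft_def[abs_def] by measurable

lemma integrable_ft_integrand:
  assumes "integrable lborel f"
  shows "integrable lborel (\<lambda>x. expi (k * x) * f x)"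
proof (rule Bochner_Integration.integrable_bound[OF assms])
  show "(\<lambda>x. expi (k * x) * f x) \<in> borel_measurable lborel"
    using borel_measurable_integrable[OF assms] by measurable
qed (simp add: norm_mult)

lemma ft_add:
  assumes "integrable lborel f" "integrable lborel g"
  shows "ft (\<lambda>x. f x + g x) k = ft f k + ft g k"
  unfolding ft_def using assms[THEN integrable_ft_integrand]
  by (simp add: distrib_left Bochner_Integration.integral_add)

lemma ft_cmult: "ft (\<lambda>x. c * f x) k = c * ft f k"
  unfolding ft_def by (simp add: mult.left_commute)

lemma ft_diff:
  assumes "integrable lborel f" "integrable lborel g"
  shows "ft (\<lambda>x. f x - g x) k = ft f k - ft g k"
  using ft_add[OF assms(1) integrable_mult_right[OF assms(2), of "-1"]] ft_cmult[of "-1" g] by simp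

lemma ft_cong_AE:
  assumes "f \<in> borel_measurable borel" "g \<in> borel_measurable borel" "AE x in lborel. f x = g x"
  shows "ft f = ft g"
proof
  fix k
  have "(LINT x|lborel. expi (k * x) * f x) = (LINT x|lborel. expi (k * x) * g x)"
    using assms by (intro integral_cong_AE) (auto elim: AE_mp)
  then show "ft f k = ft g k" by (simp add: ft_def)
qed

lemma cmod_ft_le:
  assumes "integrable lborel f"
  shows "cmod (ft f k) \<le> (LINT x|lborel. cmod (f x))"
proof -
  have "1 / sqrt (2 * pi) \<le> 1" using pi_gt3 by (simp add: real_le_rsqrt)
  moreover have "cmod (LINT x|lborel. expi (k * x) * f x) \<le> (LINT x|lborel. cmod (f x))"
    using integral_norm_bound[of lborel "\<lambda>x. expi (k * x) * f x"] by (simp add: norm_mult)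
  ultimately have "1 / sqrt (2 * pi) * cmod (LINT x|lborel. expi (k * x) * f x) \<le> 1 * (LINT x|lborel. cmod (f x))"
    by (intro mult_mono) auto
  then show ?thesis by (simp add: ft_def norm_mult norm_divide)
qed

lemma ft_reflect_real:
  assumes "\<And>x. cnj (f x) = f x"
  shows "ft f (- k) = cnj (ft f k)"
proof -
  have "cnj (expi (k * x) * f x) = expi (- k * x) * f x" for x
    using assms by (simp add: exp_cnj)
  then show ?thesis unfolding ft_def by (simp del: mult_minus_left add: Bochner_Integration.integral_cnj[symmetric])
qed

lemma ft_indicator_Ioc:
  assumes "a \<le> b" "k \<noteq> 0"
  shows "ft (indicator {a<..b}) k = complex_of_real (1 / sqrt (2 * pi)) *
     ((expi (k * a) - expi (k * b)) / (\<i> * complex_of_real k))"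
proof -
  let ?F = "\<lambda>x::real. - expi (k * x) / (\<i> * complex_of_real k)"
  have "(LINT x|lborel. indicator {a..b} x *\<^sub>R expi (k * x)) = ?F b - ?F a"
  proof (rule integral_FTC_Icc[OF assms(1)])
    fix x
    have "((\<lambda>z. - exp (- \<i> * (of_real k * z)) / (\<i> * complex_of_real k)) has_field_derivative exp (- \<i> * (of_real k * of_real x))) (at (of_real x))"
      using assms(2) by (auto intro!: derivative_eq_intros simp: field_simps)
    then have "((\<lambda>z. - exp (- \<i> * (of_real k * of_real z)) / (\<i> * complex_of_real k)) has_vector_derivative exp (- \<i> * (of_real k * of_real x))) (at x)"
      by (rule has_vector_derivative_real_field)
    then show "(?F has_vector_derivative expi (k * x)) (at x within {a..b})"
      by (auto intro: has_vector_derivative_at_within)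
  qed (intro continuous_intros)
  moreover have "(LINT x|lborel. indicator {a..b} x *\<^sub>R expi (k * x)) =
    (LINT x|lborel. expi (k * x) * indicator {a<..b} x)"
  proof (rule integral_cong_AE)
    show "AE x in lborel. indicator {a..b} x *\<^sub>R expi (k * x) = expi (k * x) * indicator {a<..b} x"
      using AE_lborel_singleton[of a] by eventually_elim (auto simp: indicator_def)
  qed auto
  ultimately show ?thesis unfolding ft_def by (simp add: diff_divide_distrib)
qed

text \<open>The constants 1 cancel in the sum; they are inserted to make each of the four quotients
  integrable near 0. The real part is enough, since the imaginary part is odd in k.\<close>

lemma ft_indicator_Ioc_mult:
  assumes "a \<le> b" "c \<le> d" "k \<noteq> 0"
  shows "Re (cnj (ft (indicator {a<..b}) k) * ft (indicator {c<..d}) k) =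
    1 / (2 * pi) * ((1 - cos ((a - d) * k)) / k\<^sup>2 + (1 - cos ((b - c) * k)) / k\<^sup>2
      - (1 - cos ((a - c) * k)) / k\<^sup>2 - (1 - cos ((b - d) * k)) / k\<^sup>2)"
proof -
  let ?e = "\<lambda>x. expi (k * x)"
  have e: "?e x = Complex (cos (k * x)) (- sin (k * x))" for x
    by (simp add: complex_eq_iff Re_exp Im_exp)
  have rr: "Re (complex_of_real r * z) = r * Re z" for r z by simp
  have s: "complex_of_real (1 / sqrt (2 * pi)) * complex_of_real (1 / sqrt (2 * pi)) = complex_of_real (1 / (2 * pi))"
    unfolding of_real_mult[symmetric] by simp
  have "cnj (ft (indicator {a<..b}) k) * ft (indicator {c<..d}) k =
    (complex_of_real (1 / sqrt (2 * pi)) * complex_of_real (1 / sqrt (2 * pi))) *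
     ((cnj (?e a) - cnj (?e b)) * (?e c - ?e d) / (complex_of_real k * complex_of_real k))"
    unfolding ft_indicator_Ioc[OF assms(1,3)] ft_indicator_Ioc[OF assms(2,3)] using assms(3)
    by (simp add: field_simps)
  also have "\<dots> = complex_of_real (1 / (2 * pi) / k\<^sup>2) * ((cnj (?e a) - cnj (?e b)) * (?e c - ?e d))"
    unfolding s by (simp add: power2_eq_square)
  finally have "Re (cnj (ft (indicator {a<..b}) k) * ft (indicator {c<..d}) k) =
    1 / (2 * pi) / k\<^sup>2 * Re ((cnj (?e a) - cnj (?e b)) * (?e c - ?e d))"
    by (simp only: rr)
  also have "Re ((cnj (?e a) - cnj (?e b)) * (?e c - ?e d)) =
    (1 - cos ((a - d) * k)) + (1 - cos ((b - c) * k)) - (1 - cos ((a - c) * k)) - (1 - cos ((b - d) * k))"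
  proof -
    have "cos ((u - v) * k) = cos (k * u) * cos (k * v) + sin (k * u) * sin (k * v)" for u v
      unfolding cos_diff[symmetric] by (simp add: algebra_simps)
    then show ?thesis unfolding e by (simp add: algebra_simps)
  qed
  finally have *: "Re (cnj (ft (indicator {a<..b}) k) * ft (indicator {c<..d}) k) =
    1 / (2 * pi) / k\<^sup>2 * ((1 - cos ((a - d) * k)) + (1 - cos ((b - c) * k)) - (1 - cos ((a - c) * k)) - (1 - cos ((b - d) * k)))" .
  have "p / q * (A + B - C - D) = p * (A / q + B / q - C / q - D / q)" for p q A B C D :: real
    by (simp add: divide_inverse algebra_simps)
  then show ?thesis using * by (simp only:)
qed

lemma has_bochner_integral_ft_indicator_Re:
  assumes "a \<le> b" "c \<le> d"
  shows "has_bochner_integral lborel (\<lambda>k. Re (cnj (ft (indicator {a<..b}) k) * ft (indicator {c<..d}) k))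
     (1 / 2 * (\<bar>a - d\<bar> + \<bar>b - c\<bar> - \<bar>a - c\<bar> - \<bar>b - d\<bar>))"
proof -
  have "has_bochner_integral lborel (\<lambda>k. 1 / (2 * pi) * ((1 - cos ((a - d) * k)) / k\<^sup>2 + (1 - cos ((b - c) * k)) / k\<^sup>2
      - (1 - cos ((a - c) * k)) / k\<^sup>2 - (1 - cos ((b - d) * k)) / k\<^sup>2))
     (1 / (2 * pi) * (pi * \<bar>a - d\<bar> + pi * \<bar>b - c\<bar> - pi * \<bar>a - c\<bar> - pi * \<bar>b - d\<bar>))"
    by (intro has_bochner_integral_mult_right has_bochner_integral_add has_bochner_integral_diff has_bochner_integral_one_minus_cos)
  moreover have "1 / (2 * pi) * (pi * \<bar>a - d\<bar> + pi * \<bar>b - c\<bar> - pi * \<bar>a - c\<bar> - pi * \<bar>b - d\<bar>) =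
    1 / 2 * (\<bar>a - d\<bar> + \<bar>b - c\<bar> - \<bar>a - c\<bar> - \<bar>b - d\<bar>)" by (simp add: field_simps)
  ultimately have I: "has_bochner_integral lborel (\<lambda>k. 1 / (2 * pi) * ((1 - cos ((a - d) * k)) / k\<^sup>2 + (1 - cos ((b - c) * k)) / k\<^sup>2
      - (1 - cos ((a - c) * k)) / k\<^sup>2 - (1 - cos ((b - d) * k)) / k\<^sup>2))
     (1 / 2 * (\<bar>a - d\<bar> + \<bar>b - c\<bar> - \<bar>a - c\<bar> - \<bar>b - d\<bar>))" by (simp only:)
  show ?thesis
  proof (rule has_bochner_integral_cong_AE[THEN iffD2, OF _ _ _ I])
    show "AE k in lborel. Re (cnj (ft (indicator {a<..b}) k) * ft (indicator {c<..d}) k) =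
       1 / (2 * pi) * ((1 - cos ((a - d) * k)) / k\<^sup>2 + (1 - cos ((b - c) * k)) / k\<^sup>2
        - (1 - cos ((a - c) * k)) / k\<^sup>2 - (1 - cos ((b - d) * k)) / k\<^sup>2)"
      using AE_lborel_singleton[of 0] by eventually_elim (rule ft_indicator_Ioc_mult[OF assms])
  qed auto
qed

lemma sqint_ft_indicator: "a \<le> b \<Longrightarrow> ft (indicator {a<..b}) \<in> sqint lborel"
proof (intro sqintI)
  assume "a \<le> b"
  have "Re (cnj z * z) = (cmod z)\<^sup>2" for z by (simp add: cmod_power2) (simp add: power2_eq_square)
  then show "integrable lborel (\<lambda>x. (cmod (ft (indicator {a<..b}) x))\<^sup>2)"
    using has_bochner_integral_ft_indicator_Re[OF \<open>a \<le> b\<close> \<open>a \<le> b\<close>] by (simp add: has_bochner_integral_iff)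
qed simp

text \<open>The reflection k to -k conjugates the product of the transforms, so its integral is
  real. The remaining combination of absolute values is the length of the overlap of the two
  intervals.\<close>

lemma l2inner_ft_indicator:
  assumes "a \<le> b" "c \<le> d"
  shows "l2inner lborel (ft (indicator {a<..b})) (ft (indicator {c<..d})) = l2inner lborel (indicator {a<..b}) (indicator {c<..d})"
proof -
  let ?h = "\<lambda>k. cnj (ft (indicator {a<..b}) k) * ft (indicator {c<..d}) k"
  have int: "integrable lborel ?h" using assms by (intro l2inner_integrable sqint_ft_indicator)
  have "?h (- k) = cnj (?h k)" for k
    using ft_reflect_real[of "indicator {a<..b}" k] ft_reflect_real[of "indicator {c<..d}" k]
    by (simp add: indicator_def)
  then have neg: "?h (0 + (-1) * k) = cnj (?h k)" for k by simp
  have "cnj (LINT k|lborel. ?h k) = (LINT k|lborel. ?h (0 + (-1) * k))"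
    unfolding neg by (rule Bochner_Integration.integral_cnj[symmetric])
  also have "\<dots> = (LINT k|lborel. ?h k)"
    by (subst lborel_integral_real_affine[of "-1" ?h 0]) auto
  finally have Im0: "Im (LINT k|lborel. ?h k) = 0" by (simp add: complex_eq_iff)
  have "Re (LINT k|lborel. ?h k) = (LINT k|lborel. Re (?h k))" by (rule integral_Re[OF int, symmetric])
  also have "\<dots> = 1 / 2 * (\<bar>a - d\<bar> + \<bar>b - c\<bar> - \<bar>a - c\<bar> - \<bar>b - d\<bar>)"
    using has_bochner_integral_ft_indicator_Re[OF assms] by (simp add: has_bochner_integral_iff)
  also have "\<dots> = max 0 (min b d - max a c)" using assms by (auto simp: max_def min_def abs_if)
  finally have Re: "(LINT k|lborel. ?h k) = of_real (max 0 (min b d - max a c))" using Im0 by (simp add: complex_eq_iff)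
  have "l2inner lborel (indicator {a<..b}) (indicator {c<..d}) = (LINT x|lborel. complex_of_real (indicator {max a c<..min b d} x))"
    unfolding l2inner_def by (intro Bochner_Integration.integral_cong) (auto simp: indicator_def)
  also have "\<dots> = complex_of_real (measure lborel {max a c<..min b d})" by (subst integral_complex_of_real) simp
  also have "measure lborel {max a c<..min b d} = max 0 (min b d - max a c)"
    by (cases "max a c \<le> min b d") auto
  finally show ?thesis using Re by (simp add: l2inner_def)
qed


text \<open>A list of coefficients with endpoints, under no condition of order or disjointness:
  addition becomes concatenation, and restriction to an interval only changes endpoints, reversed
  ones giving the empty interval.\<close>

primrec step_fun :: "(complex \<times> real \<times> real) list \<Rightarrow> real \<Rightarrow> complex" where
  "step_fun [] x = 0"
| "step_fun (p # ps) x = fst p * indicator {fst (snd p)<..snd (snd p)} x + step_fun ps x"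

lemma step_fun_Nil: "step_fun [] = (\<lambda>x. 0)"
  and step_fun_Cons: "step_fun (p # ps) = (\<lambda>x. fst p * indicator {fst (snd p)<..snd (snd p)} x + step_fun ps x)"
  by auto

lemma step_fun_append: "step_fun (ps @ qs) x = step_fun ps x + step_fun qs x"
  by (induction ps) auto

lemma step_fun_cmult: "step_fun (map (\<lambda>p. (c * fst p, snd p)) ps) x = c * step_fun ps x"
  by (induction ps) (auto simp: algebra_simps)

lemma step_fun_restrict:
  "step_fun (map (\<lambda>p. (fst p, max u (fst (snd p)), min v (snd (snd p)))) ps) x = indicator {u<..v} x * step_fun ps x"
  by (induction ps) (auto simp: algebra_simps indicator_def)

lemma integrable_indicator_Ioc: "integrable lborel (indicator {a<..b::real} :: real \<Rightarrow> complex)"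
proof -
  have "integrable lborel (\<lambda>x. indicator {a<..b} x * indicator {a<..b} x :: complex)"
    by (intro sqint_mult_integrable) auto
  moreover have "(\<lambda>x. indicator {a<..b} x * indicator {a<..b} x) = (indicator {a<..b} :: real \<Rightarrow> complex)"
    by (auto simp: indicator_def)
  ultimately show ?thesis by (simp only:)
qed

lemma step_fun_sqint: "step_fun ps \<in> sqint lborel"
  by (induction ps) (auto simp: step_fun_Nil step_fun_Cons intro!: sqint_add sqint_cmult simp del: step_fun.simps)

lemma step_fun_integrable: "integrable lborel (step_fun ps)"
  by (induction ps) (auto simp: step_fun_Nil step_fun_Cons integrable_indicator_Ioc simp del: step_fun.simps)

text \<open>Stated for inner products of two different step functions, because both sides are
  sesquilinear and the claim then reduces to pairs of intervals.\<close>

lemma step_fun_isometry: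
  "ft (step_fun ps) \<in> sqint lborel"
  "l2inner lborel (ft (step_fun ps)) (ft (step_fun qs)) = l2inner lborel (step_fun ps) (step_fun qs)"
proof -
  have ind: "ft (indicator {a<..b}) \<in> sqint lborel" for a b :: real
  proof (cases "a \<le> b")
    case False
    then have "indicator {a<..b} = (\<lambda>x::real. 0::complex)" by (auto simp: indicator_def)
    moreover have "ft (\<lambda>x. 0) = (\<lambda>x. 0)" by (simp add: ft_def fun_eq_iff)
    ultimately show ?thesis by simp
  qed (rule sqint_ft_indicator)
  have ind2: "l2inner lborel (ft (indicator {a<..b})) (ft (indicator {c<..d})) = l2inner lborel (indicator {a<..b}) (indicator {c<..d})"
    for a b c d :: real
  proof (cases "a \<le> b \<and> c \<le> d")
    case False
    from False consider "indicator {a<..b} = (\<lambda>x::real. 0::complex)" | "indicator {c<..d} = (\<lambda>x::real. 0::complex)"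
      by (fastforce simp: indicator_def)
    then show ?thesis
    proof cases
      case 1 show ?thesis unfolding 1 by (simp add: l2inner_def ft_def)
    next
      case 2 show ?thesis unfolding 2 by (simp add: l2inner_def ft_def)
    qed
  qed (simp add: l2inner_ft_indicator)
  have nil: "ft (step_fun []) = (\<lambda>x. 0)" by (simp add: ft_def fun_eq_iff)
  have cons: "ft (step_fun (p # ps)) = (\<lambda>k. fst p * ft (indicator {fst (snd p)<..snd (snd p)}) k + ft (step_fun ps) k)" for p ps
    unfolding step_fun_Cons
    by (rule ext, subst ft_add) (auto simp: ft_cmult step_fun_integrable integrable_indicator_Ioc simp del: step_fun.simps)
  have sq: "ft (step_fun ps) \<in> sqint lborel" for ps
    by (induction ps) (auto simp: nil cons ind intro!: sqint_add sqint_cmult simp del: step_fun.simps)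
  then show "ft (step_fun ps) \<in> sqint lborel" .
  have 1: "l2inner lborel (ft (indicator {a<..b})) (ft (step_fun qs)) = l2inner lborel (indicator {a<..b}) (step_fun qs)" for a b :: real
  proof (induction qs)
    case Nil then show ?case unfolding nil unfolding step_fun_Nil by (simp add: l2inner_def)
  next
    case (Cons q qs)
    then show ?case unfolding cons unfolding step_fun_Cons
      by (simp add: l2inner_add_right ind sq step_fun_sqint sqint_cmult l2inner_cmult_right ind2)
  qed
  show "l2inner lborel (ft (step_fun ps)) (ft (step_fun qs)) = l2inner lborel (step_fun ps) (step_fun qs)"
  proof (induction ps)
    case Nil then show ?case unfolding nil unfolding step_fun_Nil by (simp add: l2inner_def)
  next
    case (Cons q ps)
    then show ?case unfolding cons unfolding step_fun_Cons
      by (simp add: l2inner_add_left ind sq step_fun_sqint sqint_cmult l2inner_cmult_left 1)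
  qed
qed

lemma step_fun_dense:
  assumes "f \<in> sqint lborel" "0 < e"
  shows "\<exists>ps. l2norm lborel (\<lambda>x. step_fun ps x - f x) < e"
  using assms
proof (induction arbitrary: e rule: sqint_lborel_induct)
  case (interval a b)
  then show ?case by (intro exI[of _ "[(1, a, b)]"]) simp
next
  case (add f g)
  obtain ps qs where "l2norm lborel (\<lambda>x. step_fun ps x - f x) < e/2" "l2norm lborel (\<lambda>x. step_fun qs x - g x) < e/2"
    using add.IH add.prems by (meson half_gt_zero)
  moreover have "l2norm lborel (\<lambda>x. step_fun (ps @ qs) x - (f x + g x)) \<le>
    l2norm lborel (\<lambda>x. step_fun ps x - f x) + l2norm lborel (\<lambda>x. step_fun qs x - g x)"
    using l2norm_triangle[of "\<lambda>x. step_fun ps x - f x" lborel "\<lambda>x. step_fun qs x - g x"] add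
    by (simp add: step_fun_append algebra_simps sqint_diff step_fun_sqint)
  ultimately show ?case by (intro exI[of _ "ps @ qs"]) simp
next
  case (cmult c f)
  have c: "0 < e / (cmod c + 1)" using cmult by (intro divide_pos_pos) (auto intro: add_nonneg_pos)
  obtain ps where ps: "l2norm lborel (\<lambda>x. step_fun ps x - f x) < e / (cmod c + 1)"
    using cmult.IH[OF c] by blast
  let ?N = "l2norm lborel (\<lambda>x. step_fun ps x - f x)"
  have "l2norm lborel (\<lambda>x. step_fun (map (\<lambda>p. (c * fst p, snd p)) ps) x - c * f x) = cmod c * ?N"
    using l2norm_cmult[of lborel c "\<lambda>x. step_fun ps x - f x"] by (simp add: step_fun_cmult right_diff_distrib)
  also have "\<dots> \<le> (cmod c + 1) * ?N" by (intro mult_right_mono) auto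
  also have "\<dots> < e"
    using ps add_nonneg_pos[of "cmod c" 1] by (simp add: pos_less_divide_eq mult.commute)
  finally show ?case by blast
next
  case (limit s f)
  obtain k where k: "norm (l2norm lborel (\<lambda>x. s k x - f x) - 0) < e / 2"
    using LIMSEQ_D[OF limit(3), of "e/2"] limit by auto
  obtain ps where ps: "l2norm lborel (\<lambda>x. step_fun ps x - s k x) < e / 2"
    using limit.IH[of "e/2" k] limit.prems by auto
  have "l2norm lborel (\<lambda>x. step_fun ps x - f x) \<le> l2norm lborel (\<lambda>x. step_fun ps x - s k x) + l2norm lborel (\<lambda>x. s k x - f x)"
    by (intro l2norm_triangle_diff step_fun_sqint limit)
  then show ?case using k ps by (intro exI[of _ ps]) simp
qed

section \<open>Plancherel's theorem, from step functions to integrable functions in L2\<close>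

lemma ft_pointwise_limit:
  assumes "\<And>n. integrable lborel (g n)" "integrable lborel f"
    "(\<lambda>n. LINT x|lborel. cmod (g n x - f x)) \<longlonglongrightarrow> 0"
  shows "(\<lambda>n. ft (g n) k) \<longlonglongrightarrow> ft f k"
proof (rule LIM_zero_cancel, rule Lim_null_comparison[OF _ assms(3)])
  show "\<forall>\<^sub>F n in sequentially. cmod (ft (g n) k - ft f k) \<le> (LINT x|lborel. cmod (g n x - f x))"
    using assms by (intro always_eventually allI) (simp add: ft_diff[symmetric] cmod_ft_le)
qed

text \<open>Convergence in L1 makes the transforms converge pointwise, and Fatou's lemma then acts
  on the transform side; this yields an inequality only.\<close>

lemma ft_contraction_limit:
  assumes g: "\<And>n. g n \<in> sqint lborel" "\<And>n. integrable lborel (g n)" "\<And>n. ft (g n) \<in> sqint lborel"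
     "\<And>n. l2norm lborel (ft (g n)) \<le> l2norm lborel (g n)"
    and f: "f \<in> sqint lborel" "integrable lborel f"
    and lim: "(\<lambda>n. LINT x|lborel. cmod (g n x - f x)) \<longlonglongrightarrow> 0" "(\<lambda>n. l2norm lborel (\<lambda>x. g n x - f x)) \<longlonglongrightarrow> 0"
  shows "ft f \<in> sqint lborel" "l2norm lborel (ft f) \<le> l2norm lborel f"
proof -
  have [measurable]: "f \<in> borel_measurable borel" using f by (simp add: sqint_def)
  have *: "ft f \<in> sqint lborel \<and> l2norm lborel (ft f) \<le> l2norm lborel f + e" if "e > 0" for e
  proof -
    have "(\<lambda>n. l2norm lborel (g n)) \<longlonglongrightarrow> l2norm lborel f" by (rule tendsto_l2norm[OF g(1) f(1) lim(2)])
    then have "\<forall>\<^sub>F n in sequentially. l2norm lborel (g n) < l2norm lborel f + e"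
      using that by (intro order_tendstoD) auto
    then obtain N where N: "\<And>n. n \<ge> N \<Longrightarrow> l2norm lborel (g n) < l2norm lborel f + e"
      unfolding eventually_sequentially by blast
    have AE: "AE k in lborel. (\<lambda>n. ft (g (n + N)) k) \<longlonglongrightarrow> ft f k"
      by (intro AE_I2 LIMSEQ_ignore_initial_segment ft_pointwise_limit g f lim)
    have le: "l2norm lborel (ft (g (n + N))) \<le> l2norm lborel f + e" for n
      using g(4)[of "n + N"] N[of "n + N"] by simp
    show ?thesis
      using l2norm_Fatou[of "ft f" lborel "\<lambda>n. ft (g (n + N))", OF _ g(3) AE le] by auto
  qed
  show "ft f \<in> sqint lborel" using *[of 1] by simp
  show "l2norm lborel (ft f) \<le> l2norm lborel f" by (rule field_le_epsilon) (use * in blast)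
qed

text \<open>The contraction inequality for the differences from f turns norm convergence of the
  functions into norm convergence of their transforms, so equality of norms survives the
  limit.\<close>

lemma ft_isometry_limit:
  assumes g: "\<And>n. g n \<in> sqint lborel" "\<And>n. integrable lborel (g n)" "\<And>n. ft (g n) \<in> sqint lborel"
     "\<And>n. l2norm lborel (ft (g n)) = l2norm lborel (g n)"
    and f: "f \<in> sqint lborel" "integrable lborel f" "ft f \<in> sqint lborel"
    and d: "\<And>n. l2norm lborel (ft (\<lambda>x. g n x - f x)) \<le> l2norm lborel (\<lambda>x. g n x - f x)"
    and lim: "(\<lambda>n. l2norm lborel (\<lambda>x. g n x - f x)) \<longlonglongrightarrow> 0"
  shows "l2norm lborel (ft f) = l2norm lborel f"
proof (rule LIMSEQ_unique)
  show "(\<lambda>n. l2norm lborel (g n)) \<longlonglongrightarrow> l2norm lborel f" by (rule tendsto_l2norm[OF g(1) f(1) lim])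
  have "(\<lambda>n. l2norm lborel (ft (g n))) \<longlonglongrightarrow> l2norm lborel (ft f)"
  proof (rule tendsto_l2norm[OF g(3) f(3)], rule Lim_null_comparison[OF _ lim])
    show "\<forall>\<^sub>F n in sequentially. norm (l2norm lborel (\<lambda>x. ft (g n) x - ft f x)) \<le> l2norm lborel (\<lambda>x. g n x - f x)"
    proof -
      have "(\<lambda>k. ft (g n) k - ft f k) = ft (\<lambda>x. g n x - f x)" for n
        using ft_diff[OF g(2) f(2)] by (simp add: fun_eq_iff)
      then show ?thesis using d by simp
    qed
  qed
  then show "(\<lambda>n. l2norm lborel (g n)) \<longlonglongrightarrow> l2norm lborel (ft f)" by (simp add: g(4))
qed

lemma sqint_bounded_support_integrable:
  assumes "f \<in> sqint lborel" "0 \<le> R" "\<And>x::real. x \<notin> {-R<..R} \<Longrightarrow> f x = 0"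
  shows "integrable lborel f" "(LINT x|lborel. cmod (f x)) \<le> sqrt (2 * R) * l2norm lborel f"
proof -
  have eq: "(\<lambda>x. indicator {-R<..R} x * f x) = f" using assms(3) by (auto simp: indicator_def fun_eq_iff)
  have "integrable lborel (\<lambda>x. indicator {-R<..R} x * f x)"
    by (intro sqint_mult_integrable assms) simp
  then show "integrable lborel f" unfolding eq .
  have "(LINT x|lborel. cmod (f x)) = (LINT x|lborel. cmod (indicator {-R<..R} x) * cmod (f x))"
    using assms(3) by (intro Bochner_Integration.integral_cong) (auto simp: indicator_def)
  also have "\<dots> \<le> l2norm lborel (indicator {-R<..R}) * l2norm lborel f"
    by (intro l2norm_integral_mult_le assms) simp
  also have "l2norm lborel (indicator {-R<..R} :: real \<Rightarrow> complex) = sqrt (2 * R)"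
  proof -
    have "(LINT x|lborel. (cmod (indicator {-R<..R} x))\<^sup>2) = (LINT x|lborel. indicator {-R<..R} x)"
      by (intro Bochner_Integration.integral_cong) (auto simp: indicator_def)
    then show ?thesis using assms(2) by (simp add: l2norm_def)
  qed
  finally show "(LINT x|lborel. cmod (f x)) \<le> sqrt (2 * R) * l2norm lborel f" .
qed

text \<open>On a bounded interval convergence in L2 implies convergence in L1, as the contraction
  argument requires; therefore the approximating step functions are cut off to the same interval.
  The inequality comes first and for all such functions, because it is then applied to
  differences.\<close>

lemma Plancherel_bounded_support:
  assumes f: "f \<in> sqint lborel" and R: "0 \<le> R" and supp: "\<And>x::real. x \<notin> {-R<..R} \<Longrightarrow> f x = 0"
  shows "ft f \<in> sqint lborel" "l2norm lborel (ft f) = l2norm lborel f"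
proof -
  have approx: "\<exists>g. (\<forall>n. g n \<in> sqint lborel \<and> integrable lborel (g n) \<and> ft (g n) \<in> sqint lborel \<and>
      l2norm lborel (ft (g n)) = l2norm lborel (g n) \<and> (\<forall>x. x \<notin> {-R<..R} \<longrightarrow> g n x = 0)) \<and>
      (\<lambda>n. LINT x|lborel. cmod (g n x - f x)) \<longlonglongrightarrow> 0 \<and> (\<lambda>n. l2norm lborel (\<lambda>x. g n x - f x)) \<longlonglongrightarrow> 0"
    if f: "f \<in> sqint lborel" and supp: "\<And>x. x \<notin> {-R<..R} \<Longrightarrow> f x = 0" for f
  proof -
    have "\<forall>n. \<exists>ps. l2norm lborel (\<lambda>x. step_fun ps x - f x) < inverse (real (Suc n))"
      using step_fun_dense[OF f] by simp
    then obtain ps where ps: "\<And>n. l2norm lborel (\<lambda>x. step_fun (ps n) x - f x) < inverse (real (Suc n))" by metis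
    define qs where "qs n = map (\<lambda>p. (fst p, max (-R) (fst (snd p)), min R (snd (snd p)))) (ps n)" for n
    define g where "g n = step_fun (qs n)" for n
    have g_eq: "g n = (\<lambda>x. indicator {-R<..R} x * step_fun (ps n) x)" for n
      by (simp add: g_def qs_def step_fun_restrict fun_eq_iff)
    have g: "g n \<in> sqint lborel" "integrable lborel (g n)" "ft (g n) \<in> sqint lborel" for n
      unfolding g_def by (rule step_fun_sqint step_fun_integrable step_fun_isometry)+
    have iso: "l2norm lborel (ft (g n)) = l2norm lborel (g n)" for n
    proof -
      have "complex_of_real ((l2norm lborel (ft (g n)))\<^sup>2) = of_real ((l2norm lborel (g n))\<^sup>2)"
        unfolding l2inner_self[symmetric] unfolding g_def by (rule step_fun_isometry)
      then have "(l2norm lborel (ft (g n)))\<^sup>2 = (l2norm lborel (g n))\<^sup>2" using of_real_eq_iff by blast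
      then show ?thesis by (simp add: power2_eq_iff_nonneg)
    qed
    have gs: "g n x = 0" if "x \<notin> {-R<..R}" for n x using that unfolding g_eq by simp
    have le: "l2norm lborel (\<lambda>x. g n x - f x) \<le> inverse (real (Suc n))" for n
    proof -
      have eq: "(\<lambda>x. g n x - f x) = (\<lambda>x. indicator {-R<..R} x * (step_fun (ps n) x - f x))"
        using supp unfolding g_eq by (auto simp: indicator_def fun_eq_iff)
      have "l2norm lborel (\<lambda>x. indicator {-R<..R} x * (step_fun (ps n) x - f x)) \<le> 1 * l2norm lborel (\<lambda>x. step_fun (ps n) x - f x)"
        by (rule sqint_bounded_mult(2)) (auto simp: indicator_def intro!: sqint_diff step_fun_sqint f)
      then show ?thesis unfolding eq using ps[of n] by simp
    qed
    have lim: "(\<lambda>n. l2norm lborel (\<lambda>x. g n x - f x)) \<longlonglongrightarrow> 0"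
      by (rule Lim_null_comparison[OF _ LIMSEQ_inverse_real_of_nat]) (use le in simp)
    have "(\<lambda>n. LINT x|lborel. cmod (g n x - f x)) \<longlonglongrightarrow> 0"
    proof (rule Lim_null_comparison)
      show "\<forall>\<^sub>F n in sequentially. norm (LINT x|lborel. cmod (g n x - f x)) \<le> sqrt (2 * R) * l2norm lborel (\<lambda>x. g n x - f x)"
        using sqint_bounded_support_integrable(2)[OF sqint_diff[OF g(1) f] R] gs supp
        by (intro always_eventually allI) (simp add: Bochner_Integration.integral_nonneg)
      show "(\<lambda>n. sqrt (2 * R) * l2norm lborel (\<lambda>x. g n x - f x)) \<longlonglongrightarrow> 0"
        using tendsto_mult_left[OF lim] by simp
    qed
    then show ?thesis using g iso gs lim by blast
  qed
  have contr: "ft f \<in> sqint lborel \<and> l2norm lborel (ft f) \<le> l2norm lborel f"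
    if f: "f \<in> sqint lborel" and supp: "\<And>x. x \<notin> {-R<..R} \<Longrightarrow> f x = 0" for f
  proof -
    obtain g where g: "\<And>n. g n \<in> sqint lborel" "\<And>n. integrable lborel (g n)" "\<And>n. ft (g n) \<in> sqint lborel"
      "\<And>n. l2norm lborel (ft (g n)) = l2norm lborel (g n)"
      "(\<lambda>n. LINT x|lborel. cmod (g n x - f x)) \<longlonglongrightarrow> 0" "(\<lambda>n. l2norm lborel (\<lambda>x. g n x - f x)) \<longlonglongrightarrow> 0"
      using approx[OF f supp] by blast
    show ?thesis
      using ft_contraction_limit[OF g(1-3) eq_refl[OF g(4)] f sqint_bounded_support_integrable(1)[OF f R supp] g(5,6)] by blast
  qed
  show sq: "ft f \<in> sqint lborel" using contr[OF f supp] by blast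
  obtain g where g: "\<And>n. g n \<in> sqint lborel" "\<And>n. integrable lborel (g n)" "\<And>n. ft (g n) \<in> sqint lborel"
    "\<And>n. l2norm lborel (ft (g n)) = l2norm lborel (g n)" "\<And>n x. x \<notin> {-R<..R} \<Longrightarrow> g n x = 0"
    "(\<lambda>n. l2norm lborel (\<lambda>x. g n x - f x)) \<longlonglongrightarrow> 0"
    using approx[OF f supp] by blast
  show "l2norm lborel (ft f) = l2norm lborel f"
  proof (rule ft_isometry_limit[OF g(1-4) f sqint_bounded_support_integrable(1)[OF f R supp] sq _ g(6)])
    show "l2norm lborel (ft (\<lambda>x. g n x - f x)) \<le> l2norm lborel (\<lambda>x. g n x - f x)" for n
      using contr[OF sqint_diff[OF g(1) f]] g(5) supp by simp
  qed
qed

text \<open>Closed at both ends, as is the domain of integration in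
  \<open>fourier_trunc\<close>.\<close>

definition trunc :: "real \<Rightarrow> (real \<Rightarrow> complex) \<Rightarrow> real \<Rightarrow> complex" where
  "trunc R f x = indicator {-R..R} x * f x"

lemma trunc_sqint:
  assumes "f \<in> sqint lborel"
  shows "trunc R f \<in> sqint lborel" "l2norm lborel (trunc R f) \<le> l2norm lborel f"
  using sqint_bounded_mult[OF assms, of "indicator {-R..R}" 1] by (auto simp: trunc_def[abs_def] indicator_def)

text \<open>The enlargement by 1 fits the closed interval of \<open>trunc\<close> into the half-open
  intervals used for bounded supports.\<close>

lemma trunc_supp: "0 \<le> R \<Longrightarrow> x \<notin> {-(R + 1)<..R + 1} \<Longrightarrow> trunc R f x = 0"
  by (auto simp: trunc_def)

lemma trunc_integrable:
  assumes "f \<in> sqint lborel"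
  shows "integrable lborel (trunc R f)"
proof (cases "0 \<le> R")
  case True
  then show ?thesis using sqint_bounded_support_integrable(1)[OF trunc_sqint(1)[OF assms], of "R+1" R] trunc_supp by simp
next
  case False
  then have "trunc R f = (\<lambda>x. 0)" by (auto simp: trunc_def fun_eq_iff)
  then show ?thesis by simp
qed

lemma trunc_limit:
  assumes "f \<in> sqint lborel"
  shows "((\<lambda>R. l2norm lborel (\<lambda>x. trunc R f x - f x)) \<longlongrightarrow> 0) at_top"
proof (rule tendsto_at_topI_sequentially)
  fix X :: "nat \<Rightarrow> real" assume X: "filterlim X at_top sequentially"
  have [measurable]: "f \<in> borel_measurable borel" using assms by (simp add: sqint_def)
  show "(\<lambda>n. l2norm lborel (\<lambda>x. trunc (X n) f x - f x)) \<longlonglongrightarrow> 0"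
  proof (rule l2_dominated_convergence(3)[where w="\<lambda>x. cmod (f x)"])
    show "AE x in lborel. (\<lambda>n. trunc (X n) f x) \<longlonglongrightarrow> f x"
    proof (intro AE_I2 tendsto_eventually)
      fix x :: real
      have "\<forall>\<^sub>F n in sequentially. X n \<ge> \<bar>x\<bar>" using X by (simp add: filterlim_at_top)
      then show "\<forall>\<^sub>F n in sequentially. trunc (X n) f x = f x"
        by eventually_elim (auto simp: trunc_def indicator_def)
    qed
  qed (use assms in \<open>auto simp: trunc_def[abs_def] sqint_def indicator_def\<close>)
qed

lemma trunc_limit_nat:
  assumes "f \<in> sqint lborel"
  shows "(\<lambda>n. l2norm lborel (\<lambda>x. trunc (real n) f x - f x)) \<longlonglongrightarrow> 0"
  by (rule filterlim_compose[OF trunc_limit[OF assms] filterlim_real_sequentially])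

lemma Plancherel_trunc:
  assumes "f \<in> sqint lborel"
  shows "ft (trunc R f) \<in> sqint lborel" "l2norm lborel (ft (trunc R f)) = l2norm lborel (trunc R f)"
proof -
  have "ft (trunc R f) \<in> sqint lborel \<and> l2norm lborel (ft (trunc R f)) = l2norm lborel (trunc R f)"
  proof (cases "0 \<le> R")
    case True
    then show ?thesis using Plancherel_bounded_support[OF trunc_sqint(1)[OF assms], of "R+1" R] trunc_supp by simp
  next
    case False
    then have "trunc R f = (\<lambda>x. 0)" by (auto simp: trunc_def fun_eq_iff)
    moreover have "ft (\<lambda>x. 0) = (\<lambda>x. 0)" by (simp add: ft_def fun_eq_iff)
    ultimately show ?thesis by simp
  qed
  then show "ft (trunc R f) \<in> sqint lborel" "l2norm lborel (ft (trunc R f)) = l2norm lborel (trunc R f)" by auto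
qed

text \<open>The same passage as for bounded support, now with truncations as approximants;
  integrability of f gives their convergence in L1.\<close>

lemma Plancherel:
  assumes f: "f \<in> sqint lborel" and int: "integrable lborel f"
  shows "ft f \<in> sqint lborel" "l2norm lborel (ft f) = l2norm lborel f"
proof -
  note T = trunc_sqint(1) trunc_integrable Plancherel_trunc
  have L1: "(\<lambda>n. LINT x|lborel. cmod (trunc (real n) f x - f x)) \<longlonglongrightarrow> 0" if int: "integrable lborel f" for f
  proof -
    have [measurable]: "f \<in> borel_measurable borel" using borel_measurable_integrable[OF int] by simp
    have "(\<lambda>n. LINT x|lborel. cmod (trunc (real n) f x - f x)) \<longlonglongrightarrow> (LINT x::real|lborel. 0)"
    proof (rule integral_dominated_convergence[where w="\<lambda>x. cmod (f x)"])
      show "AE x in lborel. (\<lambda>n. cmod (trunc (real n) f x - f x)) \<longlonglongrightarrow> 0"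
      proof (intro AE_I2 tendsto_eventually)
        fix x :: real
        obtain N where N: "\<bar>x\<bar> < real N" using reals_Archimedean2 by blast
        show "\<forall>\<^sub>F n in sequentially. cmod (trunc (real n) f x - f x) = 0"
          by (rule eventually_sequentiallyI[of N]) (use N in \<open>auto simp: trunc_def indicator_def\<close>)
      qed
    qed (use int in \<open>auto simp: trunc_def[abs_def] indicator_def\<close>)
    then show ?thesis by simp
  qed
  have contr: "ft f \<in> sqint lborel \<and> l2norm lborel (ft f) \<le> l2norm lborel f"
    if f: "f \<in> sqint lborel" and int: "integrable lborel f" for f
    using ft_contraction_limit[of "\<lambda>n. trunc (real n) f", OF T(1-3)[OF f] eq_refl[OF T(4)[OF f]] f int L1[OF int] trunc_limit_nat[OF f]] by blast
  show sq: "ft f \<in> sqint lborel" using contr[OF f int] by blast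
  show "l2norm lborel (ft f) = l2norm lborel f"
    using contr[OF sqint_diff[OF T(1)[OF f] f]] T(2)[OF f] int
    by (intro ft_isometry_limit[of "\<lambda>n. trunc (real n) f", OF T[OF f] f int sq _ trunc_limit_nat[OF f]]) auto
qed

section \<open>The Fourier--Plancherel transform\<close>

lemma fourier_trunc_eq: "fourier_trunc R f = ft (trunc R f)"
proof
  fix k
  have "(LINT x:{-R..R}|lborel. expi (k * x) * f x) =
    (LINT x|lborel. expi (k * x) * trunc R f x)"
    unfolding set_lebesgue_integral_def trunc_def
    by (intro Bochner_Integration.integral_cong) (auto simp: indicator_def)
  then show "fourier_trunc R f k = ft (trunc R f) k" by (simp add: fourier_trunc_def ft_def)
qed

lemma is_fourier_iff:
  "is_fourier f g \<longleftrightarrow> g \<in> sqint lborel \<and> ((\<lambda>R. l2norm lborel (\<lambda>k. ft (trunc R f) k - g k)) \<longlongrightarrow> 0) at_top"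
proof -
  have eq: "(LINT k|lborel. (cmod (g k - fourier_trunc R f k))\<^sup>2) = (l2norm lborel (\<lambda>k. ft (trunc R f) k - g k))\<^sup>2" for R
    unfolding fourier_trunc_eq l2norm_minus_commute[of lborel "ft (trunc R f)" g] by (simp add: l2norm_power2)
  have "((\<lambda>R. (l2norm lborel (\<lambda>k. ft (trunc R f) k - g k))\<^sup>2) \<longlongrightarrow> 0) at_top \<longleftrightarrow>
    ((\<lambda>R. l2norm lborel (\<lambda>k. ft (trunc R f) k - g k)) \<longlongrightarrow> 0) at_top" (is "?A \<longleftrightarrow> ?B")
  proof
    assume ?A
    from tendsto_real_sqrt[OF this] show ?B by simp
  next
    assume ?B
    from tendsto_power[OF this, of 2] show ?A by simp
  qed
  then show ?thesis unfolding is_fourier_def eq L2_eq_sqint by simp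
qed

lemma is_fourier_sqint: "is_fourier f g \<Longrightarrow> g \<in> sqint lborel"
  by (simp add: is_fourier_iff)

lemma is_fourier_seq:
  "is_fourier f g \<Longrightarrow> (\<lambda>n. l2norm lborel (\<lambda>k. ft (trunc (real n) f) k - g k)) \<longlonglongrightarrow> 0"
  using filterlim_compose[OF conjunct2[OF iffD1[OF is_fourier_iff]] filterlim_real_sequentially] by blast

lemma l2norm_ft_diff:
  assumes "f \<in> sqint lborel" "integrable lborel f" "g \<in> sqint lborel" "integrable lborel g"
  shows "l2norm lborel (\<lambda>k. ft f k - ft g k) = l2norm lborel (\<lambda>x. f x - g x)"
proof -
  have "(\<lambda>k. ft f k - ft g k) = ft (\<lambda>x. f x - g x)" using assms by (simp add: ft_diff fun_eq_iff)
  then show ?thesis using assms by (simp add: Plancherel sqint_diff)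
qed

lemma is_fourier_norm:
  assumes "f \<in> sqint lborel" "is_fourier f g"
  shows "l2norm lborel g = l2norm lborel f"
proof (rule LIMSEQ_unique)
  show "(\<lambda>n. l2norm lborel (trunc (real n) f)) \<longlonglongrightarrow> l2norm lborel f"
    by (rule tendsto_l2norm[OF trunc_sqint(1) _ trunc_limit_nat]) (fact assms)+
  show "(\<lambda>n. l2norm lborel (trunc (real n) f)) \<longlonglongrightarrow> l2norm lborel g"
    unfolding Plancherel_trunc(2)[OF assms(1), symmetric]
    by (rule tendsto_l2norm[OF Plancherel_trunc(1)[OF assms(1)] is_fourier_sqint[OF assms(2)] is_fourier_seq[OF assms(2)]])
qed

lemma is_fourier_add:
  assumes f: "f \<in> sqint lborel" "is_fourier f F" and g: "g \<in> sqint lborel" "is_fourier g G"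
  shows "is_fourier (\<lambda>x. f x + g x) (\<lambda>k. F k + G k)"
  unfolding is_fourier_iff
proof
  note F = is_fourier_sqint[OF f(2)] and G = is_fourier_sqint[OF g(2)]
  show "(\<lambda>k. F k + G k) \<in> sqint lborel" by (rule sqint_add[OF F G])
  have eq: "(\<lambda>k. ft (trunc R (\<lambda>x. f x + g x)) k - (F k + G k)) =
    (\<lambda>k. (ft (trunc R f) k - F k) + (ft (trunc R g) k - G k))" for R
  proof -
    have "trunc R (\<lambda>x. f x + g x) = (\<lambda>x. trunc R f x + trunc R g x)" by (auto simp: trunc_def algebra_simps)
    then show ?thesis using trunc_integrable[OF f(1)] trunc_integrable[OF g(1)] by (auto simp: ft_add)
  qed
  show "((\<lambda>R. l2norm lborel (\<lambda>k. ft (trunc R (\<lambda>x. f x + g x)) k - (F k + G k))) \<longlongrightarrow> 0) at_top"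
  proof (rule Lim_null_comparison)
    show "\<forall>\<^sub>F R in at_top. norm (l2norm lborel (\<lambda>k. ft (trunc R (\<lambda>x. f x + g x)) k - (F k + G k))) \<le>
      l2norm lborel (\<lambda>k. ft (trunc R f) k - F k) + l2norm lborel (\<lambda>k. ft (trunc R g) k - G k)"
      unfolding eq using F G f g
      by (auto intro!: always_eventually l2norm_triangle sqint_diff Plancherel_trunc)
    show "((\<lambda>R. l2norm lborel (\<lambda>k. ft (trunc R f) k - F k) + l2norm lborel (\<lambda>k. ft (trunc R g) k - G k)) \<longlongrightarrow> 0) at_top"
      using f(2) g(2) tendsto_add[of _ 0 at_top _ 0] unfolding is_fourier_iff by auto
  qed
qed

lemma is_fourier_cmult:
  assumes "is_fourier f F"
  shows "is_fourier (\<lambda>x. c * f x) (\<lambda>k. c * F k)"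
  unfolding is_fourier_iff
proof
  show "(\<lambda>k. c * F k) \<in> sqint lborel" using assms by (intro sqint_cmult is_fourier_sqint)
  have eq: "(\<lambda>k. ft (trunc R (\<lambda>x. c * f x)) k - c * F k) = (\<lambda>k. c * (ft (trunc R f) k - F k))" for R
  proof -
    have "trunc R (\<lambda>x. c * f x) = (\<lambda>x. c * trunc R f x)" by (auto simp: trunc_def)
    then show ?thesis by (auto simp: ft_cmult algebra_simps)
  qed
  show "((\<lambda>R. l2norm lborel (\<lambda>k. ft (trunc R (\<lambda>x. c * f x)) k - c * F k)) \<longlongrightarrow> 0) at_top"
    unfolding eq l2norm_cmult using assms tendsto_mult_left[of _ 0 at_top "cmod c"] unfolding is_fourier_iff by auto
qed

lemma is_fourier_diff:
  assumes "f \<in> sqint lborel" "is_fourier f F" "g \<in> sqint lborel" "is_fourier g G"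
  shows "is_fourier (\<lambda>x. f x - g x) (\<lambda>k. F k - G k)"
  using is_fourier_add[OF assms(1,2) sqint_cmult[OF assms(3)] is_fourier_cmult[OF assms(4)], of "-1"] by simp

lemma is_fourier_unique_AE:
  assumes f: "f \<in> sqint lborel" "is_fourier f F" and g: "g \<in> sqint lborel" "is_fourier g G"
    and eq: "AE x in lborel. f x = g x"
  shows "AE k in lborel. F k = G k"
proof -
  have sq: "(\<lambda>x. F x - G x) \<in> sqint lborel" by (intro sqint_diff is_fourier_sqint[OF f(2)] is_fourier_sqint[OF g(2)])
  have "l2norm lborel (\<lambda>x. F x - G x) = l2norm lborel (\<lambda>x. f x - g x)"
    by (rule is_fourier_norm[OF sqint_diff is_fourier_diff]) (fact f g)+
  also have "\<dots> = 0"
    using eq by (subst l2norm_eq_0_iff[OF sqint_diff[OF f(1) g(1)]]) auto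
  finally show ?thesis unfolding l2norm_eq_0_iff[OF sq] by auto
qed

text \<open>The relation compares functions rather than classes. Its invariance under null sets
  makes the arbitrary representative chosen in \<open>schr_prop\<close> harmless.\<close>

lemma is_fourier_cong_AE:
  assumes f: "f \<in> sqint lborel" "is_fourier f F" and f': "f' \<in> sqint lborel" "AE x in lborel. f x = f' x"
    and F': "F' \<in> borel_measurable lborel" "AE k in lborel. F k = F' k"
  shows "is_fourier f' F'"
proof -
  have FF: "F \<in> sqint lborel" using f(2) by (rule is_fourier_sqint)
  have [measurable]: "f \<in> borel_measurable borel" "f' \<in> borel_measurable borel" "F \<in> borel_measurable borel" "F' \<in> borel_measurable borel"
    using f(1) f'(1) FF F'(1) by (auto simp: sqint_def)
  have "ft (trunc R f) = ft (trunc R f')" for R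
  proof (rule ft_cong_AE)
    show "AE x in lborel. trunc R f x = trunc R f' x" using f'(2) by eventually_elim (simp add: trunc_def)
  qed (auto simp: trunc_def[abs_def])
  moreover have "l2norm lborel (\<lambda>k. ft (trunc R f') k - F k) = l2norm lborel (\<lambda>k. ft (trunc R f') k - F' k)" for R
  proof (rule l2norm_cong_AE)
    show "AE k in lborel. ft (trunc R f') k - F k = ft (trunc R f') k - F' k" using F'(2) by eventually_elim simp
  qed (auto simp: trunc_def[abs_def])
  ultimately show ?thesis
    using f(2) sqint_cong_AE[OF FF F'] unfolding is_fourier_iff by simp
qed

text \<open>Completeness gives a limit along integer radii. The estimate \<open>d\<close> for two
  radii, the second of which is sent to infinity, then gives convergence along all real R, as the
  definition demands.\<close>

lemma is_fourier_exists:
  assumes f: "f \<in> sqint lborel"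
  shows "\<exists>g. is_fourier f g"
proof -
  let ?n = "l2norm lborel" and ?F = "\<lambda>R. ft (trunc R f)"
  have d: "?n (\<lambda>k. ?F R k - ?F S k) \<le> ?n (\<lambda>x. trunc R f x - f x) + ?n (\<lambda>x. trunc S f x - f x)" for R S
  proof -
    have "?n (\<lambda>k. ?F R k - ?F S k) = ?n (\<lambda>k. trunc R f k - trunc S f k)"
      by (intro l2norm_ft_diff trunc_sqint trunc_integrable f)
    also have "\<dots> \<le> ?n (\<lambda>x. trunc R f x - f x) + ?n (\<lambda>x. f x - trunc S f x)"
      by (intro l2norm_triangle_diff trunc_sqint f)
    finally show ?thesis by (simp add: l2norm_minus_commute[of lborel f])
  qed
  have "\<exists>g\<in>sqint lborel. (\<lambda>n. ?n (\<lambda>x. ?F (real n) x - g x)) \<longlonglongrightarrow> 0"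
  proof (rule l2_complete[OF Plancherel_trunc(1)[OF f]])
    fix e :: real assume "0 < e"
    then obtain N where N: "\<And>n. n \<ge> N \<Longrightarrow> norm (?n (\<lambda>x. trunc (real n) f x - f x) - 0) < e / 2"
      using LIMSEQ_D[OF trunc_limit_nat[OF f], of "e/2"] by auto
    have "?n (\<lambda>x. ?F (real m) x - ?F (real n) x) < e" if "m \<ge> N" "n \<ge> N" for m n
      using d[of "real m" "real n"] N[OF that(1)] N[OF that(2)] by simp
    then show "\<exists>N. \<forall>m\<ge>N. \<forall>n\<ge>N. ?n (\<lambda>x. ?F (real m) x - ?F (real n) x) < e" by blast
  qed
  then obtain g where g: "g \<in> sqint lborel" "(\<lambda>n. ?n (\<lambda>x. ?F (real n) x - g x)) \<longlonglongrightarrow> 0" by blast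
  have le: "?n (\<lambda>x. ?F R x - g x) \<le> ?n (\<lambda>x. trunc R f x - f x)" for R
  proof (rule LIMSEQ_le_const)
    show "\<exists>N. \<forall>n\<ge>N. ?n (\<lambda>x. ?F R x - g x) \<le> ?n (\<lambda>x. trunc R f x - f x) + ?n (\<lambda>x. trunc (real n) f x - f x) + ?n (\<lambda>x. ?F (real n) x - g x)"
      using l2norm_triangle_diff[OF Plancherel_trunc(1)[OF f] Plancherel_trunc(1)[OF f] g(1)] d
      by (meson add_right_mono order_trans)
    show "(\<lambda>n. ?n (\<lambda>x. trunc R f x - f x) + ?n (\<lambda>x. trunc (real n) f x - f x) + ?n (\<lambda>x. ?F (real n) x - g x))
       \<longlonglongrightarrow> ?n (\<lambda>x. trunc R f x - f x)"
      using tendsto_add[OF tendsto_add[OF tendsto_const trunc_limit_nat[OF f]] g(2)] by simp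
  qed
  have "((\<lambda>R. ?n (\<lambda>x. ?F R x - g x)) \<longlongrightarrow> 0) at_top"
    by (rule Lim_null_comparison[OF _ trunc_limit[OF f]]) (use le in simp)
  then show ?thesis using g(1) unfolding is_fourier_iff by blast
qed

lemma is_fourier_ft:
  assumes f: "f \<in> sqint lborel" "integrable lborel f"
  shows "is_fourier f (ft f)"
  unfolding is_fourier_iff
proof
  show "ft f \<in> sqint lborel" by (rule Plancherel(1)[OF f])
  have "l2norm lborel (\<lambda>k. ft (trunc R f) k - ft f k) = l2norm lborel (\<lambda>x. trunc R f x - f x)" for R
    by (intro l2norm_ft_diff trunc_sqint trunc_integrable f)
  then show "((\<lambda>R. l2norm lborel (\<lambda>k. ft (trunc R f) k - ft f k)) \<longlongrightarrow> 0) at_top"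
    using trunc_limit[OF f(1)] by simp
qed

lemma l2inner_polar:
  assumes "f \<in> sqint M" "g \<in> sqint M"
  shows "2 * Re (l2inner M f g) = (l2norm M (\<lambda>x. f x + g x))\<^sup>2 - (l2norm M f)\<^sup>2 - (l2norm M g)\<^sup>2"
  using l2norm_add_sq[OF assms] by simp

text \<open>Polarization: norms determine the real part, and the real part for \<i> g determines the
  imaginary part.\<close>

lemma Parseval:
  assumes f: "f \<in> sqint lborel" "is_fourier f F" and g: "g \<in> sqint lborel" "is_fourier g G"
  shows "l2inner lborel F G = l2inner lborel f g"
proof -
  have re: "Re (l2inner lborel F G) = Re (l2inner lborel f g)"
    if "f \<in> sqint lborel" "is_fourier f F" "g \<in> sqint lborel" "is_fourier g G" for f g F G
    using l2inner_polar[OF is_fourier_sqint[OF that(2)] is_fourier_sqint[OF that(4)]] l2inner_polar[OF that(1,3)]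
      is_fourier_norm[OF that(1,2)] is_fourier_norm[OF that(3,4)] is_fourier_norm[OF sqint_add[OF that(1,3)] is_fourier_add[OF that]]
    by simp
  show ?thesis
  proof (rule complex_eqI)
    show "Re (l2inner lborel F G) = Re (l2inner lborel f g)" by (rule re[OF f g])
    show "Im (l2inner lborel F G) = Im (l2inner lborel f g)"
      using re[OF f sqint_cmult[OF g(1)] is_fourier_cmult[OF g(2)], of \<i>] by (simp add: l2inner_cmult_right)
  qed
qed

lemma ft_multiplication:
  assumes f: "integrable lborel f" and h: "integrable lborel h"
  shows "(LINT k|lborel. ft f k * h k) = (LINT x|lborel. f x * ft h x)"
proof -
  have [measurable]: "f \<in> borel_measurable borel" "h \<in> borel_measurable borel"
    using borel_measurable_integrable[OF f] borel_measurable_integrable[OF h] by auto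
  let ?e = "\<lambda>k x. expi (k * x)" and ?c = "complex_of_real (1 / sqrt (2 * pi))"
  have int: "integrable (lborel \<Otimes>\<^sub>M lborel) (\<lambda>(k, x). ?e k x * f x * h k)"
  proof (rule lborel_pair.Fubini_integrable)
    show "(\<lambda>(k, x). ?e k x * f x * h k) \<in> borel_measurable (lborel \<Otimes>\<^sub>M lborel)" by measurable
    have "(\<lambda>k. LINT x|lborel. cmod (?e k x * f x * h k)) = (\<lambda>k. (LINT x|lborel. cmod (f x)) * cmod (h k))"
      by (simp add: norm_mult)
    then show "integrable lborel (\<lambda>k. LINT x|lborel. cmod (case (k, x) of (k, x) \<Rightarrow> ?e k x * f x * h k))"
      using h by simp
    show "AE k in lborel. integrable lborel (\<lambda>x. case (k, x) of (k, x) \<Rightarrow> ?e k x * f x * h k)"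
      using integrable_ft_integrand[OF f] by simp
  qed
  have "(LINT k|lborel. ft f k * h k) = (LINT k|lborel. ?c * (LINT x|lborel. ?e k x * f x * h k))"
    unfolding ft_def by simp
  also have "\<dots> = ?c * (LINT k|lborel. LINT x|lborel. ?e k x * f x * h k)" by (rule integral_mult_right_zero)
  also have "(LINT k|lborel. LINT x|lborel. ?e k x * f x * h k) = (LINT x|lborel. LINT k|lborel. ?e k x * f x * h k)"
    using lborel_pair.Fubini_integral[OF int] by simp
  also have "?c * \<dots> = (LINT x|lborel. ?c * (LINT k|lborel. ?e k x * f x * h k))" by (rule integral_mult_right_zero[symmetric])
  also have "\<dots> = (LINT x|lborel. f x * ft h x)"
  proof (rule Bochner_Integration.integral_cong[OF refl])
    fix x
    have "(LINT k|lborel. ?e k x * f x * h k) = (LINT k|lborel. f x * (?e x k * h k))"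
      by (intro Bochner_Integration.integral_cong) (auto simp: mult_ac)
    then show "?c * (LINT k|lborel. ?e k x * f x * h k) = f x * ft h x" unfolding ft_def by simp
  qed
  finally show ?thesis .
qed

text \<open>The pairing without conjugation is continuous in both arguments, so the identity passes
  from truncations, where it is Fubini's theorem, to the L2 transform.\<close>

lemma is_fourier_multiplication:
  assumes f: "f \<in> sqint lborel" "is_fourier f F" and h: "h \<in> sqint lborel" "is_fourier h H"
  shows "(LINT k|lborel. F k * h k) = (LINT x|lborel. f x * H x)"
proof -
  have eq: "(LINT k|lborel. a k * b k) = l2inner lborel (\<lambda>k. cnj (a k)) b" for a b :: "real \<Rightarrow> complex"
    by (simp add: l2inner_def)
  have c: "(\<lambda>n. l2norm lborel (\<lambda>x. cnj (a n x) - cnj (b x))) \<longlonglongrightarrow> 0" if "(\<lambda>n. l2norm lborel (\<lambda>x. a n x - b x)) \<longlonglongrightarrow> 0"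
    for a :: "nat \<Rightarrow> real \<Rightarrow> complex" and b
    using that l2norm_cnj[of lborel "\<lambda>x. a n x - b x" for n] by simp
  have "(\<lambda>n. LINT k|lborel. ft (trunc (real n) f) k * trunc (real n) h k) \<longlonglongrightarrow> (LINT k|lborel. F k * h k)"
    unfolding eq by (intro tendsto_l2inner c is_fourier_seq trunc_limit_nat sqint_cnj f h Plancherel_trunc trunc_sqint is_fourier_sqint[OF f(2)])
  moreover have "(\<lambda>n. LINT k|lborel. trunc (real n) f k * ft (trunc (real n) h) k) \<longlonglongrightarrow> (LINT k|lborel. f k * H k)"
    unfolding eq by (intro tendsto_l2inner c is_fourier_seq trunc_limit_nat sqint_cnj f h Plancherel_trunc trunc_sqint is_fourier_sqint[OF h(2)])
  moreover have "(LINT k|lborel. ft (trunc (real n) f) k * trunc (real n) h k) = (LINT k|lborel. trunc (real n) f k * ft (trunc (real n) h) k)" for n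
    by (intro ft_multiplication trunc_integrable f h)
  ultimately show ?thesis by (simp add: LIMSEQ_unique)
qed

section \<open>Shifts, reflections, conjugation and modulation; inversion\<close>

lemma nn_integral_lborel_isometry:
  fixes g :: "real \<Rightarrow> ennreal"
  assumes "g \<in> borel_measurable borel" "\<bar>c\<bar> = 1"
  shows "(\<integral>\<^sup>+x. g (t + c * x) \<partial>lborel) = (\<integral>\<^sup>+x. g x \<partial>lborel)"
  using nn_integral_real_affine[OF assms(1), of c t] assms(2) by auto

lemma integral_lborel_isometry:
  fixes g :: "real \<Rightarrow> 'a :: {banach, second_countable_topology}"
  assumes "\<bar>c\<bar> = 1"
  shows "(LINT x|lborel. g (t + c * x)) = (LINT x|lborel. g x)"
  using lborel_integral_real_affine[of c g t] assms by auto

lemma sqint_isometry: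
  assumes "f \<in> sqint lborel" "\<bar>c :: real\<bar> = 1"
  shows "(\<lambda>x. f (t + c * x)) \<in> sqint lborel"
proof -
  have [measurable]: "f \<in> borel_measurable borel" using assms by (simp add: sqint_def)
  have "integrable lborel (\<lambda>x. (cmod (f (t + c * x)))\<^sup>2)"
    using lborel_integrable_real_affine[of "\<lambda>x. (cmod (f x))\<^sup>2" c t] assms by (auto simp: sqint_def)
  then show ?thesis by (intro sqintI) auto
qed

lemma l2norm_isometry:
  assumes "\<bar>c :: real\<bar> = 1"
  shows "l2norm lborel (\<lambda>x. f (t + c * x)) = l2norm lborel f"
  unfolding l2norm_def using integral_lborel_isometry[OF assms, of "\<lambda>x. (cmod (f x))\<^sup>2" t] by simp

lemma sqint_shift: "f \<in> sqint lborel \<Longrightarrow> (\<lambda>x::real. f (x + t)) \<in> sqint lborel"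
  using sqint_isometry[of f 1 t] by (simp add: add.commute)

lemma l2norm_shift: "l2norm lborel (\<lambda>x::real. f (x + t)) = l2norm lborel f"
  using l2norm_isometry[of 1 f t] by (simp add: add.commute)

lemma sqint_reflect: "f \<in> sqint lborel \<Longrightarrow> (\<lambda>x::real. f (- x)) \<in> sqint lborel"
  using sqint_isometry[of f "-1" 0] by simp

lemma l2norm_reflect: "l2norm lborel (\<lambda>x::real. f (- x)) = l2norm lborel f"
  using l2norm_isometry[of "-1" f 0] by simp

lemma ft_reflect: "ft (\<lambda>x. f (- x)) k = ft f (- k)"
proof -
  have "(LINT x|lborel. expi (k * x) * f (- x)) =
    (LINT x|lborel. expi (- k * x) * f x)"
    using integral_lborel_isometry[of "-1" "\<lambda>x. expi (- k * x) * f x" 0] by simp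
  then show ?thesis by (simp add: ft_def)
qed

lemma ft_cnj: "ft (\<lambda>x. cnj (f x)) k = cnj (ft f (- k))"
proof -
  have "cnj (expi (- k * x) * f x) = expi (k * x) * cnj (f x)" for x
    by (simp add: exp_cnj)
  then have "cnj (LINT x|lborel. expi (- k * x) * f x) =
      (LINT x|lborel. expi (k * x) * cnj (f x))"
    unfolding Bochner_Integration.integral_cnj[symmetric] by (simp only:)
  then show ?thesis unfolding ft_def by simp
qed

lemma ft_modulate: "ft (\<lambda>x. expi (\<xi> * x) * f x) k = ft f (k + \<xi>)"
proof -
  have "expi (k * x) * (expi (\<xi> * x) * f x) =
    expi ((k + \<xi>) * x) * f x" for x
    unfolding mult.assoc[symmetric] exp_add[symmetric] by (simp add: algebra_simps)
  then show ?thesis unfolding ft_def by (simp only:)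
qed

lemma is_fourier_reflect:
  assumes "is_fourier f F"
  shows "is_fourier (\<lambda>x. f (- x)) (\<lambda>k. F (- k))"
proof -
  have t: "trunc R (\<lambda>x. f (- x)) = (\<lambda>x. trunc R f (- x))" for R
    by (auto simp: trunc_def indicator_def fun_eq_iff)
  have "l2norm lborel (\<lambda>k. ft (trunc R (\<lambda>x. f (- x))) k - F (- k)) = l2norm lborel (\<lambda>k. ft (trunc R f) k - F k)" for R
    unfolding t ft_reflect using l2norm_reflect[of "\<lambda>k. ft (trunc R f) k - F k"] .
  then show ?thesis using assms sqint_reflect[of F] unfolding is_fourier_iff by simp
qed

lemma is_fourier_cnj_reflect:
  assumes "is_fourier f F"
  shows "is_fourier (\<lambda>x. cnj (f (- x))) (\<lambda>k. cnj (F k))"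
proof -
  have t: "trunc R (\<lambda>x. cnj (f (- x))) = (\<lambda>x. cnj (trunc R f (- x)))" for R
    by (auto simp: trunc_def indicator_def fun_eq_iff)
  have "l2norm lborel (\<lambda>k. ft (trunc R (\<lambda>x. cnj (f (- x)))) k - cnj (F k)) = l2norm lborel (\<lambda>k. ft (trunc R f) k - F k)" for R
    unfolding t ft_cnj ft_reflect using l2norm_cnj[of lborel "\<lambda>k. ft (trunc R f) k - F k"] by simp
  then show ?thesis using assms sqint_cnj[of F] unfolding is_fourier_iff by simp
qed

lemma is_fourier_modulate:
  assumes "is_fourier f F"
  shows "is_fourier (\<lambda>x. expi (\<xi> * x) * f x) (\<lambda>k. F (k + \<xi>))"
proof -
  have t: "trunc R (\<lambda>x. expi (\<xi> * x) * f x) = (\<lambda>x. expi (\<xi> * x) * trunc R f x)" for R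
    by (auto simp: trunc_def fun_eq_iff)
  have "l2norm lborel (\<lambda>k. ft (trunc R (\<lambda>x. expi (\<xi> * x) * f x)) k - F (k + \<xi>)) =
    l2norm lborel (\<lambda>k. ft (trunc R f) k - F k)" for R
    unfolding t ft_modulate using l2norm_shift[of "\<lambda>k. ft (trunc R f) k - F k" \<xi>] .
  then show ?thesis using assms sqint_shift[of F] unfolding is_fourier_iff by simp
qed

text \<open>Let h be the transform of g and \<phi> the conjugate of h(x) - f(-x). The multiplication
  formula carries the pairing of h with \<phi> over to g, and Parseval's identity for the conjugate
  of f(-x), whose transform is the conjugate of g, carries it back. Hence \<phi> is orthogonal to
  itself.\<close>

lemma Fourier_inversion:
  assumes f: "f \<in> sqint lborel" "is_fourier f g"
  shows "is_fourier g (\<lambda>x. f (- x))"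
proof -
  have g: "g \<in> sqint lborel" using f(2) by (rule is_fourier_sqint)
  obtain h where h: "is_fourier g h" using is_fourier_exists[OF g] by blast
  have hs: "h \<in> sqint lborel" using h by (rule is_fourier_sqint)
  have fr: "(\<lambda>x. f (- x)) \<in> sqint lborel" using f(1) by (rule sqint_reflect)
  let ?\<phi> = "\<lambda>x. cnj (h x - f (- x))"
  have d: "(\<lambda>x. h x - f (- x)) \<in> sqint lborel" using hs fr by (rule sqint_diff)
  then have \<phi>: "?\<phi> \<in> sqint lborel" by (rule sqint_cnj)
  obtain \<Phi> where \<Phi>: "is_fourier ?\<phi> \<Phi>" using is_fourier_exists[OF \<phi>] by blast
  have "l2inner lborel (\<lambda>x. cnj (h x)) ?\<phi> = (LINT k|lborel. h k * ?\<phi> k)" by (simp add: l2inner_def)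
  also have "\<dots> = (LINT k|lborel. g k * \<Phi> k)" by (rule is_fourier_multiplication[OF g h \<phi> \<Phi>])
  also have "\<dots> = l2inner lborel (\<lambda>k. cnj (g k)) \<Phi>" by (simp add: l2inner_def)
  also have "\<dots> = l2inner lborel (\<lambda>x. cnj (f (- x))) ?\<phi>"
    by (rule Parseval[OF sqint_cnj[OF fr] is_fourier_cnj_reflect[OF f(2)] \<phi> \<Phi>])
  finally have "l2inner lborel (\<lambda>x. cnj (h x) - cnj (f (- x))) ?\<phi> = 0"
    by (subst l2inner_diff_left[OF sqint_cnj[OF hs] sqint_cnj[OF fr] \<phi>]) simp
  then have "l2norm lborel ?\<phi> = 0" using l2inner_self[of lborel ?\<phi>] by simp
  then have "AE x in lborel. h x = f (- x)" unfolding l2norm_eq_0_iff[OF \<phi>] by simp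
  then show ?thesis
    using is_fourier_cong_AE[OF g h g] fr by (simp add: sqint_def)
qed

lemma Fourier_surjective:
  assumes g: "g \<in> sqint lborel"
  shows "\<exists>f\<in>sqint lborel. is_fourier f g"
proof -
  obtain h where h: "is_fourier g h" using is_fourier_exists[OF g] by blast
  have hs: "h \<in> sqint lborel" using h by (rule is_fourier_sqint)
  have "is_fourier (\<lambda>x. h (- x)) (\<lambda>x. g (- (- x)))"
    by (rule is_fourier_reflect[OF Fourier_inversion[OF g h]])
  then show ?thesis using sqint_reflect[OF hs] by auto
qed

section \<open>Correlations as transforms of products\<close>

definition corr :: "(real \<Rightarrow> complex) \<Rightarrow> (real \<Rightarrow> complex) \<Rightarrow> real \<Rightarrow> complex" where
  "corr U V \<xi> = (LINT k|lborel. cnj (U k) * V (k + \<xi>))"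

text \<open>The product is integrable, so \<open>ft\<close> applies to it. Its exponential is
  attached to v, where it shifts the transform, and Parseval's identity does the rest.\<close>

lemma ft_cnj_mult:
  assumes u: "u \<in> sqint lborel" "is_fourier u U" and v: "v \<in> sqint lborel" "is_fourier v V"
  shows "ft (\<lambda>x. cnj (u x) * v x) \<xi> = complex_of_real (1 / sqrt (2 * pi)) * corr U V \<xi>"
proof -
  let ?m = "\<lambda>x. expi (\<xi> * x) * v x"
  have m: "?m \<in> sqint lborel" using v(1) by (intro sqint_unimod) auto
  have "(LINT x|lborel. expi (\<xi> * x) * (cnj (u x) * v x)) = l2inner lborel u ?m"
    unfolding l2inner_def by (intro Bochner_Integration.integral_cong) (auto simp: mult_ac)
  also have "\<dots> = l2inner lborel U (\<lambda>k. V (k + \<xi>))"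
    by (rule Parseval[symmetric, OF u m is_fourier_modulate[OF v(2)]])
  finally show ?thesis by (simp add: ft_def corr_def l2inner_def)
qed

lemma corr_sqint:
  assumes u: "u \<in> sqint lborel" "is_fourier u U" and v: "v \<in> sqint lborel" "is_fourier v V"
    and uv: "(\<lambda>x. cnj (u x) * v x) \<in> sqint lborel"
  shows "corr U V \<in> sqint lborel"
proof -
  have int: "integrable lborel (\<lambda>x. cnj (u x) * v x)" by (rule l2inner_integrable[OF v(1) u(1)])
  have "(\<lambda>\<xi>. complex_of_real (sqrt (2 * pi)) * ft (\<lambda>x. cnj (u x) * v x) \<xi>) \<in> sqint lborel"
    by (intro sqint_cmult Plancherel uv int)
  moreover have "complex_of_real (sqrt (2 * pi)) * complex_of_real (1 / sqrt (2 * pi)) = 1"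
    unfolding of_real_mult[symmetric] by simp
  ultimately show ?thesis unfolding ft_cnj_mult[OF u v] mult.assoc[symmetric] by simp
qed

text \<open>The four factors are grouped as the conjugate of \<open>cnj u2 * u1\<close> times
  \<open>cnj u3 * u4\<close>, which accounts for the order of the indices here and in later
  formulas. Parseval's identity wants both products in L2, and this is not automatic.\<close>

lemma integral_mult4_corr:
  assumes u1: "u1 \<in> sqint lborel" "is_fourier u1 U1" and u2: "u2 \<in> sqint lborel" "is_fourier u2 U2"
    and u3: "u3 \<in> sqint lborel" "is_fourier u3 U3" and u4: "u4 \<in> sqint lborel" "is_fourier u4 U4"
    and s12: "(\<lambda>x. cnj (u2 x) * u1 x) \<in> sqint lborel" and s34: "(\<lambda>x. cnj (u3 x) * u4 x) \<in> sqint lborel"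
  shows "(LINT x|lborel. cnj (u1 x) * u2 x * cnj (u3 x) * u4 x) =
    complex_of_real (1 / (2 * pi)) * l2inner lborel (corr U2 U1) (corr U3 U4)"
proof -
  have i12: "integrable lborel (\<lambda>x. cnj (u2 x) * u1 x)" by (rule l2inner_integrable[OF u1(1) u2(1)])
  have i34: "integrable lborel (\<lambda>x. cnj (u3 x) * u4 x)" by (rule l2inner_integrable[OF u4(1) u3(1)])
  have "(LINT x|lborel. cnj (u1 x) * u2 x * cnj (u3 x) * u4 x) = l2inner lborel (\<lambda>x. cnj (u2 x) * u1 x) (\<lambda>x. cnj (u3 x) * u4 x)"
    unfolding l2inner_def by (intro Bochner_Integration.integral_cong) (auto simp: mult_ac)
  also have "\<dots> = l2inner lborel (ft (\<lambda>x. cnj (u2 x) * u1 x)) (ft (\<lambda>x. cnj (u3 x) * u4 x))"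
    by (rule Parseval[symmetric, OF s12 is_fourier_ft[OF s12 i12] s34 is_fourier_ft[OF s34 i34]])
  also have "\<dots> = l2inner lborel (\<lambda>\<xi>. complex_of_real (1 / sqrt (2 * pi)) * corr U2 U1 \<xi>) (\<lambda>\<xi>. complex_of_real (1 / sqrt (2 * pi)) * corr U3 U4 \<xi>)"
    using ft_cnj_mult[OF u2 u1] ft_cnj_mult[OF u3 u4] by presburger
  also have "\<dots> = (complex_of_real (1 / sqrt (2 * pi)) * complex_of_real (1 / sqrt (2 * pi))) * l2inner lborel (corr U2 U1) (corr U3 U4)"
    by (simp only: l2inner_cmult_left l2inner_cmult_right complex_cnj_complex_of_real mult.assoc)
  also have "complex_of_real (1 / sqrt (2 * pi)) * complex_of_real (1 / sqrt (2 * pi)) = complex_of_real (1 / (2 * pi))"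
    unfolding of_real_mult[symmetric] by simp
  finally show ?thesis .
qed

lemma nn_integral_power4_corr:
  assumes w: "w \<in> sqint lborel" "is_fourier w U" and ww: "(\<lambda>x. cnj (w x) * w x) \<in> sqint lborel"
  shows "(\<integral>\<^sup>+x. ennreal ((cmod (w x)) ^ 4) \<partial>lborel) = ennreal (1 / (2 * pi)) * (\<integral>\<^sup>+\<xi>. ennreal ((cmod (corr U U \<xi>))\<^sup>2) \<partial>lborel)"
proof -
  have int: "integrable lborel (\<lambda>x. cnj (w x) * w x)" by (rule l2inner_integrable[OF w(1) w(1)])
  have 4: "(cmod z) ^ 4 = (cmod (cnj z * z))\<^sup>2" for z :: complex
    by (simp add: norm_mult flip: power2_eq_square power_mult)
  have "(\<integral>\<^sup>+x. ennreal ((cmod (w x)) ^ 4) \<partial>lborel) = (\<integral>\<^sup>+\<xi>. ennreal ((cmod (ft (\<lambda>x. cnj (w x) * w x) \<xi>))\<^sup>2) \<partial>lborel)"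
    unfolding 4 nn_integral_l2norm[OF ww] nn_integral_l2norm[OF Plancherel(1)[OF ww int]] Plancherel(2)[OF ww int] ..
  also have "\<dots> = (\<integral>\<^sup>+\<xi>. ennreal (1 / (2 * pi)) * ennreal ((cmod (corr U U \<xi>))\<^sup>2) \<partial>lborel)"
  proof (rule nn_integral_cong)
    fix \<xi>
    have "(cmod (ft (\<lambda>x. cnj (w x) * w x) \<xi>))\<^sup>2 = 1 / (2 * pi) * (cmod (corr U U \<xi>))\<^sup>2"
      unfolding ft_cnj_mult[OF w w] norm_mult power_mult_distrib by (simp add: norm_divide power_divide)
    then show "ennreal ((cmod (ft (\<lambda>x. cnj (w x) * w x) \<xi>))\<^sup>2) = ennreal (1 / (2 * pi)) * ennreal ((cmod (corr U U \<xi>))\<^sup>2)"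
      by (simp add: ennreal_mult[symmetric])
  qed
  also have "\<dots> = ennreal (1 / (2 * pi)) * (\<integral>\<^sup>+\<xi>. ennreal ((cmod (corr U U \<xi>))\<^sup>2) \<partial>lborel)"
  proof (rule nn_integral_cmult)
    note [measurable] = sqintD(1)[OF corr_sqint[OF w w ww]]
    show "(\<lambda>\<xi>. ennreal ((cmod (corr U U \<xi>))\<^sup>2)) \<in> borel_measurable lborel" by measurable
  qed
  finally show ?thesis .
qed

section \<open>The propagator and the ambiguity function\<close>

definition phase :: "real \<Rightarrow> (real \<Rightarrow> complex) \<Rightarrow> real \<Rightarrow> complex" where
  "phase t F k = expi (t * k\<^sup>2) * F k"

lemma phase_sqint:
  assumes "F \<in> sqint lborel"
  shows "phase t F \<in> sqint lborel" "l2norm lborel (phase t F) = l2norm lborel F"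
  using sqint_unimod[OF assms, of "\<lambda>k. expi (t * k\<^sup>2)"] by (simp_all add: phase_def[abs_def])

lemma phase_integrable:
  assumes "integrable lborel F"
  shows "integrable lborel (phase t F)"
proof (rule Bochner_Integration.integrable_bound[OF assms])
  show "phase t F \<in> borel_measurable lborel"
    using borel_measurable_integrable[OF assms] unfolding phase_def[abs_def] by measurable
qed (simp add: phase_def norm_mult)

text \<open>Surjectivity of the transform provides a function of the required kind, so the choice is
  effective. The transform of f occurring in the choice need not be F but agrees with it almost
  everywhere.\<close>

lemma schr_prop_is_fourier:
  assumes f: "f \<in> sqint lborel" "is_fourier f F"
  shows "schr_prop r f \<in> sqint lborel" "is_fourier (schr_prop r f) (phase r F)"
proof -
  let ?P = "\<lambda>h. h \<in> L2 \<and> (\<exists>fh. is_fourier f fh \<and> is_fourier h (\<lambda>k. expi (r * k\<^sup>2) * fh k))"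
  have F: "F \<in> sqint lborel" using f(2) by (rule is_fourier_sqint)
  obtain h where "h \<in> sqint lborel" "is_fourier h (phase r F)"
    using Fourier_surjective[OF phase_sqint(1)[OF F]] by blast
  then have "?P h" using f(2) by (auto simp: L2_eq_sqint phase_def[abs_def])
  then have P: "?P (schr_prop r f)" unfolding schr_prop_def by (rule someI[where P="?P"])
  then show s: "schr_prop r f \<in> sqint lborel" by (simp add: L2_eq_sqint)
  from P obtain fh where fh: "is_fourier f fh" "is_fourier (schr_prop r f) (phase r fh)"
    by (auto simp: phase_def[abs_def])
  have "AE k in lborel. fh k = F k" by (rule is_fourier_unique_AE[OF f(1) fh(1) f]) simp
  then have "AE k in lborel. phase r fh k = phase r F k" by eventually_elim (simp add: phase_def)
  then show "is_fourier (schr_prop r f) (phase r F)"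
    using phase_sqint(1)[OF F] by (intro is_fourier_cong_AE[OF s fh(2) s]) (auto simp: sqint_def)
qed

lemma is_fourier_inverse_ft:
  assumes "G \<in> sqint lborel" "integrable lborel G"
  shows "is_fourier (\<lambda>x. ft G (- x)) G" "(\<lambda>x. ft G (- x)) \<in> sqint lborel"
proof -
  have "is_fourier (ft G) (\<lambda>x. G (- x))" by (rule Fourier_inversion[OF assms(1) is_fourier_ft[OF assms]])
  from is_fourier_reflect[OF this] show "is_fourier (\<lambda>x. ft G (- x)) G" by simp
  show "(\<lambda>x. ft G (- x)) \<in> sqint lborel" by (intro sqint_reflect Plancherel assms)
qed

text \<open>One sequence of radii serves all t: multiplication by the phase preserves norms, so the
  error does not depend on t. The rate \<open>(1/2)^n\<close> gives convergence almost everywhere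
  directly, where extraction of a subsequence would make the radii depend on t.\<close>

lemma schr_prop_approx:
  assumes f: "f \<in> sqint lborel" "is_fourier f F"
  shows "\<exists>X :: nat \<Rightarrow> real. \<forall>t. AE x in lborel. (\<lambda>n. ft (phase t (trunc (X n) F)) (- x)) \<longlonglongrightarrow> schr_prop t f x"
proof -
  have F: "F \<in> sqint lborel" using f(2) by (rule is_fourier_sqint)
  have "\<forall>n. \<exists>m. l2norm lborel (\<lambda>x. trunc (real m) F x - F x) \<le> (1/2)^n"
  proof
    fix n
    have "0 < (1/2 :: real)^n" by simp
    from LIMSEQ_D[OF trunc_limit_nat[OF F] this]
    obtain m where "norm (l2norm lborel (\<lambda>x. trunc (real m) F x - F x) - 0) < (1/2)^n" by blast
    then have "l2norm lborel (\<lambda>x. trunc (real m) F x - F x) \<le> (1/2)^n"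
      unfolding diff_0_right real_norm_def by linarith
    then show "\<exists>m. l2norm lborel (\<lambda>x. trunc (real m) F x - F x) \<le> (1/2)^n" by blast
  qed
  from choice[OF this] obtain m where m: "\<forall>n. l2norm lborel (\<lambda>x. trunc (real (m n)) F x - F x) \<le> (1/2)^n" ..
  have "AE x in lborel. (\<lambda>n. ft (phase t (trunc (real (m n)) F)) (- x)) \<longlonglongrightarrow> schr_prop t f x" for t
  proof -
    let ?v = "\<lambda>n x. ft (phase t (trunc (real (m n)) F)) (- x)" and ?u = "schr_prop t f"
    have v: "?v n \<in> sqint lborel" "is_fourier (?v n) (phase t (trunc (real (m n)) F))" for n
      by (intro is_fourier_inverse_ft phase_sqint phase_integrable trunc_sqint trunc_integrable F)+
    note u = schr_prop_is_fourier[OF f, of t]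
    have "AE x in lborel. summable (\<lambda>n. cmod (?v n x - ?u x))"
    proof (rule summable_AE_l2)
      fix n
      show "(\<lambda>x. ?v n x - ?u x) \<in> sqint lborel" by (rule sqint_diff[OF v(1) u(1)])
      have "l2norm lborel (\<lambda>x. ?v n x - ?u x) = l2norm lborel (\<lambda>k. phase t (trunc (real (m n)) F) k - phase t F k)"
        by (rule is_fourier_norm[symmetric, OF sqint_diff[OF v(1) u(1)] is_fourier_diff[OF v u]])
      also have "(\<lambda>k. phase t (trunc (real (m n)) F) k - phase t F k) = phase t (\<lambda>k. trunc (real (m n)) F k - F k)"
        by (simp add: phase_def fun_eq_iff algebra_simps)
      also have "l2norm lborel \<dots> \<le> (1/2)^n"
        using spec[OF m, of n] by (simp add: phase_sqint sqint_diff trunc_sqint F)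
      finally show "l2norm lborel (\<lambda>x. ?v n x - ?u x) \<le> (1/2)^n" .
    qed
    then show ?thesis
    proof eventually_elim
      case (elim x)
      then have "(\<lambda>n. cmod (?v n x - ?u x)) \<longlonglongrightarrow> 0" by (rule summable_LIMSEQ_zero)
      then show ?case by (rule LIM_zero_cancel[OF tendsto_norm_zero_cancel])
    qed
  qed
  then show ?thesis by (intro exI[of _ "\<lambda>n. real (m n)"] allI)
qed

text \<open>The definition of \<open>schr_prop\<close> chooses a representative separately for every \<open>t\<close>. Since the Bochner
  integral of a non-measurable function is \<open>0\<close>, the outer integral in \<open>Qc\<close> is meaningful only because
  all these representatives agree almost everywhere with one jointly measurable function.\<close>

lemma schr_prop_jointly_measurable:
  assumes "f \<in> sqint lborel"
  shows "\<exists>u. (\<lambda>p. u (fst p) (snd p)) \<in> borel_measurable (lborel \<Otimes>\<^sub>M lborel) \<and> (\<forall>t. AE x in lborel. schr_prop t f x = u t x)"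
proof -
  obtain F where F: "is_fourier f F" using is_fourier_exists[OF assms] by blast
  obtain X :: "nat \<Rightarrow> real" where X: "\<And>t. AE x in lborel. (\<lambda>n. ft (phase t (trunc (X n) F)) (- x)) \<longlonglongrightarrow> schr_prop t f x"
    using schr_prop_approx[OF assms F] by blast
  have [measurable]: "F \<in> borel_measurable borel" using is_fourier_sqint[OF F] by (simp add: sqint_def)
  have m: "(\<lambda>p. ft (phase (fst p) (trunc (X n) F)) (- snd p)) \<in> borel_measurable (lborel \<Otimes>\<^sub>M lborel)" for n
    unfolding ft_def phase_def trunc_def by measurable
  define u where "u t x = lim (\<lambda>n. ft (phase t (trunc (X n) F)) (- x))" for t x
  have "(\<lambda>p. u (fst p) (snd p)) \<in> borel_measurable (lborel \<Otimes>\<^sub>M lborel)"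
    unfolding u_def by (rule borel_measurable_lim_metric[OF m])
  moreover have "AE x in lborel. schr_prop t f x = u t x" for t
    using X[of t] by eventually_elim (simp add: u_def limI)
  ultimately show ?thesis by blast
qed

section \<open>The ambiguity function\<close>

definition amb :: "(real \<Rightarrow> complex) \<Rightarrow> (real \<Rightarrow> complex) \<Rightarrow> real \<Rightarrow> real \<Rightarrow> complex" where
  "amb F G \<xi> s = (LINT k|lborel. expi (s * k) * (cnj (F k) * G (k + \<xi>)))"

lemma amb_eq_ft: "amb F G \<xi> s = complex_of_real (sqrt (2 * pi)) * ft (\<lambda>k. cnj (F k) * G (k + \<xi>)) s"
proof -
  have "complex_of_real (sqrt (2 * pi)) * complex_of_real (1 / sqrt (2 * pi)) = 1"
    unfolding of_real_mult[symmetric] by simp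
  then show ?thesis unfolding amb_def ft_def mult.assoc[symmetric] by simp
qed

text \<open>In the difference of t (k + \<xi>)^2 and t k^2 the quadratic terms in k cancel; the
  slope 2 t \<xi> of what is left is the second argument of the ambiguity function.\<close>

lemma corr_phase:
  "corr (phase t F) (phase t G) \<xi> = expi (t * \<xi>\<^sup>2) * amb F G \<xi> (2 * t * \<xi>)"
proof -
  have "cnj (phase t F k) * phase t G (k + \<xi>) =
    expi (t * \<xi>\<^sup>2) * (expi (2 * t * \<xi> * k) * (cnj (F k) * G (k + \<xi>)))" for k
  proof -
    have "cnj (expi (t * k\<^sup>2)) * expi (t * (k + \<xi>)\<^sup>2) =
      exp (\<i> * complex_of_real (t * k\<^sup>2) + - \<i> * complex_of_real (t * (k + \<xi>)\<^sup>2))"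
      unfolding exp_add by (simp add: exp_cnj)
    also have "\<i> * complex_of_real (t * k\<^sup>2) + - \<i> * complex_of_real (t * (k + \<xi>)\<^sup>2) =
      - \<i> * complex_of_real (t * \<xi>\<^sup>2) + - \<i> * complex_of_real (2 * t * \<xi> * k)"
      by (simp add: power2_eq_square algebra_simps)
    finally have e: "cnj (expi (t * k\<^sup>2)) * expi (t * (k + \<xi>)\<^sup>2) =
      expi (t * \<xi>\<^sup>2) * expi (2 * t * \<xi> * k)"
      unfolding exp_add .
    have "cnj (phase t F k) * phase t G (k + \<xi>) =
      (cnj (expi (t * k\<^sup>2)) * expi (t * (k + \<xi>)\<^sup>2)) * (cnj (F k) * G (k + \<xi>))"
      unfolding phase_def complex_cnj_mult by (simp only: mult_ac)
    then show ?thesis unfolding e by (simp only: mult_ac)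
  qed
  then show ?thesis unfolding corr_def amb_def by simp
qed

lemma borel_measurable_amb [measurable (raw)]:
  assumes [measurable]: "F \<in> borel_measurable borel" "G \<in> borel_measurable borel"
    "a \<in> borel_measurable M" "b \<in> borel_measurable M"
  shows "(\<lambda>x. amb F G (a x) (b x)) \<in> borel_measurable M"
proof -
  have "(\<lambda>p. amb F G (fst p) (snd p)) \<in> borel_measurable (borel \<Otimes>\<^sub>M borel)"
    unfolding amb_def by measurable
  from measurable_compose[OF _ this, of "\<lambda>x. (a x, b x)" M] show ?thesis by simp
qed

lemma cmod_amb_le:
  assumes F: "F \<in> sqint lborel" and G: "G \<in> sqint lborel"
  shows "cmod (amb F G \<xi> s) \<le> l2norm lborel F * l2norm lborel G"
proof -
  let ?G = "\<lambda>k. expi (s * k) * G (k + \<xi>)"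
  have G': "?G \<in> sqint lborel" "l2norm lborel ?G = l2norm lborel G"
    using sqint_unimod[OF sqint_shift[OF G], of "\<lambda>k. expi (s * k)" \<xi>] by (simp_all add: l2norm_shift)
  have "amb F G \<xi> s = l2inner lborel F ?G"
    unfolding amb_def l2inner_def by (simp add: mult_ac)
  then show ?thesis using l2inner_CS[OF F G'(1)] G'(2) by simp
qed

lemma nn_integral_shift_mult:
  fixes F G :: "real \<Rightarrow> complex"
  assumes F: "F \<in> sqint lborel" and G: "G \<in> sqint lborel"
  shows "(\<integral>\<^sup>+\<xi>. \<integral>\<^sup>+k. ennreal ((cmod (cnj (F k) * G (k + \<xi>)))\<^sup>2) \<partial>lborel \<partial>lborel) = ennreal ((l2norm lborel F)\<^sup>2 * (l2norm lborel G)\<^sup>2)"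
proof -
  have [measurable]: "F \<in> borel_measurable borel" "G \<in> borel_measurable borel" using F G by (auto simp: sqint_def)
  have "(\<integral>\<^sup>+\<xi>. \<integral>\<^sup>+k. ennreal ((cmod (cnj (F k) * G (k + \<xi>)))\<^sup>2) \<partial>lborel \<partial>lborel) =
    (\<integral>\<^sup>+k. \<integral>\<^sup>+\<xi>. ennreal ((cmod (cnj (F k) * G (k + \<xi>)))\<^sup>2) \<partial>lborel \<partial>lborel)"
    by (rule lborel_pair.Fubini') measurable
  also have "\<dots> = (\<integral>\<^sup>+k. ennreal ((cmod (F k))\<^sup>2) * ennreal ((l2norm lborel G)\<^sup>2) \<partial>lborel)"
  proof (rule nn_integral_cong)
    fix k
    have "(\<integral>\<^sup>+\<xi>. ennreal ((cmod (cnj (F k) * G (k + \<xi>)))\<^sup>2) \<partial>lborel) =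
      (\<integral>\<^sup>+\<xi>. ennreal ((cmod (F k))\<^sup>2) * ennreal ((cmod (G (k + 1 * \<xi>)))\<^sup>2) \<partial>lborel)"
      by (simp add: norm_mult power_mult_distrib ennreal_mult)
    also have "\<dots> = ennreal ((cmod (F k))\<^sup>2) * (\<integral>\<^sup>+\<xi>. ennreal ((cmod (G (k + 1 * \<xi>)))\<^sup>2) \<partial>lborel)"
      by (rule nn_integral_cmult) measurable
    also have "(\<integral>\<^sup>+\<xi>. ennreal ((cmod (G (k + 1 * \<xi>)))\<^sup>2) \<partial>lborel) = ennreal ((l2norm lborel G)\<^sup>2)"
      using nn_integral_lborel_isometry[of "\<lambda>\<xi>. ennreal ((cmod (G \<xi>))\<^sup>2)" 1 k] nn_integral_l2norm[OF G] by simp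
    finally show "(\<integral>\<^sup>+\<xi>. ennreal ((cmod (cnj (F k) * G (k + \<xi>)))\<^sup>2) \<partial>lborel) = ennreal ((cmod (F k))\<^sup>2) * ennreal ((l2norm lborel G)\<^sup>2)" .
  qed
  also have "\<dots> = ennreal ((l2norm lborel F)\<^sup>2) * ennreal ((l2norm lborel G)\<^sup>2)"
    by (subst nn_integral_multc) (auto simp: nn_integral_l2norm[OF F])
  finally show ?thesis by (simp add: ennreal_mult)
qed

text \<open>Plancherel's theorem in s. The function of k being transformed is integrable for every
  \<xi>, but it is known to be square integrable only for almost every \<xi>.\<close>

lemma nn_integral_amb:
  assumes F: "F \<in> sqint lborel" and G: "G \<in> sqint lborel"
  shows "(\<integral>\<^sup>+\<xi>. \<integral>\<^sup>+s. ennreal ((cmod (amb F G \<xi> s))\<^sup>2) \<partial>lborel \<partial>lborel) =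
    ennreal (2 * pi * (l2norm lborel F)\<^sup>2 * (l2norm lborel G)\<^sup>2)"
proof -
  have [measurable]: "F \<in> borel_measurable borel" "G \<in> borel_measurable borel" using F G by (auto simp: sqint_def)
  let ?p = "\<lambda>\<xi> k. cnj (F k) * G (k + \<xi>)"
  have "AE \<xi> in lborel. (\<integral>\<^sup>+k. ennreal ((cmod (?p \<xi> k))\<^sup>2) \<partial>lborel) \<noteq> \<infinity>"
    using nn_integral_shift_mult[OF F G] by (intro nn_integral_noteq_infinite) auto
  then have "AE \<xi> in lborel. (\<integral>\<^sup>+s. ennreal ((cmod (amb F G \<xi> s))\<^sup>2) \<partial>lborel) =
    ennreal (2 * pi) * (\<integral>\<^sup>+k. ennreal ((cmod (?p \<xi> k))\<^sup>2) \<partial>lborel)"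
  proof eventually_elim
    case (elim \<xi>)
    have int: "integrable lborel (?p \<xi>)" by (intro sqint_mult_integrable sqint_cnj F sqint_shift G)
    have sq: "?p \<xi> \<in> sqint lborel" using elim by (intro sqintI_nn) (auto simp: less_top)
    have "amb F G \<xi> = (\<lambda>s. complex_of_real (sqrt (2 * pi)) * ft (?p \<xi>) s)" by (simp add: amb_eq_ft fun_eq_iff)
    then have "amb F G \<xi> \<in> sqint lborel" "l2norm lborel (amb F G \<xi>) = sqrt (2 * pi) * l2norm lborel (?p \<xi>)"
      using Plancherel[OF sq int] by (auto simp: l2norm_cmult intro!: sqint_cmult)
    then show ?case
      by (simp add: nn_integral_l2norm nn_integral_l2norm[OF sq] power_mult_distrib ennreal_mult)
  qed
  then have "(\<integral>\<^sup>+\<xi>. \<integral>\<^sup>+s. ennreal ((cmod (amb F G \<xi> s))\<^sup>2) \<partial>lborel \<partial>lborel) =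
    (\<integral>\<^sup>+\<xi>. ennreal (2 * pi) * (\<integral>\<^sup>+k. ennreal ((cmod (?p \<xi> k))\<^sup>2) \<partial>lborel) \<partial>lborel)"
    by (rule nn_integral_cong_AE)
  also have "\<dots> = ennreal (2 * pi) * (\<integral>\<^sup>+\<xi>. (\<integral>\<^sup>+k. ennreal ((cmod (?p \<xi> k))\<^sup>2) \<partial>lborel) \<partial>lborel)"
    by (rule nn_integral_cmult) measurable
  finally show ?thesis unfolding nn_integral_shift_mult[OF F G] by (simp add: ennreal_mult mult.assoc)
qed

text \<open>For fixed \<xi> the substitution s = 2 t \<xi> has Jacobian 2 |\<xi>|; it degenerates
  only on the null set \<xi> = 0.\<close>

lemma nn_integral_rescale_lines:
  assumes [measurable]: "(\<lambda>p. h (fst p) (snd p)) \<in> borel_measurable (borel \<Otimes>\<^sub>M borel)"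
  shows "(\<integral>\<^sup>+t. \<integral>\<^sup>+\<xi>. ennreal (2 * \<bar>\<xi>\<bar>) * h \<xi> (2 * t * \<xi>) \<partial>lborel \<partial>lborel) =
    (\<integral>\<^sup>+\<xi>. \<integral>\<^sup>+s. h \<xi> s \<partial>(lborel :: real measure) \<partial>(lborel :: real measure))"
proof -
  have m: "(\<lambda>p. h (a p) (b p)) \<in> borel_measurable M" if "a \<in> borel_measurable M" "b \<in> borel_measurable M" for a b and M :: "'x measure"
    using measurable_compose[OF _ assms, of "\<lambda>p. (a p, b p)" M] that by simp
  have m1: "(\<lambda>s. h \<xi> s) \<in> borel_measurable borel" for \<xi> by (intro m) auto
  have m2: "(\<lambda>(\<xi>, t). ennreal (2 * \<bar>\<xi>\<bar>) * h \<xi> (2 * t * \<xi>)) \<in> borel_measurable (lborel \<Otimes>\<^sub>M lborel)"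
    unfolding split_beta by (intro borel_measurable_times_ennreal m) auto
  have "(\<integral>\<^sup>+t. \<integral>\<^sup>+\<xi>. ennreal (2 * \<bar>\<xi>\<bar>) * h \<xi> (2 * t * \<xi>) \<partial>lborel \<partial>lborel) =
    (\<integral>\<^sup>+\<xi>. \<integral>\<^sup>+t. ennreal (2 * \<bar>\<xi>\<bar>) * h \<xi> (2 * t * \<xi>) \<partial>lborel \<partial>lborel)"
    using lborel_pair.Fubini'[of "\<lambda>\<xi> t. ennreal (2 * \<bar>\<xi>\<bar>) * h \<xi> (2 * t * \<xi>)", OF m2] by simp
  also have "\<dots> = (\<integral>\<^sup>+\<xi>. \<integral>\<^sup>+s. h \<xi> s \<partial>lborel \<partial>lborel)"
  proof (rule nn_integral_cong_AE)
    show "AE \<xi> in lborel. (\<integral>\<^sup>+t. ennreal (2 * \<bar>\<xi>\<bar>) * h \<xi> (2 * t * \<xi>) \<partial>lborel) = (\<integral>\<^sup>+s. h \<xi> s \<partial>lborel)"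
      using AE_lborel_singleton[of 0]
    proof eventually_elim
      case (elim \<xi>)
      have "(\<integral>\<^sup>+s. h \<xi> s \<partial>lborel) = ennreal \<bar>2 * \<xi>\<bar> * (\<integral>\<^sup>+t. h \<xi> (0 + (2 * \<xi>) * t) \<partial>lborel)"
        by (rule nn_integral_real_affine[OF m1]) (use elim in simp)
      also have "\<dots> = (\<integral>\<^sup>+t. ennreal \<bar>2 * \<xi>\<bar> * h \<xi> (0 + (2 * \<xi>) * t) \<partial>lborel)"
        by (rule nn_integral_cmult[symmetric], rule m) auto
      finally show ?case by (simp add: abs_mult mult_ac)
    qed
  qed
  finally show ?thesis .
qed

text \<open>For fixed t, the restriction to the line of slope 2 t in the (\<xi>, s)-plane. The
  argument is the pair (t, \<xi>), to be integrated against a measure on times and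
  frequencies.\<close>

definition amb_line :: "(real \<Rightarrow> complex) \<Rightarrow> (real \<Rightarrow> complex) \<Rightarrow> real \<times> real \<Rightarrow> complex" where
  "amb_line F G p = amb F G (snd p) (2 * fst p * snd p)"

lemma borel_measurable_amb_line:
  assumes "F \<in> sqint lborel" "G \<in> sqint lborel" "sets M = sets (lborel \<Otimes>\<^sub>M lborel)"
  shows "amb_line F G \<in> borel_measurable M"
proof -
  have [measurable]: "F \<in> borel_measurable borel" "G \<in> borel_measurable borel" using assms by (auto simp: sqint_def)
  have "amb_line F G \<in> borel_measurable (lborel \<Otimes>\<^sub>M lborel)" unfolding amb_line_def[abs_def] by measurable
  then show ?thesis using assms(3) measurable_cong_sets by blast
qed

lemma amb_add_right:
  assumes "F \<in> sqint lborel" "G \<in> sqint lborel" "H \<in> sqint lborel"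
  shows "amb F (\<lambda>k. G k + H k) \<xi> s = amb F G \<xi> s + amb F H \<xi> s"
proof -
  have "integrable lborel (\<lambda>k. cnj (F k) * G (k + \<xi>))" "integrable lborel (\<lambda>k. cnj (F k) * H (k + \<xi>))"
    by (intro sqint_mult_integrable sqint_cnj sqint_shift assms)+
  from ft_add[OF this] show ?thesis unfolding amb_eq_ft by (simp add: distrib_left)
qed

lemma amb_add_left:
  assumes "F \<in> sqint lborel" "G \<in> sqint lborel" "H \<in> sqint lborel"
  shows "amb (\<lambda>k. G k + H k) F \<xi> s = amb G F \<xi> s + amb H F \<xi> s"
proof -
  have "integrable lborel (\<lambda>k. cnj (G k) * F (k + \<xi>))" "integrable lborel (\<lambda>k. cnj (H k) * F (k + \<xi>))"
    by (intro sqint_mult_integrable sqint_cnj sqint_shift assms)+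
  from ft_add[OF this] show ?thesis unfolding amb_eq_ft by (simp add: distrib_left distrib_right)
qed

lemma amb_cmult_right: "amb F (\<lambda>k. c * G k) \<xi> s = c * amb F G \<xi> s"
proof -
  have eq: "(\<lambda>k. cnj (F k) * (c * G (k + \<xi>))) = (\<lambda>k. c * (cnj (F k) * G (k + \<xi>)))" by (auto simp: mult_ac)
  show ?thesis unfolding amb_eq_ft eq ft_cmult by (simp only: mult_ac)
qed

lemma amb_cmult_left: "amb (\<lambda>k. c * F k) G \<xi> s = cnj c * amb F G \<xi> s"
proof -
  have eq: "(\<lambda>k. cnj (c * F k) * G (k + \<xi>)) = (\<lambda>k. cnj c * (cnj (F k) * G (k + \<xi>)))" by (auto simp: mult_ac)
  show ?thesis unfolding amb_eq_ft eq ft_cmult by (simp only: mult_ac)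
qed

section \<open>The bilinear space-time estimate\<close>

lemma nn_integral_power4_eq_amb_line:
  assumes "w \<in> sqint lborel" "is_fourier w (phase t F)" "(\<lambda>x. cnj (w x) * w x) \<in> sqint lborel"
  shows "(\<integral>\<^sup>+x. ennreal ((cmod (w x)) ^ 4) \<partial>lborel) = ennreal (1 / (2 * pi)) * (\<integral>\<^sup>+\<xi>. ennreal ((cmod (amb_line F F (t, \<xi>)))\<^sup>2) \<partial>lborel)"
  unfolding nn_integral_power4_corr[OF assms] corr_phase amb_line_def by (simp add: norm_mult)

lemma sqint_cnj_mult_power4:
  assumes "u \<in> borel_measurable M" "v \<in> borel_measurable M"
    "(\<integral>\<^sup>+x. ennreal ((cmod (u x)) ^ 4) \<partial>M) < \<infinity>" "(\<integral>\<^sup>+x. ennreal ((cmod (v x)) ^ 4) \<partial>M) < \<infinity>"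
  shows "(\<lambda>x. cnj (u x) * v x) \<in> sqint M"
proof (rule sqintI_nn)
  note [measurable] = assms(1,2)
  show "(\<lambda>x. cnj (u x) * v x) \<in> borel_measurable M" by measurable
  have "(\<integral>\<^sup>+x. ennreal ((cmod (cnj (u x) * v x))\<^sup>2) \<partial>M) \<le> (\<integral>\<^sup>+x. ennreal ((cmod (u x)) ^ 4) + ennreal ((cmod (v x)) ^ 4) \<partial>M)"
  proof (intro nn_integral_mono)
    fix x
    have "(cmod (cnj (u x) * v x))\<^sup>2 = (cmod (u x))\<^sup>2 * (cmod (v x))\<^sup>2" by (simp add: norm_mult power_mult_distrib)
    also have "\<dots> \<le> 2 * ((cmod (u x))\<^sup>2 * (cmod (v x))\<^sup>2)" by simp
    also have "\<dots> \<le> ((cmod (u x))\<^sup>2)\<^sup>2 + ((cmod (v x))\<^sup>2)\<^sup>2"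
      using sum_squares_bound[of "(cmod (u x))\<^sup>2" "(cmod (v x))\<^sup>2"] by simp
    also have "\<dots> = cmod (u x) ^ 4 + cmod (v x) ^ 4" by (simp flip: power_mult)
    finally show "ennreal ((cmod (cnj (u x) * v x))\<^sup>2) \<le> ennreal ((cmod (u x)) ^ 4) + ennreal ((cmod (v x)) ^ 4)"
      by (simp add: ennreal_plus[symmetric] ennreal_leI del: ennreal_plus)
  qed
  also have "\<dots> = (\<integral>\<^sup>+x. ennreal ((cmod (u x)) ^ 4) \<partial>M) + (\<integral>\<^sup>+x. ennreal ((cmod (v x)) ^ 4) \<partial>M)"
    by (rule nn_integral_add) measurable
  finally show "(\<integral>\<^sup>+x. ennreal ((cmod (cnj (u x) * v x))\<^sup>2) \<partial>M) < \<infinity>"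
    using assms(3,4) by (auto intro: le_less_trans simp: ennreal_add_less_top)
qed

section \<open>The space-time measure of a density in L2\<close>

locale dispersion_density =
  fixes \<psi> :: "real \<Rightarrow> real"
  assumes psi_meas: "\<psi> \<in> borel_measurable lborel"
    and psi_nonneg: "\<And>t. 0 \<le> \<psi> t"
    and psi_L2: "integrable lborel (\<lambda>t. (\<psi> t)\<^sup>2)"
begin

definition mu :: "real measure" where "mu = density lborel (\<lambda>t. ennreal (\<psi> t))"
definition nu :: "(real \<times> real) measure" where "nu = mu \<Otimes>\<^sub>M lborel"
definition psi_sq :: real where "psi_sq = (LINT t|lborel. (\<psi> t)\<^sup>2)"
definition strip :: "real \<Rightarrow> (real \<times> real) set" where "strip \<delta> = {p. 2 * \<delta> * \<bar>snd p\<bar> < \<psi> (fst p)}"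

lemma psi_borel [measurable]: "\<psi> \<in> borel_measurable borel"
  using psi_meas by simp

lemma psi_sq_nonneg: "0 \<le> psi_sq"
  unfolding psi_sq_def by (rule Bochner_Integration.integral_nonneg) simp

lemma sets_mu [measurable_cong, simp]: "sets mu = sets borel"
  by (simp add: mu_def)

lemma space_mu [simp]: "space mu = UNIV"
  by (simp add: mu_def)

lemma sets_nu [measurable_cong]: "sets nu = sets (lborel \<Otimes>\<^sub>M lborel)"
  unfolding nu_def by (rule sets_pair_measure_cong) auto

lemma space_nu [simp]: "space nu = UNIV"
  unfolding nu_def by (simp add: space_pair_measure)

lemma sigma_finite_mu: "sigma_finite_measure mu"
  unfolding mu_def by (subst sigma_finite_measure.sigma_finite_iff_density_finite[OF lborel.sigma_finite_measure_axioms]) auto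

lemma pair_mu: "pair_sigma_finite mu lborel"
  by (intro pair_sigma_finite.intro sigma_finite_mu lborel.sigma_finite_measure_axioms)

lemma nn_integral_mu:
  assumes "h \<in> borel_measurable borel"
  shows "(\<integral>\<^sup>+t. h t \<partial>mu) = (\<integral>\<^sup>+t. ennreal (\<psi> t) * h t \<partial>lborel)"
  unfolding mu_def using assms by (intro nn_integral_density) auto

lemma nn_integral_nu_fst:
  assumes "h \<in> borel_measurable (lborel \<Otimes>\<^sub>M lborel)"
  shows "(\<integral>\<^sup>+p. h p \<partial>nu) = (\<integral>\<^sup>+t. \<integral>\<^sup>+\<xi>. h (t, \<xi>) \<partial>lborel \<partial>mu)"
proof -
  have "h \<in> borel_measurable (mu \<Otimes>\<^sub>M lborel)"
    using assms sets_nu measurable_cong_sets unfolding nu_def by blast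
  from lborel.nn_integral_fst[OF this] show ?thesis by (simp add: nu_def)
qed

lemma nn_integral_nu:
  assumes [measurable]: "h \<in> borel_measurable (lborel \<Otimes>\<^sub>M lborel)"
  shows "(\<integral>\<^sup>+p. h p \<partial>nu) = (\<integral>\<^sup>+t. \<integral>\<^sup>+\<xi>. ennreal (\<psi> t) * h (t, \<xi>) \<partial>lborel \<partial>lborel)"
  unfolding nn_integral_nu_fst[OF assms]
  by (subst nn_integral_mu) (auto simp: nn_integral_cmult)

lemma strip_sets [measurable]: "strip \<delta> \<in> sets (lborel \<Otimes>\<^sub>M lborel)"
proof -
  have "{p \<in> space (lborel \<Otimes>\<^sub>M lborel). 2 * \<delta> * \<bar>snd p\<bar> < \<psi> (fst p)} \<in> sets (lborel \<Otimes>\<^sub>M lborel)" by measurable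
  then show ?thesis by (simp add: strip_def space_pair_measure)
qed

text \<open>The section of the strip at t is an interval of length
  \<open>\<psi> t / \<delta>\<close>, and the measure contributes another factor \<psi>: here square
  integrability of \<psi> enters.\<close>

lemma emeasure_strip:
  assumes "0 < \<delta>"
  shows "emeasure nu (strip \<delta>) = ennreal (psi_sq / \<delta>)"
proof -
  have "emeasure nu (strip \<delta>) = (\<integral>\<^sup>+p. indicator (strip \<delta>) p \<partial>nu)"
    using strip_sets sets_nu by (simp add: nn_integral_indicator)
  also have "\<dots> = (\<integral>\<^sup>+t. \<integral>\<^sup>+\<xi>. ennreal (\<psi> t) * indicator (strip \<delta>) (t, \<xi>) \<partial>lborel \<partial>lborel)"
    by (rule nn_integral_nu) measurable
  also have "\<dots> = (\<integral>\<^sup>+t. ennreal ((\<psi> t)\<^sup>2 / \<delta>) \<partial>lborel)"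
  proof (rule nn_integral_cong)
    fix t
    have eq: "indicator (strip \<delta>) (t, \<xi>) = (indicator {- (\<psi> t / (2 * \<delta>))<..<\<psi> t / (2 * \<delta>)} \<xi> :: ennreal)" for \<xi>
    proof -
      have "(t, \<xi>) \<in> strip \<delta> \<longleftrightarrow> \<bar>\<xi>\<bar> < \<psi> t / (2 * \<delta>)" using assms by (auto simp: strip_def field_simps)
      then show ?thesis by (auto simp: indicator_def)
    qed
    have "(\<integral>\<^sup>+\<xi>. ennreal (\<psi> t) * indicator (strip \<delta>) (t, \<xi>) \<partial>lborel) = ennreal (\<psi> t) * emeasure lborel {- (\<psi> t / (2 * \<delta>))<..<\<psi> t / (2 * \<delta>)}"
      unfolding eq by (rule nn_integral_cmult_indicator) simp
    also have "\<dots> = ennreal (\<psi> t) * ennreal (\<psi> t / \<delta>)"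
      using assms psi_nonneg[of t] by (subst emeasure_lborel_Ioo) (auto simp: field_simps)
    also have "\<dots> = ennreal ((\<psi> t)\<^sup>2 / \<delta>)"
      using assms psi_nonneg[of t] by (simp add: ennreal_mult[symmetric] power2_eq_square)
    finally show "(\<integral>\<^sup>+\<xi>. ennreal (\<psi> t) * indicator (strip \<delta>) (t, \<xi>) \<partial>lborel) = ennreal ((\<psi> t)\<^sup>2 / \<delta>)" .
  qed
  also have "\<dots> = ennreal (psi_sq / \<delta>)"
    unfolding psi_sq_def using psi_L2 assms by (subst nn_integral_eq_integral) auto
  finally show ?thesis .
qed

lemma amb_line_measurable:
  assumes "F \<in> sqint lborel" "G \<in> sqint lborel"
  shows "amb_line F G \<in> borel_measurable (lborel \<Otimes>\<^sub>M lborel)" "amb_line F G \<in> borel_measurable nu"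
  using borel_measurable_amb_line[OF assms] sets_nu by auto

text \<open>Outside the strip \<open>\<psi>(t)\<close> is at most \<open>2 \<delta> |\<xi>|\<close>, and \<open>2 |\<xi>| dt\<close> is \<open>ds\<close> for \<open>s = 2 t \<xi>\<close>.\<close>

lemma nn_integral_amb_line_split:
  assumes F: "F \<in> sqint lborel" and G: "G \<in> sqint lborel" and \<delta>: "0 < \<delta>"
  shows "(\<integral>\<^sup>+p. ennreal ((cmod (amb_line F G p))\<^sup>2) \<partial>nu) \<le>
    ennreal (\<delta> * (2 * pi * (l2norm lborel F)\<^sup>2 * (l2norm lborel G)\<^sup>2)) +
    (\<integral>\<^sup>+p. ennreal ((cmod (amb_line F G p))\<^sup>2) * indicator (strip \<delta>) p \<partial>nu)"
proof -
  have [measurable]: "F \<in> borel_measurable borel" "G \<in> borel_measurable borel" using F G by (auto simp: sqint_def)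
  note [measurable] = amb_line_measurable[OF F G]
  let ?h = "\<lambda>p. ennreal ((cmod (amb_line F G p))\<^sup>2)"
  have hm: "(\<lambda>p. ?h p * indicator (strip \<delta>) p) \<in> borel_measurable (lborel \<Otimes>\<^sub>M lborel)" by measurable
  have hm2: "(\<lambda>p. ennreal \<delta> * (ennreal (2 * \<bar>snd p\<bar>) * ?h p)) \<in> borel_measurable (lborel \<Otimes>\<^sub>M lborel)" by measurable
  have "(\<integral>\<^sup>+p. ?h p \<partial>nu) = (\<integral>\<^sup>+t. \<integral>\<^sup>+\<xi>. ennreal (\<psi> t) * ?h (t, \<xi>) \<partial>lborel \<partial>lborel)"
    by (rule nn_integral_nu) measurable
  also have "\<dots> \<le> (\<integral>\<^sup>+t. \<integral>\<^sup>+\<xi>. ennreal \<delta> * (ennreal (2 * \<bar>\<xi>\<bar>) * ?h (t, \<xi>)) + ennreal (\<psi> t) * (?h (t, \<xi>) * indicator (strip \<delta>) (t, \<xi>)) \<partial>lborel \<partial>lborel)"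
  proof (intro nn_integral_mono)
    fix t \<xi>
    show "ennreal (\<psi> t) * ?h (t, \<xi>) \<le> ennreal \<delta> * (ennreal (2 * \<bar>\<xi>\<bar>) * ?h (t, \<xi>)) + ennreal (\<psi> t) * (?h (t, \<xi>) * indicator (strip \<delta>) (t, \<xi>))"
    proof (cases "(t, \<xi>) \<in> strip \<delta>")
      case True then show ?thesis by (simp add: add_increasing)
    next
      case False
      then have "ennreal (\<psi> t) \<le> ennreal (\<delta> * (2 * \<bar>\<xi>\<bar>))" by (intro ennreal_leI) (auto simp: strip_def)
      then have "ennreal (\<psi> t) * ?h (t, \<xi>) \<le> ennreal (\<delta> * (2 * \<bar>\<xi>\<bar>)) * ?h (t, \<xi>)" by (intro mult_right_mono) auto
      then show ?thesis using \<delta> by (simp add: ennreal_mult mult.assoc add_increasing2)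
    qed
  qed
  also have "\<dots> = (\<integral>\<^sup>+t. (\<integral>\<^sup>+\<xi>. ennreal \<delta> * (ennreal (2 * \<bar>\<xi>\<bar>) * ?h (t, \<xi>)) \<partial>lborel) + (\<integral>\<^sup>+\<xi>. ennreal (\<psi> t) * (?h (t, \<xi>) * indicator (strip \<delta>) (t, \<xi>)) \<partial>lborel) \<partial>lborel)"
    by (intro nn_integral_cong nn_integral_add) measurable
  also have "\<dots> = (\<integral>\<^sup>+t. \<integral>\<^sup>+\<xi>. ennreal \<delta> * (ennreal (2 * \<bar>\<xi>\<bar>) * ?h (t, \<xi>)) \<partial>lborel \<partial>lborel) +
      (\<integral>\<^sup>+t. \<integral>\<^sup>+\<xi>. ennreal (\<psi> t) * (?h (t, \<xi>) * indicator (strip \<delta>) (t, \<xi>)) \<partial>lborel \<partial>lborel)"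
    by (rule nn_integral_add) measurable
  also have "(\<integral>\<^sup>+t. \<integral>\<^sup>+\<xi>. ennreal (\<psi> t) * (?h (t, \<xi>) * indicator (strip \<delta>) (t, \<xi>)) \<partial>lborel \<partial>lborel) = (\<integral>\<^sup>+p. ?h p * indicator (strip \<delta>) p \<partial>nu)"
    by (rule nn_integral_nu[OF hm, symmetric])
  also have "(\<integral>\<^sup>+t. \<integral>\<^sup>+\<xi>. ennreal \<delta> * (ennreal (2 * \<bar>\<xi>\<bar>) * ?h (t, \<xi>)) \<partial>lborel \<partial>lborel) =
     (\<integral>\<^sup>+t. \<integral>\<^sup>+\<xi>. ennreal (2 * \<bar>\<xi>\<bar>) * (ennreal \<delta> * ennreal ((cmod (amb F G \<xi> (2 * t * \<xi>)))\<^sup>2)) \<partial>lborel \<partial>lborel)"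
    by (intro nn_integral_cong) (simp add: amb_line_def mult_ac)
  also have "\<dots> = (\<integral>\<^sup>+\<xi>. \<integral>\<^sup>+s. ennreal \<delta> * ennreal ((cmod (amb F G \<xi> s))\<^sup>2) \<partial>lborel \<partial>lborel)"
    by (rule nn_integral_rescale_lines) measurable
  also have "\<dots> = ennreal \<delta> * (\<integral>\<^sup>+\<xi>. \<integral>\<^sup>+s. ennreal ((cmod (amb F G \<xi> s))\<^sup>2) \<partial>lborel \<partial>lborel)"
    by (simp add: nn_integral_cmult)
  also have "\<dots> = ennreal (\<delta> * (2 * pi * (l2norm lborel F)\<^sup>2 * (l2norm lborel G)\<^sup>2))"
    unfolding nn_integral_amb[OF F G] using \<delta> by (simp add: ennreal_mult)
  finally show ?thesis .
qed

text \<open>The splitting at \<delta> = 1: the term 2 pi belongs to the outside of the strip, and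
  \<open>psi_sq\<close> is the measure of the strip, where the pointwise bound on the ambiguity
  function is used.\<close>

definition amb_const :: real where "amb_const = sqrt (2 * pi + psi_sq)"

lemma amb_const_nonneg: "0 \<le> amb_const"
  using psi_sq_nonneg by (simp add: amb_const_def)

lemma amb_line_bound:
  assumes F: "F \<in> sqint lborel" and G: "G \<in> sqint lborel"
  shows "amb_line F G \<in> sqint nu" "l2norm nu (amb_line F G) \<le> amb_const * l2norm lborel F * l2norm lborel G"
proof -
  let ?c = "l2norm lborel F * l2norm lborel G"
  have "(\<integral>\<^sup>+p. ennreal ((cmod (amb_line F G p))\<^sup>2) * indicator (strip 1) p \<partial>nu) \<le> (\<integral>\<^sup>+p. ennreal (?c\<^sup>2) * indicator (strip 1) p \<partial>nu)"
    using cmod_amb_le[OF F G] by (intro nn_integral_mono mult_right_mono ennreal_leI power_mono) (auto simp: amb_line_def)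
  also have "\<dots> = ennreal (?c\<^sup>2) * emeasure nu (strip 1)"
    using strip_sets sets_nu by (intro nn_integral_cmult_indicator) auto
  also have "\<dots> = ennreal (?c\<^sup>2 * psi_sq)" using emeasure_strip[of 1] psi_sq_nonneg by (simp add: ennreal_mult)
  finally have "(\<integral>\<^sup>+p. ennreal ((cmod (amb_line F G p))\<^sup>2) \<partial>nu) \<le> ennreal (1 * (2 * pi * (l2norm lborel F)\<^sup>2 * (l2norm lborel G)\<^sup>2)) + ennreal (?c\<^sup>2 * psi_sq)"
    using nn_integral_amb_line_split[OF F G, of 1] by (meson add_left_mono order_trans zero_less_one)
  also have "\<dots> = ennreal ((amb_const * l2norm lborel F * l2norm lborel G)\<^sup>2)"
    using psi_sq_nonneg by (subst ennreal_plus[symmetric]) (auto simp: amb_const_def power_mult_distrib algebra_simps)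
  finally show "amb_line F G \<in> sqint nu" "l2norm nu (amb_line F G) \<le> amb_const * l2norm lborel F * l2norm lborel G"
    using amb_const_nonneg by (auto intro!: nn_integral_l2norm_le amb_line_measurable F G)
qed

text \<open>The identity with the ambiguity function presupposes that |u|^2 lies in L2, which is
  what has to be shown. Truncation of F gives bounded approximants for which it holds, and Fatou's
  lemma, first in x and then in r, passes to the limit.\<close>

lemma nn_integral_schr_prop_power4:
  assumes f: "f \<in> sqint lborel"
  shows "(\<integral>\<^sup>+r. \<integral>\<^sup>+x. ennreal ((cmod (schr_prop r f x)) ^ 4) \<partial>lborel \<partial>mu) \<le>
    ennreal (1 / (2 * pi) * (amb_const * l2norm lborel f * l2norm lborel f)\<^sup>2)"
proof -
  obtain F where fF: "is_fourier f F" using is_fourier_exists[OF f] by blast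
  have F: "F \<in> sqint lborel" using fF by (rule is_fourier_sqint)
  have nF: "l2norm lborel F = l2norm lborel f" by (rule is_fourier_norm[OF f fF])
  obtain X :: "nat \<Rightarrow> real" where X: "\<And>t. AE x in lborel. (\<lambda>n. ft (phase t (trunc (X n) F)) (- x)) \<longlonglongrightarrow> schr_prop t f x"
    using schr_prop_approx[OF f fF] by blast
  let ?Fn = "\<lambda>n. trunc (X n) F"
  have Fn: "?Fn n \<in> sqint lborel" "integrable lborel (?Fn n)" for n by (intro trunc_sqint trunc_integrable F)+
  let ?v = "\<lambda>n t x. ft (phase t (?Fn n)) (- x)"
  let ?B = "\<lambda>n t. \<integral>\<^sup>+\<xi>. ennreal ((cmod (amb_line (?Fn n) (?Fn n) (t, \<xi>)))\<^sup>2) \<partial>lborel"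
  have v4: "(\<integral>\<^sup>+x. ennreal ((cmod (?v n t x)) ^ 4) \<partial>lborel) = ennreal (1 / (2 * pi)) * ?B n t" for n t
  proof (rule nn_integral_power4_eq_amb_line)
    have ph: "phase t (?Fn n) \<in> sqint lborel" "integrable lborel (phase t (?Fn n))"
      by (intro phase_sqint phase_integrable Fn)+
    show v: "?v n t \<in> sqint lborel" "is_fourier (?v n t) (phase t (?Fn n))"
      by (intro is_fourier_inverse_ft ph)+
    \<comment> \<open>The truncated transform is integrable, hence the approximant is
      bounded.\<close>
    show "(\<lambda>x. cnj (?v n t x) * ?v n t x) \<in> sqint lborel"
      by (rule sqint_bounded_mult(1)[OF v(1), where C="LINT x|lborel. cmod (phase t (?Fn n) x)"])
        (use v(1) cmod_ft_le[OF ph(2)] in \<open>auto simp: sqint_def\<close>)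
  qed
  have [measurable]: "amb_line (?Fn n) (?Fn n) \<in> borel_measurable (lborel \<Otimes>\<^sub>M lborel)" for n
    by (intro amb_line_measurable Fn)
  have le: "(\<integral>\<^sup>+x. ennreal ((cmod (schr_prop t f x)) ^ 4) \<partial>lborel) \<le> liminf (\<lambda>n. ennreal (1 / (2 * pi)) * ?B n t)" for t
  proof -
    have "(\<integral>\<^sup>+x. ennreal ((cmod (schr_prop t f x)) ^ 4) \<partial>lborel) = (\<integral>\<^sup>+x. liminf (\<lambda>n. ennreal ((cmod (?v n t x)) ^ 4)) \<partial>lborel)"
    proof (rule nn_integral_cong_AE)
      show "AE x in lborel. ennreal ((cmod (schr_prop t f x)) ^ 4) = liminf (\<lambda>n. ennreal ((cmod (?v n t x)) ^ 4))"
        using X[of t]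
      proof eventually_elim
        case (elim x)
        have "(\<lambda>n. ennreal ((cmod (?v n t x)) ^ 4)) \<longlonglongrightarrow> ennreal ((cmod (schr_prop t f x)) ^ 4)"
          by (intro tendsto_ennrealI tendsto_intros elim)
        then show ?case by (intro lim_imp_Liminf[symmetric]) auto
      qed
    qed
    also have "\<dots> \<le> liminf (\<lambda>n. \<integral>\<^sup>+x. ennreal ((cmod (?v n t x)) ^ 4) \<partial>lborel)"
    proof (rule nn_integral_liminf)
      fix n
      have "?v n t \<in> sqint lborel" by (intro is_fourier_inverse_ft phase_sqint phase_integrable Fn)
      note [measurable] = sqintD(1)[OF this]
      show "(\<lambda>x. ennreal ((cmod (?v n t x)) ^ 4)) \<in> borel_measurable lborel" by measurable
    qed
    finally show ?thesis unfolding v4 .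
  qed
  have "(\<integral>\<^sup>+r. \<integral>\<^sup>+x. ennreal ((cmod (schr_prop r f x)) ^ 4) \<partial>lborel \<partial>mu) \<le> (\<integral>\<^sup>+r. liminf (\<lambda>n. ennreal (1 / (2 * pi)) * ?B n r) \<partial>mu)"
    by (intro nn_integral_mono le)
  also have "\<dots> \<le> liminf (\<lambda>n. \<integral>\<^sup>+r. ennreal (1 / (2 * pi)) * ?B n r \<partial>mu)"
    by (rule nn_integral_liminf) measurable
  also have "\<dots> \<le> ennreal (1 / (2 * pi) * (amb_const * l2norm lborel f * l2norm lborel f)\<^sup>2)"
  proof (rule Liminf_le)
    show "\<forall>\<^sub>F n in sequentially. (\<integral>\<^sup>+r. ennreal (1 / (2 * pi)) * ?B n r \<partial>mu) \<le> ennreal (1 / (2 * pi) * (amb_const * l2norm lborel f * l2norm lborel f)\<^sup>2)"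
    proof (intro always_eventually allI)
      fix n
      have "(\<integral>\<^sup>+r. ennreal (1 / (2 * pi)) * ?B n r \<partial>mu) = ennreal (1 / (2 * pi)) * (\<integral>\<^sup>+r. ?B n r \<partial>mu)"
        by (rule nn_integral_cmult) measurable
      also have "(\<integral>\<^sup>+r. ?B n r \<partial>mu) = (\<integral>\<^sup>+p. ennreal ((cmod (amb_line (?Fn n) (?Fn n) p))\<^sup>2) \<partial>nu)"
        by (rule nn_integral_nu_fst[symmetric]) measurable
      also have "\<dots> = ennreal ((l2norm nu (amb_line (?Fn n) (?Fn n)))\<^sup>2)"
        by (intro nn_integral_l2norm amb_line_bound Fn)
      also have "ennreal (1 / (2 * pi)) * \<dots> = ennreal (1 / (2 * pi) * (l2norm nu (amb_line (?Fn n) (?Fn n)))\<^sup>2)"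
        by (rule ennreal_mult[symmetric]) auto
      also have "\<dots> \<le> ennreal (1 / (2 * pi) * (amb_const * l2norm lborel f * l2norm lborel f)\<^sup>2)"
      proof (intro ennreal_leI mult_left_mono power_mono)
        have "l2norm nu (amb_line (?Fn n) (?Fn n)) \<le> amb_const * l2norm lborel (?Fn n) * l2norm lborel (?Fn n)"
          by (intro amb_line_bound Fn)
        also have "\<dots> \<le> amb_const * l2norm lborel f * l2norm lborel f"
          using trunc_sqint(2)[OF F, of "X n"] amb_const_nonneg unfolding nF by (intro mult_mono) auto
        finally show "l2norm nu (amb_line (?Fn n) (?Fn n)) \<le> amb_const * l2norm lborel f * l2norm lborel f" .
      qed auto
      finally show "(\<integral>\<^sup>+r. ennreal (1 / (2 * pi)) * ?B n r \<partial>mu) \<le> ennreal (1 / (2 * pi) * (amb_const * l2norm lborel f * l2norm lborel f)\<^sup>2)" .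
    qed
  qed simp
  finally show ?thesis .
qed

text \<open>Passing from a finite integral to finiteness almost everywhere requires a measurable
  inner integral, which the jointly measurable representative supplies.\<close>

lemma AE_schr_prop_power4:
  assumes f: "f \<in> sqint lborel"
  shows "AE r in mu. (\<integral>\<^sup>+x. ennreal ((cmod (schr_prop r f x)) ^ 4) \<partial>lborel) < \<infinity>"
proof -
  obtain u where um[measurable]: "(\<lambda>p. u (fst p) (snd p)) \<in> borel_measurable (lborel \<Otimes>\<^sub>M lborel)"
    and u: "\<And>t. AE x in lborel. schr_prop t f x = u t x"
    using schr_prop_jointly_measurable[OF f] by blast
  have eq: "(\<integral>\<^sup>+x. ennreal ((cmod (schr_prop r f x)) ^ 4) \<partial>lborel) = (\<integral>\<^sup>+x. ennreal ((cmod (u r x)) ^ 4) \<partial>lborel)" for r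
    by (rule nn_integral_cong_AE) (use u[of r] in eventually_elim, simp)
  have "(\<integral>\<^sup>+r. \<integral>\<^sup>+x. ennreal ((cmod (u r x)) ^ 4) \<partial>lborel \<partial>mu) < \<infinity>"
    using nn_integral_schr_prop_power4[OF f] unfolding eq by (auto intro: le_less_trans)
  moreover have "(\<lambda>r. \<integral>\<^sup>+x. ennreal ((cmod (u r x)) ^ 4) \<partial>lborel) \<in> borel_measurable mu"
  proof -
    have "(\<lambda>p. ennreal ((cmod (u (fst p) (snd p))) ^ 4)) \<in> borel_measurable (lborel \<Otimes>\<^sub>M lborel)" by measurable
    from lborel.borel_measurable_nn_integral_fst[OF this] show ?thesis by simp
  qed
  ultimately have "AE r in mu. (\<integral>\<^sup>+x. ennreal ((cmod (u r x)) ^ 4) \<partial>lborel) \<noteq> \<infinity>"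
    by (intro nn_integral_noteq_infinite) auto
  then show ?thesis unfolding eq by (auto simp: less_top)
qed

text \<open>For almost every r all four solutions lie in L4, so Parseval's identity applies to the
  slice at r, and the phases \<open>expi (r * \<xi>\<^sup>2)\<close> of the two correlations cancel.
  Fubini's theorem on \<open>nu\<close> applies because both ambiguity functions lie in L2.\<close>

lemma Qc_eq_l2inner:
  assumes f1: "f1 \<in> sqint lborel" "is_fourier f1 F1" and f2: "f2 \<in> sqint lborel" "is_fourier f2 F2"
    and f3: "f3 \<in> sqint lborel" "is_fourier f3 F3" and f4: "f4 \<in> sqint lborel" "is_fourier f4 F4"
  shows "Qc mu f1 f2 f3 f4 = complex_of_real (1 / (2 * pi)) * l2inner nu (amb_line F2 F1) (amb_line F3 F4)"
proof -
  obtain u1 where u1[measurable]: "(\<lambda>p. u1 (fst p) (snd p)) \<in> borel_measurable (lborel \<Otimes>\<^sub>M lborel)"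
    and u1e: "\<And>t. AE x in lborel. schr_prop t f1 x = u1 t x" using schr_prop_jointly_measurable[OF f1(1)] by blast
  obtain u2 where u2[measurable]: "(\<lambda>p. u2 (fst p) (snd p)) \<in> borel_measurable (lborel \<Otimes>\<^sub>M lborel)"
    and u2e: "\<And>t. AE x in lborel. schr_prop t f2 x = u2 t x" using schr_prop_jointly_measurable[OF f2(1)] by blast
  obtain u3 where u3[measurable]: "(\<lambda>p. u3 (fst p) (snd p)) \<in> borel_measurable (lborel \<Otimes>\<^sub>M lborel)"
    and u3e: "\<And>t. AE x in lborel. schr_prop t f3 x = u3 t x" using schr_prop_jointly_measurable[OF f3(1)] by blast
  obtain u4 where u4[measurable]: "(\<lambda>p. u4 (fst p) (snd p)) \<in> borel_measurable (lborel \<Otimes>\<^sub>M lborel)"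
    and u4e: "\<And>t. AE x in lborel. schr_prop t f4 x = u4 t x" using schr_prop_jointly_measurable[OF f4(1)] by blast
  let ?I = "\<lambda>r. LINT x|lborel. cnj (schr_prop r f1 x) * schr_prop r f2 x * cnj (schr_prop r f3 x) * schr_prop r f4 x"
  let ?g = "\<lambda>p. cnj (amb_line F2 F1 p) * amb_line F3 F4 p"
  have ms: "schr_prop r f1 \<in> borel_measurable borel" "schr_prop r f2 \<in> borel_measurable borel"
     "schr_prop r f3 \<in> borel_measurable borel" "schr_prop r f4 \<in> borel_measurable borel" for r
    using schr_prop_is_fourier(1)[OF f1] schr_prop_is_fourier(1)[OF f2] schr_prop_is_fourier(1)[OF f3] schr_prop_is_fourier(1)[OF f4]
    by (auto simp: sqint_def)
  have I_eq: "?I r = (LINT x|lborel. cnj (u1 r x) * u2 r x * cnj (u3 r x) * u4 r x)" for r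
  proof (rule integral_cong_AE)
    have sec: "(\<lambda>x. u r x) \<in> borel_measurable lborel"
      if "(\<lambda>p. u (fst p) (snd p)) \<in> borel_measurable (lborel \<Otimes>\<^sub>M lborel)" for u :: "real \<Rightarrow> real \<Rightarrow> complex"
      using measurable_compose[OF measurable_Pair1' that, of r] by simp
    note [measurable] = sec[OF u1] sec[OF u2] sec[OF u3] sec[OF u4] ms
    show "(\<lambda>x. cnj (schr_prop r f1 x) * schr_prop r f2 x * cnj (schr_prop r f3 x) * schr_prop r f4 x) \<in> borel_measurable lborel"
      by measurable
    show "(\<lambda>x. cnj (u1 r x) * u2 r x * cnj (u3 r x) * u4 r x) \<in> borel_measurable lborel" by measurable
    show "AE x in lborel. cnj (schr_prop r f1 x) * schr_prop r f2 x * cnj (schr_prop r f3 x) * schr_prop r f4 x =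
        cnj (u1 r x) * u2 r x * cnj (u3 r x) * u4 r x"
      using u1e[of r] u2e[of r] u3e[of r] u4e[of r] by eventually_elim simp
  qed
  have Im: "?I \<in> borel_measurable mu"
  proof -
    have "(\<lambda>(r, x). cnj (u1 r x) * u2 r x * cnj (u3 r x) * u4 r x) \<in> borel_measurable (lborel \<Otimes>\<^sub>M lborel)"
      unfolding split_beta by measurable
    from lborel.borel_measurable_lebesgue_integral[OF this] show ?thesis unfolding I_eq by simp
  qed
  have gint: "integrable nu ?g"
    by (intro l2inner_integrable amb_line_bound is_fourier_sqint[OF f1(2)] is_fourier_sqint[OF f2(2)] is_fourier_sqint[OF f3(2)] is_fourier_sqint[OF f4(2)])
  interpret P: pair_sigma_finite mu lborel by (rule pair_mu)
  have gint': "integrable (mu \<Otimes>\<^sub>M lborel) ?g" using gint by (simp add: nu_def)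
  have gm: "(\<lambda>r. LINT \<xi>|lborel. ?g (r, \<xi>)) \<in> borel_measurable mu"
    using borel_measurable_integrable[OF P.integrable_fst'[OF gint']] .
  have AE: "AE r in mu. ?I r = complex_of_real (1 / (2 * pi)) * (LINT \<xi>|lborel. ?g (r, \<xi>))"
    using AE_schr_prop_power4[OF f1(1)] AE_schr_prop_power4[OF f2(1)] AE_schr_prop_power4[OF f3(1)] AE_schr_prop_power4[OF f4(1)]
  proof eventually_elim
    case (elim r)
    note u = schr_prop_is_fourier[OF f1, of r] schr_prop_is_fourier[OF f2, of r] schr_prop_is_fourier[OF f3, of r] schr_prop_is_fourier[OF f4, of r]
    have "?I r = complex_of_real (1 / (2 * pi)) * l2inner lborel (corr (phase r F2) (phase r F1)) (corr (phase r F3) (phase r F4))"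
      by (rule integral_mult4_corr[OF u]) (use ms elim in \<open>auto intro!: sqint_cnj_mult_power4\<close>)
    also have "l2inner lborel (corr (phase r F2) (phase r F1)) (corr (phase r F3) (phase r F4)) = (LINT \<xi>|lborel. ?g (r, \<xi>))"
      unfolding l2inner_def
    proof (rule Bochner_Integration.integral_cong[OF refl])
      fix \<xi>
      let ?e = "expi (r * \<xi>\<^sup>2)"
      have "cnj ?e * ?e = 1" by (simp add: exp_cnj exp_add[symmetric])
      moreover have "cnj (?e * a) * (?e * b) = (cnj ?e * ?e) * (cnj a * b)" for a b
        by (simp only: complex_cnj_mult mult_ac)
      ultimately have "cnj (?e * a) * (?e * b) = cnj a * b" for a b by simp
      then show "cnj (corr (phase r F2) (phase r F1) \<xi>) * corr (phase r F3) (phase r F4) \<xi> = ?g (r, \<xi>)"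
        unfolding corr_phase amb_line_def by simp
    qed
    finally show ?case .
  qed
  have "Qc mu f1 f2 f3 f4 = (LINT r|mu. complex_of_real (1 / (2 * pi)) * (LINT \<xi>|lborel. ?g (r, \<xi>)))"
    unfolding Qc_def by (rule integral_cong_AE[OF Im _ AE]) (use gm in measurable)
  also have "\<dots> = complex_of_real (1 / (2 * pi)) * (LINT r|mu. LINT \<xi>|lborel. ?g (r, \<xi>))"
    by (rule integral_mult_right_zero)
  also have "(LINT r|mu. LINT \<xi>|lborel. ?g (r, \<xi>)) = l2inner nu (amb_line F2 F1) (amb_line F3 F4)"
    unfolding l2inner_def nu_def by (rule P.integral_fst'[OF gint'])
  finally show ?thesis .
qed

end

section \<open>Nonvanishing up to phase-space translations\<close>

text \<open>The window against which concentration is tested. What qualifies it is an ambiguity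
  function without zeros.\<close>

definition gauss :: "real \<Rightarrow> complex" where
  "gauss k = complex_of_real (exp (- k\<^sup>2 / 2))"

lemma gauss_measurable [measurable]: "gauss \<in> borel_measurable borel"
  unfolding gauss_def[abs_def] by measurable

lemma cmod_gauss: "cmod (gauss k) = exp (- k\<^sup>2 / 2)"
  by (simp add: gauss_def)

lemma cmod_gauss_le: "cmod (gauss k) \<le> 1"
  by (simp add: cmod_gauss)

lemma gauss_eq_density: "gauss k = complex_of_real (sqrt (2 * pi)) * complex_of_real (std_normal_density k)"
  unfolding gauss_def std_normal_density_def of_real_mult[symmetric] by simp

lemma gauss_integrable: "integrable lborel gauss"
proof -
  have "integrable lborel (\<lambda>x. complex_of_real (std_normal_density x))"
    using integrable_normal_density[of 1 0] by (intro integrable_of_real) simp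
  then show ?thesis unfolding gauss_eq_density[abs_def] by (intro integrable_mult_right)
qed

lemma integrable_bounded_sqint:
  assumes "integrable M f" "\<And>x. cmod (f x) \<le> C"
  shows "f \<in> sqint M"
proof (rule sqintI)
  have [measurable]: "f \<in> borel_measurable M" using assms(1) by simp
  show "f \<in> borel_measurable M" by measurable
  show "integrable M (\<lambda>x. (cmod (f x))\<^sup>2)"
  proof (rule Bochner_Integration.integrable_bound)
    show "integrable M (\<lambda>x. C * cmod (f x))" using assms(1) by simp
    show "(\<lambda>x. (cmod (f x))\<^sup>2) \<in> borel_measurable M" by measurable
    show "AE x in M. norm ((cmod (f x))\<^sup>2) \<le> norm (C * cmod (f x))"
    proof (intro AE_I2)
      fix x
      have "cmod (f x) * cmod (f x) \<le> C * cmod (f x)" using assms(2) by (intro mult_right_mono) auto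
      then show "norm ((cmod (f x))\<^sup>2) \<le> norm (C * cmod (f x))" by (simp add: power2_eq_square)
    qed
  qed
qed

lemma gauss_sqint: "gauss \<in> sqint lborel"
  by (rule integrable_bounded_sqint[OF gauss_integrable cmod_gauss_le])

lemma ft_gauss_integral:
  "(LINT y|lborel. expi (a * y) * gauss y) = complex_of_real (sqrt (2 * pi) * exp (- a\<^sup>2 / 2))"
proof -
  have "complex_of_real (exp (- (- a)\<^sup>2 / 2)) = char std_normal_distribution (- a)"
    by (simp only: char_std_normal_distribution)
  also have "\<dots> = (LINT y|lborel. std_normal_density y *\<^sub>R exp (\<i> * complex_of_real (- a * y)))"
    unfolding char_def by (subst integral_density) auto
  finally have "complex_of_real (sqrt (2 * pi)) * complex_of_real (exp (- (- a)\<^sup>2 / 2)) =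
    complex_of_real (sqrt (2 * pi)) * (LINT y|lborel. std_normal_density y *\<^sub>R exp (\<i> * complex_of_real (- a * y)))"
    by (simp only:)
  also have "\<dots> = (LINT y|lborel. complex_of_real (sqrt (2 * pi)) * (std_normal_density y *\<^sub>R exp (\<i> * complex_of_real (- a * y))))"
    by (rule integral_mult_right_zero[symmetric])
  also have "\<dots> = (LINT y|lborel. expi (a * y) * gauss y)"
    by (intro Bochner_Integration.integral_cong) (auto simp: gauss_eq_density scaleR_conv_of_real)
  finally show ?thesis by simp
qed

lemma amb_gauss_nonzero: "amb gauss gauss \<xi> s \<noteq> 0"
proof -
  \<comment> \<open>Completing the square: the product of the two Gaussians is centred at -\<xi>/2,
    and scaling by 1 / sqrt 2 restores the standard Gaussian, whose transform has no zeros.\<close>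
  let ?r = "1 / sqrt 2" and ?t = "- \<xi> / 2"
  let ?f = "\<lambda>k. expi (s * k) * (cnj (gauss k) * gauss (k + \<xi>))"
  let ?c = "complex_of_real (exp (- \<xi>\<^sup>2 / 4)) * expi (s * ?t)"
  have f: "?f (?t + ?r * y) = ?c * (expi (s * ?r * y) * gauss y)" for y
  proof -
    have r2: "(?r * y)\<^sup>2 = y\<^sup>2 / 2" by (simp add: power_divide)
    have "(?t + ?r * y)\<^sup>2 / 2 + (?t + ?r * y + \<xi>)\<^sup>2 / 2 = (?r * y)\<^sup>2 + \<xi>\<^sup>2 / 4"
      by (simp add: power2_eq_square field_simps)
    then have "- (?t + ?r * y)\<^sup>2 / 2 + - (?t + ?r * y + \<xi>)\<^sup>2 / 2 = - \<xi>\<^sup>2 / 4 + - y\<^sup>2 / 2"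
      unfolding r2 by simp
    then have "exp (- (?t + ?r * y)\<^sup>2 / 2) * exp (- (?t + ?r * y + \<xi>)\<^sup>2 / 2) = exp (- \<xi>\<^sup>2 / 4) * exp (- y\<^sup>2 / 2)"
      unfolding exp_add[symmetric] by simp
    then have g: "cnj (gauss (?t + ?r * y)) * gauss (?t + ?r * y + \<xi>) = complex_of_real (exp (- \<xi>\<^sup>2 / 4)) * gauss y"
      unfolding gauss_def complex_cnj_complex_of_real of_real_mult[symmetric] by simp
    have "expi (s * (?t + ?r * y)) = exp (- \<i> * complex_of_real (s * ?t) + - \<i> * complex_of_real (s * ?r * y))"
      by (simp add: algebra_simps)
    then have e: "expi (s * (?t + ?r * y)) = expi (s * ?t) * expi (s * ?r * y)"
      unfolding exp_add .
    show ?thesis unfolding g e by (simp only: mult_ac)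
  qed
  have "amb gauss gauss \<xi> s = \<bar>?r\<bar> *\<^sub>R (LINT y|lborel. ?f (?t + ?r * y))"
    unfolding amb_def by (rule lborel_integral_real_affine) simp
  also have "\<dots> = \<bar>?r\<bar> *\<^sub>R (?c * (LINT y|lborel. expi (s * ?r * y) * gauss y))"
    unfolding f by (subst integral_mult_right_zero) (rule refl)
  finally show ?thesis unfolding ft_gauss_integral by simp
qed

section \<open>Fourth powers of transforms and correlations of integrable functions\<close>

lemma nn_integral_ft_power4:
  assumes h: "h \<in> sqint lborel" "integrable lborel h"
  shows "(\<integral>\<^sup>+y. ennreal ((cmod (ft h y)) ^ 4) \<partial>lborel) = ennreal (1 / (2 * pi)) * (\<integral>\<^sup>+\<xi>. ennreal ((cmod (corr h h \<xi>))\<^sup>2) \<partial>lborel)"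
proof -
  let ?u = "ft h" and ?U = "\<lambda>k. h (- k)"
  have u: "?u \<in> sqint lborel" "is_fourier ?u ?U" by (rule Plancherel[OF h], rule Fourier_inversion[OF h(1) is_fourier_ft[OF h]])
  have [measurable]: "?u \<in> borel_measurable borel" "h \<in> borel_measurable borel" using u(1) h(1) by (auto simp: sqint_def)
  have uu: "(\<lambda>x. cnj (?u x) * ?u x) \<in> sqint lborel"
    by (rule sqint_bounded_mult(1)[OF u(1), where C="LINT x|lborel. cmod (h x)"]) (use cmod_ft_le[OF h(2)] in auto)
  have c: "corr ?U ?U \<xi> = cnj (corr h h \<xi>)" for \<xi>
  proof -
    have "corr ?U ?U \<xi> = (LINT k|lborel. cnj (h (- (- \<xi> + (-1) * k))) * h (- ((- \<xi> + (-1) * k) + \<xi>)))"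
      unfolding corr_def by (subst integral_lborel_isometry[of "-1" _ "- \<xi>"]) auto
    also have "\<dots> = (LINT k|lborel. cnj (cnj (h k) * h (k + \<xi>)))"
      by (intro Bochner_Integration.integral_cong) (auto simp: algebra_simps)
    finally show ?thesis unfolding corr_def Bochner_Integration.integral_cnj .
  qed
  show ?thesis unfolding nn_integral_power4_corr[OF u uu] c by simp
qed

text \<open>The convolution theorem with g reflected, whence the argument -y. The Fubini estimate is
  shown for an arbitrary unimodular factor, since it is used both with and without the
  exponential.\<close>

lemma ft_correlation:
  assumes P: "integrable lborel P" and g: "integrable lborel g"
  defines "C \<equiv> \<lambda>x. LINT k|lborel. P k * g (k - x)"
  shows "integrable lborel C" "ft C y = complex_of_real (sqrt (2 * pi)) * (ft P y * ft g (- y))"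
proof -
  have [measurable]: "P \<in> borel_measurable borel" "g \<in> borel_measurable borel"
    using borel_measurable_integrable[OF P] borel_measurable_integrable[OF g] by auto
  have gk: "integrable lborel (\<lambda>x. g (k - x))" for k
    using lborel_integrable_real_affine[OF g, of "-1" k] by simp
  have gn: "(LINT x|lborel. cmod (g (k - x))) = (LINT x|lborel. cmod (g x))" for k
    using integral_lborel_isometry[of "-1" "\<lambda>x. cmod (g x)" k] by simp
  let ?e = "\<lambda>x. expi (y * x)"
  have int: "integrable (lborel \<Otimes>\<^sub>M lborel) (\<lambda>(k, x). e x * (P k * g (k - x)))"
    if [measurable]: "e \<in> borel_measurable borel" and e: "\<And>x. cmod (e x) = 1" for e :: "real \<Rightarrow> complex"
  proof (rule lborel_pair.Fubini_integrable)
    show "(\<lambda>(k, x). e x * (P k * g (k - x))) \<in> borel_measurable (lborel \<Otimes>\<^sub>M lborel)" by measurable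
    have "(\<lambda>k. LINT x|lborel. cmod (e x * (P k * g (k - x)))) = (\<lambda>k. cmod (P k) * (LINT x|lborel. cmod (g x)))"
      by (simp add: norm_mult e gn)
    then show "integrable lborel (\<lambda>k. LINT x|lborel. cmod (case (k, x) of (k, x) \<Rightarrow> e x * (P k * g (k - x))))"
      using P by simp
    show "AE k in lborel. integrable lborel (\<lambda>x. case (k, x) of (k, x) \<Rightarrow> e x * (P k * g (k - x)))"
    proof (intro AE_I2)
      fix k
      have "integrable lborel (\<lambda>x. e x * (P k * g (k - x)))"
        by (rule Bochner_Integration.integrable_bound[OF integrable_mult_right[OF gk, of "P k" k]]) (auto simp: norm_mult e)
      then show "integrable lborel (\<lambda>x. case (k, x) of (k, x) \<Rightarrow> e x * (P k * g (k - x)))" by simp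
    qed
  qed
  show "integrable lborel C"
    using lborel_pair.integrable_snd[OF int[of "\<lambda>x. 1"]] by (simp add: C_def)
  have "(LINT x|lborel. ?e x * C x) = (LINT x|lborel. LINT k|lborel. ?e x * (P k * g (k - x)))"
    unfolding C_def by simp
  also have "\<dots> = (LINT k|lborel. LINT x|lborel. ?e x * (P k * g (k - x)))"
    using lborel_pair.Fubini_integral[OF int[of ?e]] by simp
  also have "\<dots> = (LINT k|lborel. (?e k * P k) * (LINT z|lborel. expi (- y * z) * g z))"
  proof (rule Bochner_Integration.integral_cong[OF refl])
    fix k
    have "(LINT x|lborel. ?e x * (P k * g (k - x))) = (LINT z|lborel. ?e (k + (-1) * z) * (P k * g (k - (k + (-1) * z))))"
      by (rule integral_lborel_isometry[symmetric]) simp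
    also have "\<dots> = (LINT z|lborel. (?e k * P k) * (expi (- y * z) * g z))"
    proof (rule Bochner_Integration.integral_cong[OF refl])
      fix z
      have "?e (k + (-1) * z) = exp (- \<i> * complex_of_real (y * k) + - \<i> * complex_of_real (- y * z))"
        by (simp add: algebra_simps)
      then show "?e (k + (-1) * z) * (P k * g (k - (k + (-1) * z))) = (?e k * P k) * (expi (- y * z) * g z)"
        unfolding exp_add by (simp add: mult_ac)
    qed
    also have "\<dots> = (?e k * P k) * (LINT z|lborel. expi (- y * z) * g z)"
      by (rule integral_mult_right_zero)
    finally show "(LINT x|lborel. ?e x * (P k * g (k - x))) = (?e k * P k) * (LINT z|lborel. expi (- y * z) * g z)" .
  qed
  also have "\<dots> = (LINT k|lborel. ?e k * P k) * (LINT z|lborel. expi (- y * z) * g z)"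
    by (rule integral_mult_left_zero)
  finally have "ft C y = complex_of_real (1 / sqrt (2 * pi)) *
      ((LINT k|lborel. ?e k * P k) * (LINT z|lborel. expi (- y * z) * g z))"
    by (simp only: ft_def)
  moreover have "complex_of_real (1 / sqrt (2 * pi)) * (a * b) =
    complex_of_real (sqrt (2 * pi)) * ((complex_of_real (1 / sqrt (2 * pi)) * a) * (complex_of_real (1 / sqrt (2 * pi)) * b))" for a b
    by simp
  ultimately show "ft C y = complex_of_real (sqrt (2 * pi)) * (ft P y * ft g (- y))"
    unfolding ft_def by (simp only:)
qed

text \<open>For fixed \<open>x\<close>, \<open>y \<mapsto> amb gauss F x y\<close> is a Fourier transform. Plancherel's theorem, first in \<open>y\<close> and
  then in \<open>x\<close>, identifies the left-hand side with the integral of \<open>|amb gauss F|\<^sup>4\<close>.\<close>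

lemma amb_self_mult_le:
  assumes F: "F \<in> sqint lborel" and \<epsilon>: "0 \<le> \<epsilon>" "\<And>x y. cmod (amb gauss F x y) \<le> \<epsilon>"
  shows "(\<integral>\<^sup>+s. \<integral>\<^sup>+y. ennreal ((cmod (amb gauss gauss s y))\<^sup>2 * (cmod (amb F F s y))\<^sup>2) \<partial>lborel \<partial>lborel) \<le>
    ennreal (\<epsilon>\<^sup>2 * (2 * pi * (l2norm lborel gauss)\<^sup>2 * (l2norm lborel F)\<^sup>2))"
proof -
  have [measurable]: "F \<in> borel_measurable borel" using F by (simp add: sqint_def)
  define h where "h x k = cnj (gauss k) * F (k + x)" for x k
  have h: "h x \<in> sqint lborel" "integrable lborel (h x)" for x
    unfolding h_def[abs_def]
    by (rule sqint_bounded_mult(1)[OF sqint_shift[OF F], where C=1], simp_all add: cmod_gauss_le)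
      (intro sqint_mult_integrable sqint_cnj gauss_sqint sqint_shift F)
  define P where "P s k = cnj (F k) * F (k + s)" for s k
  define q where "q s k = cnj (gauss k) * gauss (k + s)" for s k
  have P: "integrable lborel (P s)" for s unfolding P_def[abs_def] by (intro sqint_mult_integrable sqint_cnj F sqint_shift)
  have q: "integrable lborel (q s)" for s unfolding q_def[abs_def] by (intro sqint_mult_integrable sqint_cnj gauss_sqint sqint_shift)
  define C where "C s x = (LINT k|lborel. P s k * cnj (q s (k - x)))" for s x
  have [measurable]: "(\<lambda>p. C (fst p) (snd p)) \<in> borel_measurable (borel \<Otimes>\<^sub>M borel)"
    unfolding C_def P_def q_def by measurable
  have [measurable]: "(\<lambda>s. C s x) \<in> borel_measurable borel" "C s \<in> borel_measurable borel"
    "(\<lambda>p. C (snd p) (fst p)) \<in> borel_measurable (borel \<Otimes>\<^sub>M borel)" for s x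
    unfolding C_def[abs_def] P_def q_def by measurable
  \<comment> \<open>A shift of k by x trades the autocorrelation of the windowed function
    \<open>h x\<close> at lag s for a correlation, in the variable x, of the lag products
    \<open>P s\<close> and \<open>q s\<close>.\<close>
  have corr_h: "corr (h x) (h x) s = C s x" for x s
  proof -
    have "corr (h x) (h x) s = (LINT k|lborel. cnj (h x (- x + 1 * k)) * h x ((- x + 1 * k) + s))"
      unfolding corr_def by (rule integral_lborel_isometry[symmetric]) simp
    also have "\<dots> = C s x"
      unfolding C_def by (intro Bochner_Integration.integral_cong) (auto simp: h_def P_def q_def gauss_def algebra_simps)
    finally show ?thesis .
  qed
  have ftP: "ft (P s) y = complex_of_real (1 / sqrt (2 * pi)) * amb F F s y" for s y
    by (simp add: amb_def P_def ft_def)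
  have ftq: "ft (q s) y = complex_of_real (1 / sqrt (2 * pi)) * amb gauss gauss s y" for s y
    by (simp add: amb_def q_def ft_def)
  have Cint: "integrable lborel (C s)" "ft (C s) y = complex_of_real (1 / sqrt (2 * pi)) * (amb F F s y * cnj (amb gauss gauss s y))" for s y
  proof -
    have cq: "integrable lborel (\<lambda>k. cnj (q s k))" using q by simp
    note c = ft_correlation[OF P[of s] cq]
    show "integrable lborel (C s)" using c(1) by (simp add: C_def[abs_def])
    have "complex_of_real (sqrt (2 * pi)) * ((complex_of_real (1 / sqrt (2 * pi)) * a) * (complex_of_real (1 / sqrt (2 * pi)) * b)) =
      complex_of_real (1 / sqrt (2 * pi)) * (a * b)" for a b by simp
    then show "ft (C s) y = complex_of_real (1 / sqrt (2 * pi)) * (amb F F s y * cnj (amb gauss gauss s y))"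
      using c(2)[of y] unfolding ft_cnj minus_minus ftP ftq complex_cnj_mult complex_cnj_complex_of_real C_def[abs_def]
      by (simp only:)
  qed
  \<comment> \<open>Plancherel's theorem in x wants \<open>C s\<close> in L2 as well as in L1; it is
    bounded, because \<open>P s\<close> is integrable and \<open>q s\<close> is at most 1.\<close>
  have Csq: "C s \<in> sqint lborel" for s
  proof (rule integrable_bounded_sqint[OF Cint(1)])
    fix x
    have "cmod (C s x) \<le> (LINT k|lborel. cmod (P s k * cnj (q s (k - x))))" unfolding C_def by (rule integral_norm_bound)
    also have "\<dots> \<le> (LINT k|lborel. cmod (P s k))"
    proof (rule integral_mono)
      show "integrable lborel (\<lambda>k. cmod (P s k))" using P by simp
      have b: "cmod (P s k * cnj (q s (k - x))) \<le> cmod (P s k)" for k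
      proof -
        have "cmod (cnj (q s (k - x))) \<le> 1"
          unfolding q_def by (simp add: norm_mult cmod_gauss_le mult_le_one)
        then show ?thesis by (simp add: norm_mult mult_left_le)
      qed
      show "cmod (P s k * cnj (q s (k - x))) \<le> cmod (P s k)" for k by (rule b)
      show "integrable lborel (\<lambda>k. cmod (P s k * cnj (q s (k - x))))"
        by (rule Bochner_Integration.integrable_bound[OF P[of s]]) (use b in \<open>auto simp: P_def q_def\<close>)
    qed
    finally show "cmod (C s x) \<le> (LINT k|lborel. cmod (P s k))" .
  qed
  have Cn: "(\<integral>\<^sup>+x. ennreal ((cmod (C s x))\<^sup>2) \<partial>lborel) =
    ennreal (1 / (2 * pi)) * (\<integral>\<^sup>+y. ennreal ((cmod (amb gauss gauss s y))\<^sup>2 * (cmod (amb F F s y))\<^sup>2) \<partial>lborel)" for s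
  proof -
    have "(\<integral>\<^sup>+x. ennreal ((cmod (C s x))\<^sup>2) \<partial>lborel) = (\<integral>\<^sup>+y. ennreal ((cmod (ft (C s) y))\<^sup>2) \<partial>lborel)"
      by (simp add: nn_integral_l2norm Csq Plancherel[OF Csq Cint(1)])
    also have "\<dots> = (\<integral>\<^sup>+y. ennreal (1 / (2 * pi)) * ennreal ((cmod (amb gauss gauss s y))\<^sup>2 * (cmod (amb F F s y))\<^sup>2) \<partial>lborel)"
    proof (rule nn_integral_cong)
      fix y
      have "(cmod (ft (C s) y))\<^sup>2 = 1 / (2 * pi) * ((cmod (amb gauss gauss s y))\<^sup>2 * (cmod (amb F F s y))\<^sup>2)"
        unfolding Cint(2) norm_mult power_mult_distrib by (simp add: norm_divide power_divide)
      then show "ennreal ((cmod (ft (C s) y))\<^sup>2) = ennreal (1 / (2 * pi)) * ennreal ((cmod (amb gauss gauss s y))\<^sup>2 * (cmod (amb F F s y))\<^sup>2)"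
        by (simp add: ennreal_mult[symmetric])
    qed
    also have "\<dots> = ennreal (1 / (2 * pi)) * (\<integral>\<^sup>+y. ennreal ((cmod (amb gauss gauss s y))\<^sup>2 * (cmod (amb F F s y))\<^sup>2) \<partial>lborel)"
      by (rule nn_integral_cmult) measurable
    finally show ?thesis .
  qed
  have one: "ennreal (2 * pi) * (ennreal (1 / (2 * pi)) * a) = a" for a
    by (simp add: mult.assoc[symmetric] ennreal_mult[symmetric])
  have V4: "(\<integral>\<^sup>+y. ennreal ((cmod (amb gauss F x y)) ^ 4) \<partial>lborel) = ennreal (2 * pi) * (\<integral>\<^sup>+s. ennreal ((cmod (C s x))\<^sup>2) \<partial>lborel)" for x
  proof -
    have a: "amb gauss F x y = complex_of_real (sqrt (2 * pi)) * ft (h x) y" for y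
      by (simp add: amb_eq_ft h_def[abs_def])
    have 4: "(cmod (amb gauss F x y)) ^ 4 = (2 * pi)\<^sup>2 * (cmod (ft (h x) y)) ^ 4" for y
    proof -
      have "sqrt (2 * pi) ^ (2 * 2) = ((sqrt (2 * pi))\<^sup>2)\<^sup>2" by (rule power_mult)
      then have "sqrt (2 * pi) ^ 4 = (2 * pi)\<^sup>2" by simp
      then show ?thesis unfolding a norm_mult power_mult_distrib by simp
    qed
    have [measurable]: "ft (h x) \<in> borel_measurable borel" by (intro borel_measurable_ft) (unfold h_def, measurable)
    have "(\<integral>\<^sup>+y. ennreal ((cmod (amb gauss F x y)) ^ 4) \<partial>lborel) = ennreal ((2 * pi)\<^sup>2) * (\<integral>\<^sup>+y. ennreal ((cmod (ft (h x) y)) ^ 4) \<partial>lborel)"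
      unfolding 4 by (simp add: ennreal_mult nn_integral_cmult)
    also have "\<dots> = ennreal (2 * pi) * (ennreal (2 * pi) * (ennreal (1 / (2 * pi)) * (\<integral>\<^sup>+s. ennreal ((cmod (C s x))\<^sup>2) \<partial>lborel)))"
    proof -
      have "ennreal ((2 * pi)\<^sup>2) = ennreal (2 * pi) * ennreal (2 * pi)"
        by (subst ennreal_mult[symmetric]) (auto simp: power2_eq_square)
      then show ?thesis unfolding nn_integral_ft_power4[OF h] corr_h by (simp only: mult.assoc)
    qed
    finally show ?thesis unfolding one .
  qed
  have "(\<integral>\<^sup>+s. \<integral>\<^sup>+y. ennreal ((cmod (amb gauss gauss s y))\<^sup>2 * (cmod (amb F F s y))\<^sup>2) \<partial>lborel \<partial>lborel) =
    (\<integral>\<^sup>+s. ennreal (2 * pi) * (\<integral>\<^sup>+x. ennreal ((cmod (C s x))\<^sup>2) \<partial>lborel) \<partial>lborel)"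
    unfolding Cn one ..
  also have "\<dots> = (\<integral>\<^sup>+s. \<integral>\<^sup>+x. ennreal (2 * pi) * ennreal ((cmod (C s x))\<^sup>2) \<partial>lborel \<partial>lborel)"
    by (intro nn_integral_cong nn_integral_cmult[symmetric]) measurable
  also have "\<dots> = (\<integral>\<^sup>+x. \<integral>\<^sup>+s. ennreal (2 * pi) * ennreal ((cmod (C s x))\<^sup>2) \<partial>lborel \<partial>lborel)"
    by (rule lborel_pair.Fubini') measurable
  also have "\<dots> = (\<integral>\<^sup>+x. ennreal (2 * pi) * (\<integral>\<^sup>+s. ennreal ((cmod (C s x))\<^sup>2) \<partial>lborel) \<partial>lborel)"
    by (intro nn_integral_cong nn_integral_cmult) measurable
  also have "\<dots> = (\<integral>\<^sup>+x. \<integral>\<^sup>+y. ennreal ((cmod (amb gauss F x y)) ^ 4) \<partial>lborel \<partial>lborel)"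
    unfolding V4 ..
  \<comment> \<open>Two of the four factors are estimated by \<epsilon>; the other two are
    integrated exactly by \<open>nn_integral_amb\<close>.\<close>
  also have "\<dots> \<le> (\<integral>\<^sup>+x. \<integral>\<^sup>+y. ennreal (\<epsilon>\<^sup>2) * ennreal ((cmod (amb gauss F x y))\<^sup>2) \<partial>lborel \<partial>lborel)"
  proof (intro nn_integral_mono)
    fix x y
    have "(cmod (amb gauss F x y)) ^ 4 = (cmod (amb gauss F x y))\<^sup>2 * (cmod (amb gauss F x y))\<^sup>2"
      by (simp flip: power_add)
    also have "\<dots> \<le> \<epsilon>\<^sup>2 * (cmod (amb gauss F x y))\<^sup>2" by (intro mult_right_mono power_mono \<epsilon>) auto
    finally show "ennreal ((cmod (amb gauss F x y)) ^ 4) \<le> ennreal (\<epsilon>\<^sup>2) * ennreal ((cmod (amb gauss F x y))\<^sup>2)"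
      by (simp add: ennreal_mult[symmetric] ennreal_leI)
  qed
  also have "\<dots> = ennreal (\<epsilon>\<^sup>2) * (\<integral>\<^sup>+x. \<integral>\<^sup>+y. ennreal ((cmod (amb gauss F x y))\<^sup>2) \<partial>lborel \<partial>lborel)"
    by (simp add: nn_integral_cmult)
  also have "\<dots> = ennreal (\<epsilon>\<^sup>2 * (2 * pi * (l2norm lborel gauss)\<^sup>2 * (l2norm lborel F)\<^sup>2))"
    unfolding nn_integral_amb[OF gauss_sqint F] by (simp add: ennreal_mult)
  finally show ?thesis .
qed

context dispersion_density
begin

text \<open>Suppose the cross ambiguity function with the Gaussian is at most \<epsilon> everywhere.
  The energy then comes from three regions: the outside of the strip; the set \<open>E n\<close>,
  where \<psi> exceeds n + 1 times the weight w and whose measure is small; and the rest of the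
  strip, where \<psi> is dominated by that multiple of w and \<open>amb_self_mult_le\<close>
  applies. Each contributes at most c/4, and all choices depend on c and m but not on F.\<close>

lemma nonvanishing:
  assumes c: "0 < c" and m: "0 \<le> m"
  shows "\<exists>\<epsilon>>0. \<forall>F\<in>sqint lborel. l2norm lborel F = m \<and> c \<le> (l2norm nu (amb_line F F))\<^sup>2 \<longrightarrow> (\<exists>x y. \<epsilon> < cmod (amb gauss F x y))"
proof -
  \<comment> \<open>Makes the outside of the strip contribute at most c/4. The + 1 here and in the
    bound for \<open>E n\<close> covers m = 0.\<close>
  define \<delta> where "\<delta> = c / (4 * (2 * pi * m\<^sup>2 * m\<^sup>2 + 1))"
  have den: "0 < 2 * pi * m\<^sup>2 * m\<^sup>2 + 1" by (intro add_nonneg_pos) auto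
  have \<delta>: "0 < \<delta>" unfolding \<delta>_def using c den by (intro divide_pos_pos mult_pos_pos) auto
  have \<delta>le: "\<delta> * (2 * pi * m\<^sup>2 * m\<^sup>2) \<le> c / 4"
  proof -
    have "\<delta> * (2 * pi * m\<^sup>2 * m\<^sup>2) \<le> \<delta> * (2 * pi * m\<^sup>2 * m\<^sup>2 + 1)" using \<delta> by (intro mult_left_mono) auto
    also have "\<dots> = c / 4"
    proof -
      have "c / (4 * D) * D = c / 4" if "0 < D" for D using that by simp
      from this[OF den] show ?thesis unfolding \<delta>_def .
    qed
    finally show ?thesis .
  qed
  \<comment> \<open>The Jacobian 2 |\<xi>| times the Gaussian weight, so that the integral of w |amb
    F F|^2 over all (t, \<xi>) is the left-hand side of \<open>amb_self_mult_le\<close>.\<close>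
  define w where "w p = 2 * \<bar>snd p\<bar> * (cmod (amb_line gauss gauss p))\<^sup>2" for p
  have [measurable]: "w \<in> borel_measurable (lborel \<Otimes>\<^sub>M lborel)"
    using amb_line_measurable(1)[OF gauss_sqint gauss_sqint] unfolding w_def by measurable
  have w0: "0 \<le> w p" for p by (simp add: w_def)
  define E where "E n = {p \<in> strip \<delta>. real (Suc n) * w p < \<psi> (fst p)}" for n
  have Em: "E n \<in> sets (lborel \<Otimes>\<^sub>M lborel)" for n
  proof -
    have "E n = strip \<delta> \<inter> {p \<in> space (lborel \<Otimes>\<^sub>M lborel). real (Suc n) * w p < \<psi> (fst p)}"
      by (auto simp: E_def space_pair_measure)
    also have "\<dots> \<in> sets (lborel \<Otimes>\<^sub>M lborel)" by (intro sets.Int strip_sets) measurable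
    finally show ?thesis .
  qed
  note [measurable] = Em
  have Emn: "E n \<in> sets nu" for n using Em sets_nu by simp
  \<comment> \<open>The sets decrease within a strip of finite measure, and their intersection lies
    in \<xi> = 0 because w has no other zeros.\<close>
  have "(\<lambda>n. emeasure nu (E n)) \<longlonglongrightarrow> emeasure nu (\<Inter>n. E n)"
  proof (rule Lim_emeasure_decseq)
    show "range E \<subseteq> sets nu" using Emn by auto
    show "decseq E"
    proof (rule decseq_SucI, rule subsetI)
      fix n p assume p: "p \<in> E (Suc n)"
      have "real (Suc n) * w p \<le> real (Suc (Suc n)) * w p" using w0 by (intro mult_right_mono) auto
      then show "p \<in> E n" using p by (auto simp: E_def)
    qed
    fix n
    have "emeasure nu (E n) \<le> emeasure nu (strip \<delta>)"
      using strip_sets sets_nu by (intro emeasure_mono) (auto simp: E_def)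
    then show "emeasure nu (E n) \<noteq> \<infinity>" unfolding emeasure_strip[OF \<delta>] by (auto simp: top_unique)
  qed
  moreover have "emeasure nu (\<Inter>n. E n) = 0"
  proof -
    have sub: "(\<Inter>n. E n) \<subseteq> {p. snd p = 0}"
    proof
      fix p assume p: "p \<in> (\<Inter>n. E n)"
      have "w p = 0"
      proof (rule ccontr)
        assume "w p \<noteq> 0"
        then have "0 < w p" using w0[of p] by simp
        then obtain n where n: "\<psi> (fst p) < real n * w p" using reals_Archimedean3 by blast
        also have "\<dots> \<le> real (Suc n) * w p" using w0 by (intro mult_right_mono) auto
        finally show False using p by (auto simp: E_def dest!: spec[of _ n])
      qed
      then show "p \<in> {p. snd p = 0}" using amb_gauss_nonzero by (simp add: w_def amb_line_def)
    qed
    have zm: "{p. snd p = (0::real)} \<in> sets (lborel \<Otimes>\<^sub>M (lborel :: real measure))"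
    proof -
      have "{p \<in> space (lborel \<Otimes>\<^sub>M lborel). snd p = (0::real)} \<in> sets (lborel \<Otimes>\<^sub>M (lborel :: real measure))" by measurable
      then show ?thesis by (simp add: space_pair_measure)
    qed
    have "emeasure nu {p. snd p = 0} = (\<integral>\<^sup>+p. indicator {p. snd p = 0} p \<partial>nu)"
      by (rule nn_integral_indicator[symmetric]) (use zm sets_nu in blast)
    also have "\<dots> = (\<integral>\<^sup>+t. \<integral>\<^sup>+\<xi>. ennreal (\<psi> t) * indicator {p. snd p = (0 :: real)} (t, \<xi>) \<partial>lborel \<partial>lborel)"
      using zm by (intro nn_integral_nu) auto
    also have "\<dots> = (\<integral>\<^sup>+t. \<integral>\<^sup>+\<xi>. ennreal (\<psi> t) * indicator {0 :: real} \<xi> \<partial>lborel \<partial>lborel)"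
      by (intro nn_integral_cong) (auto simp: indicator_def)
    also have "\<dots> = 0" by (simp add: nn_integral_cmult_indicator)
    finally have "emeasure nu {p. snd p = 0} = 0" .
    then show ?thesis using emeasure_mono[OF sub, of nu] zm sets_nu by simp
  qed
  ultimately have lim: "(\<lambda>n. emeasure nu (E n)) \<longlonglongrightarrow> 0" by simp
  have "0 < ennreal (c / (4 * (m\<^sup>2 * m\<^sup>2 + 1)))"
    using c by (auto intro!: divide_pos_pos mult_pos_pos add_nonneg_pos)
  from order_tendstoD(2)[OF lim this] obtain n where n: "emeasure nu (E n) < ennreal (c / (4 * (m\<^sup>2 * m\<^sup>2 + 1)))"
    by (auto simp: eventually_sequentially)
  \<comment> \<open>The bound of \<open>amb_self_mult_le\<close> without its factor \<epsilon>^2,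
    times the n + 1 from \<open>E n\<close>.\<close>
  define \<kappa> where "\<kappa> = real (Suc n) * (2 * pi * (l2norm lborel gauss)\<^sup>2 * m\<^sup>2)"
  have \<kappa>: "0 \<le> \<kappa>" by (simp add: \<kappa>_def)
  define \<epsilon> where "\<epsilon> = sqrt (c / (4 * (\<kappa> + 1)))"
  have \<epsilon>: "0 < \<epsilon>" using c \<kappa> by (simp add: \<epsilon>_def)
  have \<epsilon>le: "\<kappa> * \<epsilon>\<^sup>2 \<le> c / 4"
  proof -
    have "\<epsilon>\<^sup>2 = c / (4 * (\<kappa> + 1))" using c \<kappa> by (simp add: \<epsilon>_def)
    moreover have "\<kappa> * (c / (4 * (\<kappa> + 1))) \<le> (\<kappa> + 1) * (c / (4 * (\<kappa> + 1)))" using c \<kappa> by (intro mult_right_mono) auto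
    moreover have "(\<kappa> + 1) * (c / (4 * (\<kappa> + 1))) = c / 4"
    proof -
      have "D * (c / (4 * D)) = c / 4" if "0 < D" for D using that by simp
      from this[of "\<kappa> + 1"] show ?thesis using \<kappa> by linarith
    qed
    ultimately show ?thesis by (simp only:)
  qed
  have "\<exists>x y. \<epsilon> < cmod (amb gauss F x y)"
    if F: "F \<in> sqint lborel" and nF: "l2norm lborel F = m" and ge: "c \<le> (l2norm nu (amb_line F F))\<^sup>2" for F
  proof (rule ccontr)
    assume "\<not> ?thesis"
    then have small: "cmod (amb gauss F x y) \<le> \<epsilon>" for x y by (auto simp: not_less)
    have [measurable]: "F \<in> borel_measurable borel" using F by (simp add: sqint_def)
    note [measurable] = amb_line_measurable[OF F F]
    let ?h = "\<lambda>p. ennreal ((cmod (amb_line F F p))\<^sup>2)"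
    have hle: "?h p \<le> ennreal (m\<^sup>2 * m\<^sup>2)" for p
    proof -
      have "cmod (amb_line F F p) \<le> m * m" unfolding amb_line_def using cmod_amb_le[OF F F] nF by simp
      then have "(cmod (amb_line F F p))\<^sup>2 \<le> (m * m)\<^sup>2" by (intro power_mono) auto
      then show ?thesis by (simp add: power_mult_distrib ennreal_leI)
    qed
    have pw: "ennreal (\<psi> t) * (?h (t, \<xi>) * indicator (strip \<delta>) (t, \<xi>)) \<le>
      ennreal (\<psi> t) * (ennreal (m\<^sup>2 * m\<^sup>2) * indicator (E n) (t, \<xi>)) + ennreal (real (Suc n)) * (ennreal (w (t, \<xi>)) * ?h (t, \<xi>))" for t \<xi>
    proof (cases "(t, \<xi>) \<in> E n")
      case True
      then show ?thesis using hle[of "(t, \<xi>)"] by (auto simp: E_def intro!: add_increasing2 mult_left_mono)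
    next
      case False
      show ?thesis
      proof (cases "(t, \<xi>) \<in> strip \<delta>")
        case True
        then have "\<psi> t \<le> real (Suc n) * w (t, \<xi>)" using False by (auto simp: E_def)
        then have "ennreal (\<psi> t) \<le> ennreal (real (Suc n) * w (t, \<xi>))" by (rule ennreal_leI)
        also have "\<dots> = ennreal (real (Suc n)) * ennreal (w (t, \<xi>))" by (rule ennreal_mult) (auto simp: w0)
        finally have "ennreal (\<psi> t) \<le> ennreal (real (Suc n)) * ennreal (w (t, \<xi>))" .
        then have "ennreal (\<psi> t) * ?h (t, \<xi>) \<le> ennreal (real (Suc n)) * ennreal (w (t, \<xi>)) * ?h (t, \<xi>)"
          by (intro mult_right_mono) auto
        then show ?thesis using True by (simp add: mult.assoc add_increasing)
      qed simp
    qed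
    have "(\<integral>\<^sup>+p. ?h p * indicator (strip \<delta>) p \<partial>nu) = (\<integral>\<^sup>+t. \<integral>\<^sup>+\<xi>. ennreal (\<psi> t) * (?h (t, \<xi>) * indicator (strip \<delta>) (t, \<xi>)) \<partial>lborel \<partial>lborel)"
      by (rule nn_integral_nu) measurable
    also have "\<dots> \<le> (\<integral>\<^sup>+t. \<integral>\<^sup>+\<xi>. ennreal (\<psi> t) * (ennreal (m\<^sup>2 * m\<^sup>2) * indicator (E n) (t, \<xi>)) + ennreal (real (Suc n)) * (ennreal (w (t, \<xi>)) * ?h (t, \<xi>)) \<partial>lborel \<partial>lborel)"
      by (intro nn_integral_mono pw)
    also have "\<dots> = (\<integral>\<^sup>+t. (\<integral>\<^sup>+\<xi>. ennreal (\<psi> t) * (ennreal (m\<^sup>2 * m\<^sup>2) * indicator (E n) (t, \<xi>)) \<partial>lborel) +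
        (\<integral>\<^sup>+\<xi>. ennreal (real (Suc n)) * (ennreal (w (t, \<xi>)) * ?h (t, \<xi>)) \<partial>lborel) \<partial>lborel)"
      by (intro nn_integral_cong nn_integral_add) measurable
    also have "\<dots> = (\<integral>\<^sup>+t. \<integral>\<^sup>+\<xi>. ennreal (\<psi> t) * (ennreal (m\<^sup>2 * m\<^sup>2) * indicator (E n) (t, \<xi>)) \<partial>lborel \<partial>lborel) +
        (\<integral>\<^sup>+t. \<integral>\<^sup>+\<xi>. ennreal (real (Suc n)) * (ennreal (w (t, \<xi>)) * ?h (t, \<xi>)) \<partial>lborel \<partial>lborel)"
      by (rule nn_integral_add) measurable
    also have "(\<integral>\<^sup>+t. \<integral>\<^sup>+\<xi>. ennreal (\<psi> t) * (ennreal (m\<^sup>2 * m\<^sup>2) * indicator (E n) (t, \<xi>)) \<partial>lborel \<partial>lborel) =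
        (\<integral>\<^sup>+p. ennreal (m\<^sup>2 * m\<^sup>2) * indicator (E n) p \<partial>nu)"
      by (rule nn_integral_nu[symmetric]) measurable
    also have "\<dots> = ennreal (m\<^sup>2 * m\<^sup>2) * emeasure nu (E n)" by (rule nn_integral_cmult_indicator[OF Emn])
    also have "\<dots> \<le> ennreal (m\<^sup>2 * m\<^sup>2) * ennreal (c / (4 * (m\<^sup>2 * m\<^sup>2 + 1)))" using n by (intro mult_left_mono) auto
    also have "\<dots> \<le> ennreal (c / 4)"
    proof -
      have p: "0 < m\<^sup>2 * m\<^sup>2 + 1" by (intro add_nonneg_pos) auto
      have "m\<^sup>2 * m\<^sup>2 * (c / (4 * (m\<^sup>2 * m\<^sup>2 + 1))) \<le> (m\<^sup>2 * m\<^sup>2 + 1) * (c / (4 * (m\<^sup>2 * m\<^sup>2 + 1)))"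
        using c p by (intro mult_right_mono divide_nonneg_nonneg) auto
      also have "\<dots> = c / 4"
      proof -
        have "D * (c / (4 * D)) = c / 4" if "0 < D" for D using that by simp
        from this[OF p] show ?thesis .
      qed
      finally have "ennreal (m\<^sup>2 * m\<^sup>2 * (c / (4 * (m\<^sup>2 * m\<^sup>2 + 1)))) \<le> ennreal (c / 4)" by (rule ennreal_leI)
      moreover have "ennreal (m\<^sup>2 * m\<^sup>2 * (c / (4 * (m\<^sup>2 * m\<^sup>2 + 1)))) = ennreal (m\<^sup>2 * m\<^sup>2) * ennreal (c / (4 * (m\<^sup>2 * m\<^sup>2 + 1)))"
        using c p by (intro ennreal_mult divide_nonneg_nonneg) auto
      ultimately show ?thesis by simp
    qed
    also have "(\<integral>\<^sup>+t. \<integral>\<^sup>+\<xi>. ennreal (real (Suc n)) * (ennreal (w (t, \<xi>)) * ?h (t, \<xi>)) \<partial>lborel \<partial>lborel) =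
      (\<integral>\<^sup>+t. \<integral>\<^sup>+\<xi>. ennreal (2 * \<bar>\<xi>\<bar>) * (ennreal (real (Suc n)) * ennreal ((cmod (amb gauss gauss \<xi> (2 * t * \<xi>)))\<^sup>2 * (cmod (amb F F \<xi> (2 * t * \<xi>)))\<^sup>2)) \<partial>lborel \<partial>lborel)"
      by (intro nn_integral_cong) (simp add: w_def amb_line_def ennreal_mult mult_ac)
    also have "\<dots> = (\<integral>\<^sup>+\<xi>. \<integral>\<^sup>+s. ennreal (real (Suc n)) * ennreal ((cmod (amb gauss gauss \<xi> s))\<^sup>2 * (cmod (amb F F \<xi> s))\<^sup>2) \<partial>lborel \<partial>lborel)"
      by (rule nn_integral_rescale_lines) measurable
    also have "\<dots> = ennreal (real (Suc n)) * (\<integral>\<^sup>+\<xi>. \<integral>\<^sup>+s. ennreal ((cmod (amb gauss gauss \<xi> s))\<^sup>2 * (cmod (amb F F \<xi> s))\<^sup>2) \<partial>lborel \<partial>lborel)"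
      by (subst nn_integral_cmult; (subst nn_integral_cmult)?) measurable
    also have "\<dots> \<le> ennreal (real (Suc n)) * ennreal (\<epsilon>\<^sup>2 * (2 * pi * (l2norm lborel gauss)\<^sup>2 * (l2norm lborel F)\<^sup>2))"
      by (intro mult_left_mono amb_self_mult_le F less_imp_le[OF \<epsilon>] small) auto
    also have "\<dots> = ennreal (\<kappa> * \<epsilon>\<^sup>2)" unfolding nF by (subst ennreal_mult[symmetric]) (auto simp: \<kappa>_def mult_ac)
    also have "\<dots> \<le> ennreal (c / 4)" using \<epsilon>le by (rule ennreal_leI)
    finally have D: "(\<integral>\<^sup>+p. ?h p * indicator (strip \<delta>) p \<partial>nu) \<le> ennreal (c / 4) + ennreal (c / 4)"
      by (simp add: add_left_mono add_right_mono)
    have "ennreal c \<le> ennreal ((l2norm nu (amb_line F F))\<^sup>2)" using ge by (rule ennreal_leI)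
    also have "\<dots> = (\<integral>\<^sup>+p. ?h p \<partial>nu)" by (rule nn_integral_l2norm[symmetric, OF amb_line_bound(1)[OF F F]])
    also have "\<dots> \<le> ennreal (\<delta> * (2 * pi * m\<^sup>2 * m\<^sup>2)) + (ennreal (c / 4) + ennreal (c / 4))"
      using nn_integral_amb_line_split[OF F F \<delta>] D unfolding nF by (meson add_left_mono order_trans)
    also have "\<dots> \<le> ennreal (c / 4) + (ennreal (c / 4) + ennreal (c / 4))"
      using \<delta>le by (intro add_right_mono ennreal_leI)
    also have "\<dots> = ennreal (3 * c / 4)" using c by (subst ennreal_plus[symmetric], simp, simp)+ simp
    finally show False using c by (simp add: ennreal_le_iff)
  qed
  then show ?thesis using \<epsilon> by blast
qed

end

section \<open>Existence of maximizers and the Euler--Lagrange equation\<close>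

context dispersion_density
begin

text \<open>By \<open>Qc_diagonal\<close> this is 2 pi times the functional, in terms of the
  transform.\<close>

definition energy :: "(real \<Rightarrow> complex) \<Rightarrow> real" where
  "energy F = (l2norm nu (amb_line F F))\<^sup>2"

lemma energy_nonneg: "0 \<le> energy F"
  by (simp add: energy_def)

lemma energy_bound:
  assumes "F \<in> sqint lborel"
  shows "energy F \<le> amb_const\<^sup>2 * ((l2norm lborel F)\<^sup>2)\<^sup>2"
proof -
  have "energy F \<le> (amb_const * l2norm lborel F * l2norm lborel F)\<^sup>2"
    unfolding energy_def by (intro power_mono amb_line_bound assms) auto
  then show ?thesis by (simp add: power_mult_distrib power2_eq_square mult_ac)
qed

lemma Qc_diagonal:
  assumes "f \<in> sqint lborel" "is_fourier f F"
  shows "Qc mu f f f f = complex_of_real (energy F / (2 * pi))"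
  unfolding Qc_eq_l2inner[OF assms assms assms assms] l2inner_self energy_def by simp

lemma energy_cmult: "energy (\<lambda>k. c * F k) = cmod c ^ 4 * energy F"
proof -
  have eq: "amb_line (\<lambda>k. c * F k) (\<lambda>k. c * F k) = (\<lambda>p. (cnj c * c) * amb_line F F p)"
    by (auto simp: amb_line_def amb_cmult_left amb_cmult_right)
  show ?thesis unfolding energy_def eq l2norm_cmult
    by (simp add: norm_mult power_mult_distrib flip: power_add)
qed

text \<open>This symmetry is invisible on the Fourier side: it holds because the first and third factor
  in the integrand of \<open>Qc\<close> commute.\<close>

lemma l2inner_amb_line_swap:
  assumes F: "F1 \<in> sqint lborel" "F2 \<in> sqint lborel" "F3 \<in> sqint lborel" "F4 \<in> sqint lborel"
  shows "l2inner nu (amb_line F2 F1) (amb_line F3 F4) = l2inner nu (amb_line F2 F3) (amb_line F1 F4)"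
proof -
  obtain f1 f2 f3 f4 where f: "f1 \<in> sqint lborel" "is_fourier f1 F1" "f2 \<in> sqint lborel" "is_fourier f2 F2"
    "f3 \<in> sqint lborel" "is_fourier f3 F3" "f4 \<in> sqint lborel" "is_fourier f4 F4"
    using Fourier_surjective F by meson
  have "Qc mu f1 f2 f3 f4 = Qc mu f3 f2 f1 f4" unfolding Qc_def by (simp add: mult_ac)
  then show ?thesis
    unfolding Qc_eq_l2inner[OF f(1,2) f(3,4) f(5,6) f(7,8)] Qc_eq_l2inner[OF f(5,6) f(3,4) f(1,2) f(7,8)] by simp
qed

text \<open>The exchange of first and third argument turns the inner product of the two diagonal
  terms into the squared norm of the mixed one. Being real, it is symmetric in F and G.\<close>

lemma l2norm_amb_line_cross:
  assumes F: "F \<in> sqint lborel" and G: "G \<in> sqint lborel"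
  shows "l2inner nu (amb_line F F) (amb_line G G) = complex_of_real ((l2norm nu (amb_line F G))\<^sup>2)"
    "l2norm nu (amb_line G F) = l2norm nu (amb_line F G)"
proof -
  show 1: "l2inner nu (amb_line F F) (amb_line G G) = complex_of_real ((l2norm nu (amb_line F G))\<^sup>2)"
    using l2inner_amb_line_swap[OF G F F G] unfolding l2inner_self by simp
  have 2: "l2inner nu (amb_line G G) (amb_line F F) = complex_of_real ((l2norm nu (amb_line G F))\<^sup>2)"
    using l2inner_amb_line_swap[OF F G G F] unfolding l2inner_self by simp
  have "l2inner nu (amb_line G G) (amb_line F F) = cnj (l2inner nu (amb_line F F) (amb_line G G))"
    by (simp add: l2inner_cnj)
  then have "complex_of_real ((l2norm nu (amb_line G F))\<^sup>2) = complex_of_real ((l2norm nu (amb_line F G))\<^sup>2)"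
    unfolding 1 2 by simp
  then have "(l2norm nu (amb_line G F))\<^sup>2 = (l2norm nu (amb_line F G))\<^sup>2" using of_real_eq_iff by blast
  then show "l2norm nu (amb_line G F) = l2norm nu (amb_line F G)" by (simp add: power2_eq_iff_nonneg)
qed

lemma amb_line_add:
  assumes "F \<in> sqint lborel" "G \<in> sqint lborel"
  shows "amb_line (\<lambda>k. F k + G k) (\<lambda>k. F k + G k) =
    (\<lambda>p. amb_line F F p + ((amb_line F G p + amb_line G F p) + amb_line G G p))"
  using assms by (auto simp: amb_line_def amb_add_left amb_add_right sqint_add)

text \<open>Every error term carries a factor \<beta>. Even the inner product of the two diagonal
  terms, which shows no smallness by itself, equals \<beta>^2 by
  \<open>l2norm_amb_line_cross\<close>.\<close>

lemma energy_add:
  assumes F: "F \<in> sqint lborel" and G: "G \<in> sqint lborel"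
  defines "\<beta> \<equiv> l2norm nu (amb_line F G)"
  shows "\<bar>energy (\<lambda>k. F k + G k) - (energy F + energy G)\<bar> \<le>
    2 * \<beta>\<^sup>2 + (2 * \<beta>)\<^sup>2 + 4 * \<beta> * (l2norm nu (amb_line F F) + l2norm nu (amb_line G G))"
proof -
  let ?a = "amb_line F F" and ?b = "amb_line F G" and ?c = "amb_line G F" and ?d = "amb_line G G"
  let ?R = "\<lambda>p. ?b p + ?c p"
  have s: "?a \<in> sqint nu" "?b \<in> sqint nu" "?c \<in> sqint nu" "?d \<in> sqint nu" by (intro amb_line_bound F G)+
  have R: "?R \<in> sqint nu" using s by (intro sqint_add)
  have nR: "l2norm nu ?R \<le> 2 * \<beta>"
    using l2norm_triangle[OF s(2,3)] l2norm_amb_line_cross(2)[OF F G] by (simp add: \<beta>_def)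
  have Rd: "(\<lambda>p. ?R p + ?d p) \<in> sqint nu" using R s by (intro sqint_add)
  have ad: "Re (l2inner nu ?a ?d) = \<beta>\<^sup>2" unfolding l2norm_amb_line_cross(1)[OF F G] \<beta>_def by simp
  have "energy (\<lambda>k. F k + G k) = energy F + (l2norm nu (\<lambda>p. ?R p + ?d p))\<^sup>2 + 2 * Re (l2inner nu ?a (\<lambda>p. ?R p + ?d p))"
    unfolding energy_def amb_line_add[OF F G] by (rule l2norm_add_sq[OF s(1) Rd])
  also have "(l2norm nu (\<lambda>p. ?R p + ?d p))\<^sup>2 = (l2norm nu ?R)\<^sup>2 + energy G + 2 * Re (l2inner nu ?R ?d)"
    unfolding energy_def by (rule l2norm_add_sq[OF R s(4)])
  also have "l2inner nu ?a (\<lambda>p. ?R p + ?d p) = l2inner nu ?a ?R + l2inner nu ?a ?d" by (rule l2inner_add_right[OF R s(4) s(1)])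
  finally have e: "energy (\<lambda>k. F k + G k) - (energy F + energy G) =
    (l2norm nu ?R)\<^sup>2 + 2 * Re (l2inner nu ?R ?d) + 2 * Re (l2inner nu ?a ?R) + 2 * \<beta>\<^sup>2" by (simp add: ad)
  have 1: "\<bar>Re (l2inner nu ?R ?d)\<bar> \<le> 2 * \<beta> * l2norm nu ?d"
  proof -
    have "\<bar>Re (l2inner nu ?R ?d)\<bar> \<le> l2norm nu ?R * l2norm nu ?d"
      using abs_Re_le_cmod l2inner_CS[OF R s(4)] by (rule order_trans)
    also have "\<dots> \<le> 2 * \<beta> * l2norm nu ?d" using nR by (intro mult_right_mono) auto
    finally show ?thesis .
  qed
  have 2: "\<bar>Re (l2inner nu ?a ?R)\<bar> \<le> 2 * \<beta> * l2norm nu ?a"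
  proof -
    have "\<bar>Re (l2inner nu ?a ?R)\<bar> \<le> l2norm nu ?a * l2norm nu ?R"
      using abs_Re_le_cmod l2inner_CS[OF s(1) R] by (rule order_trans)
    also have "\<dots> \<le> l2norm nu ?a * (2 * \<beta>)" using nR by (intro mult_left_mono) auto
    finally show ?thesis by (simp add: mult_ac)
  qed
  have 3: "(l2norm nu ?R)\<^sup>2 \<le> (2 * \<beta>)\<^sup>2" using nR by (intro power_mono) auto
  have 4: "4 * \<beta> * (l2norm nu ?a + l2norm nu ?d) = 2 * (2 * \<beta> * l2norm nu ?d) + 2 * (2 * \<beta> * l2norm nu ?a)"
    by (simp add: algebra_simps)
  show ?thesis unfolding e 4 using 1 2 3 zero_le_power2[of "l2norm nu ?R"] zero_le_power2[of \<beta>] by linarith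
qed

text \<open>Weak convergence makes the ambiguity function converge pointwise; the region outside the
  strip, where dominated convergence fails, contributes at most a multiple of \<open>\<delta>\<close>.\<close>

lemma amb_line_weak_null:
  assumes F: "F \<in> sqint lborel" and G: "\<And>n. G n \<in> sqint lborel" "\<And>n. l2norm lborel (G n) \<le> C"
    and weak: "\<And>h. h \<in> sqint lborel \<Longrightarrow> (\<lambda>n. l2inner lborel h (G n)) \<longlonglongrightarrow> 0"
  shows "(\<lambda>n. l2norm nu (amb_line F (G n))) \<longlonglongrightarrow> 0"
proof -
  have C: "0 \<le> C" using G(2)[of 0] l2norm_nonneg order_trans by blast
  have pointwise: "(\<lambda>n. amb_line F (G n) p) \<longlonglongrightarrow> 0" for p
  proof -
    obtain t \<xi> where p: "p = (t, \<xi>)" by (cases p)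
    let ?s = "2 * t * \<xi>"
    \<comment> \<open>The phase-space translate of F for which the value at p is an inner product
      with \<open>G n\<close>.\<close>
    let ?h = "\<lambda>k. expi (- ?s * (k - \<xi>)) * F (k + (- \<xi>))"
    have h: "?h \<in> sqint lborel" by (rule sqint_unimod(1)[OF sqint_shift[OF F]]) auto
    have "amb_line F (G n) p = l2inner lborel ?h (G n)" for n
    proof -
      have "amb_line F (G n) p = (LINT k|lborel. expi (?s * (- \<xi> + 1 * k)) * (cnj (F (- \<xi> + 1 * k)) * G n ((- \<xi> + 1 * k) + \<xi>)))"
        unfolding p amb_line_def amb_def fst_conv snd_conv by (rule integral_lborel_isometry[symmetric]) simp
      also have "\<dots> = l2inner lborel ?h (G n)"
        unfolding l2inner_def
      proof (rule Bochner_Integration.integral_cong[OF refl])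
        fix k
        have "cnj (expi (- ?s * (k - \<xi>))) = expi (?s * (- \<xi> + 1 * k))"
          unfolding exp_cnj by (simp add: algebra_simps)
        then show "expi (?s * (- \<xi> + 1 * k)) * (cnj (F (- \<xi> + 1 * k)) * G n ((- \<xi> + 1 * k) + \<xi>)) = cnj (?h k) * G n k"
          unfolding complex_cnj_mult by (simp only: mult.assoc) (simp add: add.commute)
      qed
      finally show ?thesis .
    qed
    then show ?thesis using weak[OF h] by simp
  qed
  let ?I = "\<lambda>n. \<integral>\<^sup>+p. ennreal ((cmod (amb_line F (G n) p))\<^sup>2) \<partial>nu"
  let ?b = "l2norm lborel F * C"
  have lim: "(\<lambda>n. \<integral>\<^sup>+p. ennreal ((cmod (amb_line F (G n) p))\<^sup>2) * indicator (strip \<delta>) p \<partial>nu) \<longlonglongrightarrow> 0" if \<delta>: "0 < \<delta>" for \<delta>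
  proof -
    have [measurable]: "amb_line F (G n) \<in> borel_measurable nu" for n by (intro amb_line_measurable F G)
    have [measurable]: "strip \<delta> \<in> sets nu" using strip_sets sets_nu by simp
    have "(\<lambda>n. \<integral>\<^sup>+p. ennreal ((cmod (amb_line F (G n) p))\<^sup>2) * indicator (strip \<delta>) p \<partial>nu) \<longlonglongrightarrow> (\<integral>\<^sup>+p. 0 \<partial>nu)"
    proof (rule nn_integral_dominated_convergence[where w="\<lambda>p. ennreal (?b\<^sup>2) * indicator (strip \<delta>) p"])
      have "cmod (amb_line F (G n) p) \<le> ?b" for n p
        using cmod_amb_le[OF F G(1)] mult_left_mono[OF G(2) l2norm_nonneg] unfolding amb_line_def by (rule order_trans)
      then show "AE p in nu. ennreal ((cmod (amb_line F (G n) p))\<^sup>2) * indicator (strip \<delta>) p \<le> ennreal (?b\<^sup>2) * indicator (strip \<delta>) p" for n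
        by (intro AE_I2 mult_right_mono ennreal_leI power_mono) auto
      show "(\<integral>\<^sup>+p. ennreal (?b\<^sup>2) * indicator (strip \<delta>) p \<partial>nu) < \<infinity>"
        by (simp add: nn_integral_cmult_indicator emeasure_strip[OF \<delta>] ennreal_mult_less_top)
      show "AE p in nu. (\<lambda>n. ennreal ((cmod (amb_line F (G n) p))\<^sup>2) * indicator (strip \<delta>) p) \<longlonglongrightarrow> 0"
      proof (intro AE_I2)
        fix p
        have "(\<lambda>n. ennreal ((cmod (amb_line F (G n) p))\<^sup>2)) \<longlonglongrightarrow> ennreal ((cmod 0)\<^sup>2)"
          by (intro tendsto_ennrealI tendsto_intros pointwise)
        then show "(\<lambda>n. ennreal ((cmod (amb_line F (G n) p))\<^sup>2) * indicator (strip \<delta>) p) \<longlonglongrightarrow> 0"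
          by (cases "p \<in> strip \<delta>") auto
      qed
    qed measurable
    then show ?thesis by simp
  qed
  have I_eq: "?I n = ennreal ((l2norm nu (amb_line F (G n)))\<^sup>2)" for n
    by (intro nn_integral_l2norm amb_line_bound F G)
  have "(\<lambda>n. (l2norm nu (amb_line F (G n)))\<^sup>2) \<longlonglongrightarrow> 0"
  proof (rule LIMSEQ_I)
    fix e :: real assume e: "0 < e"
    \<comment> \<open>The + 1 keeps the divisor positive; \<delta> then limits the outside of the
      strip to e/2.\<close>
    define K where "K = 2 * pi * (l2norm lborel F)\<^sup>2 * C\<^sup>2 + 1"
    have K: "0 < K" unfolding K_def by (intro add_nonneg_pos) auto
    define \<delta> where "\<delta> = e / 2 / K"
    have \<delta>: "0 < \<delta>" using e K by (simp add: \<delta>_def)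
    have "0 < ennreal (e / 2)" using e by simp
    from order_tendstoD(2)[OF lim[OF \<delta>] this]
    obtain N where N: "\<And>n. n \<ge> N \<Longrightarrow> (\<integral>\<^sup>+p. ennreal ((cmod (amb_line F (G n) p))\<^sup>2) * indicator (strip \<delta>) p \<partial>nu) < ennreal (e / 2)"
      unfolding eventually_sequentially by blast
    have "(l2norm nu (amb_line F (G n)))\<^sup>2 < e" if "n \<ge> N" for n
    proof -
      have "\<delta> * (2 * pi * (l2norm lborel F)\<^sup>2 * (l2norm lborel (G n))\<^sup>2) \<le> \<delta> * K"
      proof (intro mult_left_mono)
        have "(l2norm lborel (G n))\<^sup>2 \<le> C\<^sup>2" using G(2) by (intro power_mono) auto
        then have "2 * pi * (l2norm lborel F)\<^sup>2 * (l2norm lborel (G n))\<^sup>2 \<le> 2 * pi * (l2norm lborel F)\<^sup>2 * C\<^sup>2"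
          by (intro mult_left_mono) auto
        then show "2 * pi * (l2norm lborel F)\<^sup>2 * (l2norm lborel (G n))\<^sup>2 \<le> K" unfolding K_def by linarith
      qed (use \<delta> in simp)
      also have "\<delta> * K = e / 2" using K by (simp add: \<delta>_def)
      finally have 1: "ennreal (\<delta> * (2 * pi * (l2norm lborel F)\<^sup>2 * (l2norm lborel (G n))\<^sup>2)) \<le> ennreal (e / 2)"
        by (rule ennreal_leI)
      have "ennreal ((l2norm nu (amb_line F (G n)))\<^sup>2) \<le> ennreal (\<delta> * (2 * pi * (l2norm lborel F)\<^sup>2 * (l2norm lborel (G n))\<^sup>2)) +
        (\<integral>\<^sup>+p. ennreal ((cmod (amb_line F (G n) p))\<^sup>2) * indicator (strip \<delta>) p \<partial>nu)"
        unfolding I_eq[symmetric] by (rule nn_integral_amb_line_split[OF F G(1) \<delta>])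
      also have "\<dots> \<le> ennreal (e / 2) + (\<integral>\<^sup>+p. ennreal ((cmod (amb_line F (G n) p))\<^sup>2) * indicator (strip \<delta>) p \<partial>nu)"
        by (rule add_right_mono[OF 1])
      also have "\<dots> < ennreal (e / 2) + ennreal (e / 2)"
        using N[OF that] by (subst ennreal_add_left_cancel_less) auto
      also have "\<dots> = ennreal e" using e by (subst ennreal_plus[symmetric]) auto
      finally show ?thesis by (simp add: ennreal_less_iff)
    qed
    then show "\<exists>no. \<forall>n\<ge>no. norm ((l2norm nu (amb_line F (G n)))\<^sup>2 - 0) < e" by auto
  qed
  from tendsto_real_sqrt[OF this] show ?thesis by simp
qed

text \<open>A decoupling of Brezis--Lieb type. By \<open>energy_add\<close> it suffices that the
  mixed term tends to 0, as the diagonal terms of \<open>G n\<close> stay bounded.\<close>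

lemma energy_split:
  assumes F: "F \<in> sqint lborel" and G: "\<And>n. G n \<in> sqint lborel" "\<And>n. l2norm lborel (G n) \<le> C"
    and weak: "\<And>h. h \<in> sqint lborel \<Longrightarrow> (\<lambda>n. l2inner lborel h (G n)) \<longlonglongrightarrow> 0"
  shows "(\<lambda>n. energy (\<lambda>k. F k + G n k) - (energy F + energy (G n))) \<longlonglongrightarrow> 0"
proof -
  have C: "0 \<le> C" using G(2)[of 0] l2norm_nonneg order_trans by blast
  let ?\<beta> = "\<lambda>n. l2norm nu (amb_line F (G n))"
  let ?D = "l2norm nu (amb_line F F) + amb_const * C * C"
  have b: "?\<beta> \<longlonglongrightarrow> 0" by (rule amb_line_weak_null[OF F G weak])
  have "(\<lambda>n. 2 * (?\<beta> n)\<^sup>2 + (2 * ?\<beta> n)\<^sup>2 + 4 * ?\<beta> n * ?D) \<longlonglongrightarrow> 2 * 0\<^sup>2 + (2 * 0)\<^sup>2 + 4 * 0 * ?D"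
    by (intro tendsto_intros b)
  then have lim: "(\<lambda>n. 2 * (?\<beta> n)\<^sup>2 + (2 * ?\<beta> n)\<^sup>2 + 4 * ?\<beta> n * ?D) \<longlonglongrightarrow> 0" by simp
  show ?thesis
  proof (rule Lim_null_comparison[OF _ lim], intro always_eventually allI)
    fix n
    have "l2norm nu (amb_line (G n) (G n)) \<le> amb_const * l2norm lborel (G n) * l2norm lborel (G n)"
      by (rule amb_line_bound(2)[OF G(1) G(1)])
    also have "\<dots> \<le> amb_const * C * C" using G(2) C amb_const_nonneg by (intro mult_mono) auto
    finally have "4 * ?\<beta> n * (l2norm nu (amb_line F F) + l2norm nu (amb_line (G n) (G n))) \<le> 4 * ?\<beta> n * ?D"
      by (intro mult_left_mono add_left_mono) auto
    then show "norm (energy (\<lambda>k. F k + G n k) - (energy F + energy (G n))) \<le> 2 * (?\<beta> n)\<^sup>2 + (2 * ?\<beta> n)\<^sup>2 + 4 * ?\<beta> n * ?D"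
      using energy_add[OF F G(1), of n] by simp
  qed
qed

section \<open>Phase-space translations and positivity of the energy\<close>

definition translate :: "real \<Rightarrow> real \<Rightarrow> (real \<Rightarrow> complex) \<Rightarrow> real \<Rightarrow> complex" where
  "translate x y F k = expi (y * k) * F (k + x)"

lemma translate_sqint:
  assumes "F \<in> sqint lborel"
  shows "translate x y F \<in> sqint lborel" "l2norm lborel (translate x y F) = l2norm lborel F"
  using sqint_unimod[OF sqint_shift[OF assms], of "\<lambda>k. expi (y * k)" x]
  by (simp_all add: translate_def[abs_def] l2norm_shift)

text \<open>The ambiguity function is multiplied by the phase
  \<open>expi (y * \<xi> - s * x)\<close>, and only its modulus enters the energy.\<close>

lemma energy_translate: "energy (translate x y F) = energy F"
proof -
  have "cmod (amb (translate x y F) (translate x y F) \<xi> s) = cmod (amb F F \<xi> s)" for \<xi> s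
  proof -
    let ?e = "\<lambda>r. expi r"
    have "amb (translate x y F) (translate x y F) \<xi> s =
      (LINT k|lborel. (?e (y * \<xi>) * ?e (- s * x)) * (?e (s * (x + 1 * k)) * (cnj (F (x + 1 * k)) * F ((x + 1 * k) + \<xi>))))"
      unfolding amb_def
    proof (rule Bochner_Integration.integral_cong[OF refl])
      fix k
      have c: "cnj (?e (y * k)) = ?e (- y * k)" by (simp add: exp_cnj)
      have "?e (s * k) * (?e (- y * k) * ?e (y * (k + \<xi>))) = ?e (y * \<xi>) * ?e (- s * x) * ?e (s * (x + 1 * k))"
        unfolding exp_add[symmetric] by (simp add: algebra_simps)
      moreover have "?e (s * k) * (cnj (translate x y F k) * translate x y F (k + \<xi>)) =
        (?e (s * k) * (?e (- y * k) * ?e (y * (k + \<xi>)))) * (cnj (F (k + x)) * F (k + \<xi> + x))"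
        unfolding translate_def complex_cnj_mult c by (simp only: mult_ac)
      moreover have "x + 1 * k = k + x" "x + 1 * k + \<xi> = k + \<xi> + x" by simp_all
      ultimately show "?e (s * k) * (cnj (translate x y F k) * translate x y F (k + \<xi>)) =
        (?e (y * \<xi>) * ?e (- s * x)) * (?e (s * (x + 1 * k)) * (cnj (F (x + 1 * k)) * F ((x + 1 * k) + \<xi>)))"
        by (simp only: mult_ac)
    qed
    also have "\<dots> = (?e (y * \<xi>) * ?e (- s * x)) * (LINT k|lborel. ?e (s * (x + 1 * k)) * (cnj (F (x + 1 * k)) * F ((x + 1 * k) + \<xi>)))"
      by (rule integral_mult_right_zero)
    also have "(LINT k|lborel. ?e (s * (x + 1 * k)) * (cnj (F (x + 1 * k)) * F ((x + 1 * k) + \<xi>))) = amb F F \<xi> s"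
      unfolding amb_def by (rule integral_lborel_isometry) simp
    finally show ?thesis by (simp only: norm_mult cmod_exp_minus_i mult_1)
  qed
  then show ?thesis by (simp add: energy_def l2norm_def amb_line_def)
qed

text \<open>A point where the cross ambiguity function is large is thus a translation giving F a
  large component along the Gaussian, and such a component passes to weak limits.\<close>

lemma l2inner_gauss_translate: "l2inner lborel gauss (translate x y F) = amb gauss F x y"
  unfolding l2inner_def amb_def translate_def
  by (intro Bochner_Integration.integral_cong) (auto simp: mult_ac)

text \<open>If the energy vanishes, then for almost every t the fourth power of the solution has
  integral 0, so the solution is 0. A single such t contradicts conservation of the norm, and a
  nonzero measure provides one.\<close>

lemma energy_pos:
  assumes mu: "emeasure mu (space mu) \<noteq> 0" and F: "F \<in> sqint lborel" and nz: "l2norm lborel F \<noteq> 0"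
  shows "0 < energy F"
proof (rule ccontr)
  assume "\<not> 0 < energy F"
  then have e0: "energy F = 0" using energy_nonneg[of F] by simp
  obtain f where f: "f \<in> sqint lborel" "is_fourier f F" using Fourier_surjective[OF F] by blast
  note [measurable] = amb_line_measurable(1)[OF F F]
  let ?B = "\<lambda>t. \<integral>\<^sup>+\<xi>. ennreal ((cmod (amb_line F F (t, \<xi>)))\<^sup>2) \<partial>lborel"
  have "(\<integral>\<^sup>+t. ?B t \<partial>mu) = (\<integral>\<^sup>+p. ennreal ((cmod (amb_line F F p))\<^sup>2) \<partial>nu)"
    by (rule nn_integral_nu_fst[symmetric]) measurable
  also have "\<dots> = 0"
    using nn_integral_l2norm[OF amb_line_bound(1)[OF F F]] e0 by (simp add: energy_def)
  finally have "AE t in mu. ?B t = 0" by (subst (asm) nn_integral_0_iff_AE) auto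
  then have "AE t in mu. False"
    using AE_schr_prop_power4[OF f(1)]
  proof eventually_elim
    case (elim t)
    note u = schr_prop_is_fourier[OF f, of t]
    have [measurable]: "schr_prop t f \<in> borel_measurable borel" using u(1) by (simp add: sqint_def)
    have "(\<lambda>x. cnj (schr_prop t f x) * schr_prop t f x) \<in> sqint lborel"
      using elim(2) by (intro sqint_cnj_mult_power4) auto
    from nn_integral_power4_eq_amb_line[OF u this] elim(1)
    have "(\<integral>\<^sup>+x. ennreal ((cmod (schr_prop t f x)) ^ 4) \<partial>lborel) = 0" by simp
    then have "AE x in lborel. schr_prop t f x = 0" by (subst (asm) nn_integral_0_iff_AE) auto
    then have "l2norm lborel (schr_prop t f) = 0" using l2norm_eq_0_iff[OF u(1)] by simp
    then show ?case using is_fourier_norm[OF u] phase_sqint(2)[OF F, of t] nz by simp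
  qed
  then have "emeasure mu (space mu) = 0" by (simp only: eventually_False ae_filter_eq_bot_iff)
  then show False using mu by simp
qed

section \<open>The supremum at fixed mass, its attainment and the first variation\<close>

definition energy_sup :: "real \<Rightarrow> real" where
  "energy_sup lam = Sup (energy ` {F \<in> sqint lborel. (l2norm lborel F)\<^sup>2 = lam})"

lemma energy_bdd_above: "bdd_above (energy ` {F \<in> sqint lborel. (l2norm lborel F)\<^sup>2 = lam})"
  by (rule bdd_aboveI[where M="amb_const\<^sup>2 * lam\<^sup>2"]) (use energy_bound in auto)

lemma energy_le_sup:
  assumes "F \<in> sqint lborel" "(l2norm lborel F)\<^sup>2 = lam"
  shows "energy F \<le> energy_sup lam"
  unfolding energy_sup_def using assms energy_bdd_above by (intro cSup_upper) auto

lemma exists_l2norm_sq: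
  assumes "0 \<le> lam"
  shows "\<exists>F\<in>sqint (lborel :: real measure). (l2norm lborel F)\<^sup>2 = lam"
proof -
  have "(LINT x|lborel. (cmod (indicator {0<..1::real} x))\<^sup>2) = (LINT x|lborel. indicator {0<..1::real} x)"
    by (intro Bochner_Integration.integral_cong) (auto simp: indicator_def)
  then have "l2norm lborel (indicator {0<..1::real}) = 1" by (simp add: l2norm_def)
  then have "(l2norm lborel (\<lambda>x. complex_of_real (sqrt lam) * indicator {0<..1::real} x))\<^sup>2 = lam"
    using assms by (simp add: l2norm_cmult)
  then show ?thesis by (rule bexI[OF _ sqint_cmult[OF sqint_indicator_Ioc]])
qed

text \<open>Quartic homogeneity turns the supremum at mass lam into a bound at every mass. It serves
  the weak limit and the remainders, and also the varied functions in the Euler--Lagrange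
  argument.\<close>

lemma energy_sup_scaling:
  assumes lam: "0 < lam" and F: "F \<in> sqint lborel"
  shows "energy F \<le> energy_sup lam / lam\<^sup>2 * ((l2norm lborel F)\<^sup>2)\<^sup>2"
proof (cases "l2norm lborel F = 0")
  case True
  then show ?thesis using energy_bound[OF F] by simp
next
  case False
  let ?n = "l2norm lborel F"
  have n: "0 < ?n" using False l2norm_nonneg[of lborel F] by linarith
  let ?c = "complex_of_real (sqrt lam / ?n)"
  have c: "cmod ?c = sqrt lam / ?n" unfolding norm_of_real using n lam by simp
  have "(l2norm lborel (\<lambda>k. ?c * F k))\<^sup>2 = lam"
    unfolding l2norm_cmult c using n lam by simp
  then have "energy (\<lambda>k. ?c * F k) \<le> energy_sup lam" by (intro energy_le_sup sqint_cmult F)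
  then have "(sqrt lam / ?n) ^ 4 * energy F \<le> energy_sup lam" unfolding energy_cmult c .
  moreover have "(sqrt lam / ?n) ^ 4 = lam\<^sup>2 / (?n\<^sup>2)\<^sup>2"
  proof -
    have "(sqrt lam / ?n) ^ (2 * 2) = ((sqrt lam / ?n)\<^sup>2)\<^sup>2" by (rule power_mult)
    then show ?thesis using lam by (simp add: power_divide)
  qed
  ultimately have "lam\<^sup>2 / (?n\<^sup>2)\<^sup>2 * energy F \<le> energy_sup lam" by simp
  then show ?thesis using n lam by (simp add: field_simps)
qed

lemma energy_sup_pos:
  assumes "emeasure mu (space mu) \<noteq> 0" "0 < lam"
  shows "0 < energy_sup lam"
proof -
  from exists_l2norm_sq[OF less_imp_le[OF assms(2)]]
  obtain F :: "real \<Rightarrow> complex" where F: "F \<in> sqint lborel" "(l2norm lborel F)\<^sup>2 = lam" by blast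
  then have "0 < energy F" using assms by (intro energy_pos) auto
  then show ?thesis using energy_le_sup[OF F] by simp
qed

lemma energy_maximizer_exists:
  assumes mu: "emeasure mu (space mu) \<noteq> 0" and lam: "0 < lam"
  shows "\<exists>F\<in>sqint lborel. (l2norm lborel F)\<^sup>2 = lam \<and> energy F = energy_sup lam"
proof -
  let ?s = "energy_sup lam"
  let ?A = "{F \<in> sqint (lborel :: real measure). (l2norm lborel F)\<^sup>2 = lam}"
  have s: "0 < ?s" by (rule energy_sup_pos[OF mu lam])
  have ne: "energy ` ?A \<noteq> {}" using exists_l2norm_sq[of lam] lam by auto
  \<comment> \<open>The margin is at most half the supremum for every n, so that
    \<open>nonvanishing\<close> applies to the whole sequence with one constant.\<close>
  have "\<forall>n. \<exists>F. F \<in> ?A \<and> ?s - ?s / 2 * inverse (real (Suc n)) < energy F"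
  proof
    fix n
    have "?s - ?s / 2 * inverse (real (Suc n)) < Sup (energy ` ?A)"
      using s unfolding energy_sup_def[symmetric] by simp
    then show "\<exists>F. F \<in> ?A \<and> ?s - ?s / 2 * inverse (real (Suc n)) < energy F"
      using less_cSupD[OF ne] by blast
  qed
  from choice[OF this] obtain F where F: "\<And>n. F n \<in> sqint lborel" "\<And>n. (l2norm lborel (F n))\<^sup>2 = lam"
    "\<And>n. ?s - ?s / 2 * inverse (real (Suc n)) < energy (F n)" by auto
  have nF: "l2norm lborel (F n) = sqrt lam" for n using F(2)[of n] real_sqrt_unique[of "l2norm lborel (F n)" lam] by simp
  have half: "?s / 2 \<le> energy (F n)" for n
  proof -
    have "inverse (real (Suc n)) \<le> 1" by (simp add: inverse_le_1_iff)
    then have "?s / 2 * inverse (real (Suc n)) \<le> ?s / 2 * 1" using s by (intro mult_left_mono) auto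
    then show ?thesis using F(3)[of n] by linarith
  qed
  obtain \<epsilon> where \<epsilon>: "0 < \<epsilon>" and non: "\<And>G. G \<in> sqint lborel \<Longrightarrow> l2norm lborel G = sqrt lam \<Longrightarrow> ?s / 2 \<le> (l2norm nu (amb_line G G))\<^sup>2 \<Longrightarrow>
      \<exists>x y. \<epsilon> < cmod (amb gauss G x y)"
    using nonvanishing[of "?s / 2" "sqrt lam"] s lam by auto
  have "\<forall>n. \<exists>x y. \<epsilon> < cmod (amb gauss (F n) x y)"
    using non[OF F(1) nF] half unfolding energy_def by blast
  then obtain x y where xy: "\<And>n. \<epsilon> < cmod (amb gauss (F n) (x n) (y n))" by metis
  define T where "T n = translate (x n) (y n) (F n)" for n
  have T: "T n \<in> sqint lborel" "l2norm lborel (T n) = sqrt lam" "energy (T n) = energy (F n)" for n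
    using translate_sqint[OF F(1)] nF by (auto simp: T_def energy_translate)
  obtain r g where r: "strict_mono r" and g: "g \<in> sqint lborel"
    and weak: "\<And>h. h \<in> sqint lborel \<Longrightarrow> (\<lambda>n. l2inner lborel h (T (r n))) \<longlonglongrightarrow> l2inner lborel h g"
    using l2_weak_compact[of T "sqrt lam", OF T(1) eq_refl[OF T(2)]] by blast
  define G where "G n k = T (r n) k - g k" for n k
  have G: "G n \<in> sqint lborel" for n unfolding G_def[abs_def] by (intro sqint_diff T g)
  have weakG: "(\<lambda>n. l2inner lborel h (G n)) \<longlonglongrightarrow> 0" if h: "h \<in> sqint lborel" for h
  proof -
    have "l2inner lborel h (G n) = l2inner lborel h (T (r n)) - l2inner lborel h g" for n
      unfolding G_def[abs_def] by (rule l2inner_diff_right[OF T(1) g h])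
    then show ?thesis using tendsto_diff[OF weak[OF h] tendsto_const[of "l2inner lborel h g"]] by simp
  qed
  have Gb: "l2norm lborel (G n) \<le> sqrt lam + l2norm lborel g" for n
  proof -
    have "l2norm lborel (G n) \<le> l2norm lborel (\<lambda>k. T (r n) k - 0) + l2norm lborel (\<lambda>k. 0 - g k)"
      unfolding G_def[abs_def] by (rule l2norm_triangle_diff[OF T(1) sqint_zero g])
    then show ?thesis by (simp add: T(2) l2norm_uminus)
  qed
  have TG: "T (r n) = (\<lambda>k. g k + G n k)" for n by (simp add: G_def)
  define m where "m = (l2norm lborel g)\<^sup>2"
  \<comment> \<open>The components along the Gaussian all exceed \<epsilon>, and so does, up to
    equality, that of the weak limit.\<close>
  have gnz: "l2inner lborel gauss g \<noteq> 0"
  proof -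
    have "\<epsilon> \<le> cmod (l2inner lborel gauss g)"
    proof (rule LIMSEQ_le_const[OF tendsto_norm[OF weak[OF gauss_sqint]]])
      show "\<exists>N. \<forall>n\<ge>N. \<epsilon> \<le> cmod (l2inner lborel gauss (T (r n)))"
        using xy by (auto simp: T_def l2inner_gauss_translate intro: less_imp_le)
    qed
    then show ?thesis using \<epsilon> by auto
  qed
  have m: "0 < m"
  proof (rule ccontr)
    assume "\<not> 0 < m"
    then have "l2norm lborel g = 0" by (simp add: m_def)
    then show False using l2inner_CS[OF gauss_sqint g] gnz by simp
  qed
  \<comment> \<open>Weak convergence splits the mass exactly: in the limit the remainder carries lam
    - m.\<close>
  have nG: "(\<lambda>n. (l2norm lborel (G n))\<^sup>2) \<longlonglongrightarrow> lam - m"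
  proof -
    have "(l2norm lborel (G n))\<^sup>2 = lam + m - 2 * Re (l2inner lborel g (T (r n)))" for n
    proof -
      have "(l2norm lborel (\<lambda>k. g k - T (r n) k))\<^sup>2 = m + lam - 2 * Re (l2inner lborel g (T (r n)))"
        using l2norm_diff_sq[OF g T(1), of "r n"] lam by (simp add: T(2) m_def)
      then show ?thesis unfolding G_def[abs_def] l2norm_minus_commute[of lborel "T (r n)" g] by simp
    qed
    moreover have "(\<lambda>n. lam + m - 2 * Re (l2inner lborel g (T (r n)))) \<longlonglongrightarrow> lam + m - 2 * Re (l2inner lborel g g)"
      by (intro tendsto_intros weak g)
    ultimately show ?thesis by (simp add: l2inner_self m_def)
  qed
  have mle: "m \<le> lam"
  proof -
    have "0 \<le> lam - m" by (rule LIMSEQ_le_const[OF nG]) auto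
    then show ?thesis by simp
  qed
  have eT: "(\<lambda>n. energy (T (r n))) \<longlonglongrightarrow> ?s"
  proof -
    have lo: "(\<lambda>n. ?s - ?s / 2 * inverse (real (Suc n))) \<longlonglongrightarrow> ?s - ?s / 2 * 0"
      by (intro tendsto_intros LIMSEQ_inverse_real_of_nat)
    have "(\<lambda>n. energy (T n)) \<longlonglongrightarrow> ?s"
    proof (rule real_tendsto_sandwich)
      show "(\<lambda>n. ?s - ?s / 2 * inverse (real (Suc n))) \<longlonglongrightarrow> ?s" using lo by simp
      show "\<forall>\<^sub>F n in sequentially. ?s - ?s / 2 * inverse (real (Suc n)) \<le> energy (T n)"
        using F(3) by (intro always_eventually allI) (simp add: T(3) less_imp_le)
      show "\<forall>\<^sub>F n in sequentially. energy (T n) \<le> ?s"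
        using energy_le_sup[OF F(1) F(2)] by (intro always_eventually allI) (simp add: T(3))
    qed (rule tendsto_const)
    from LIMSEQ_subseq_LIMSEQ[OF this r] show ?thesis by (simp add: o_def)
  qed
  have split: "(\<lambda>n. energy (T (r n)) - (energy g + energy (G n))) \<longlonglongrightarrow> 0"
    unfolding TG by (rule energy_split[OF g G Gb weakG])
  have eG: "(\<lambda>n. energy (G n)) \<longlonglongrightarrow> ?s - energy g"
    using tendsto_diff[OF tendsto_diff[OF eT split] tendsto_const[of "energy g"]] by simp
  let ?\<kappa> = "?s / lam\<^sup>2"
  have "(\<lambda>n. ?\<kappa> * ((l2norm lborel (G n))\<^sup>2)\<^sup>2) \<longlonglongrightarrow> ?\<kappa> * (lam - m)\<^sup>2"
    by (intro tendsto_intros nG)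
  then have "?s - energy g \<le> ?\<kappa> * (lam - m)\<^sup>2"
    by (rule LIMSEQ_le[OF eG]) (use energy_sup_scaling[OF lam G] in auto)
  moreover have "energy g \<le> ?\<kappa> * m\<^sup>2" using energy_sup_scaling[OF lam g] by (simp add: m_def)
  ultimately have "?s \<le> ?\<kappa> * (m\<^sup>2 + (lam - m)\<^sup>2)" by (simp add: distrib_left)
  moreover have "?s = ?\<kappa> * lam\<^sup>2" using lam by simp
  ultimately have "?\<kappa> * lam\<^sup>2 \<le> ?\<kappa> * (m\<^sup>2 + (lam - m)\<^sup>2)" by simp
  then have "lam\<^sup>2 \<le> m\<^sup>2 + (lam - m)\<^sup>2" by (rule mult_left_le_imp_le) (use s lam in simp)
  \<comment> \<open>The square of lam exceeds m^2 + (lam - m)^2 by 2 m (lam - m); with m > 0 this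
    leaves no mass to the remainder.\<close>
  then have "m * (lam - m) \<le> 0" by (simp add: power2_eq_square algebra_simps)
  then have mlam: "m = lam" using m mle by (simp add: mult_le_0_iff)
  then have "?s \<le> energy g" using \<open>?s - energy g \<le> ?\<kappa> * (lam - m)\<^sup>2\<close> by simp
  then have "energy g = ?s" using energy_le_sup[OF g] mlam by (simp add: m_def)
  then show ?thesis using g mlam by (auto simp: m_def)
qed

text \<open>Homogeneity removes the constraint: by \<open>energy_sup_scaling\<close>,
  \<open>energy_sup lam / lam\<^sup>2\<close> times the fourth power of the norm, minus the energy,
  is nonnegative on all of L2 and vanishes at F. Its first-order term along F + t G is therefore
  0.\<close>

lemma Euler_Lagrange_Re:
  assumes lam: "0 < lam" and F: "F \<in> sqint lborel" "(l2norm lborel F)\<^sup>2 = lam" "energy F = energy_sup lam"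
    and G: "G \<in> sqint lborel"
  shows "Re (l2inner nu (amb_line F G) (amb_line F F)) = energy_sup lam / lam * Re (l2inner lborel G F)"
proof -
  let ?a = "amb_line F F" and ?R = "\<lambda>p. amb_line F G p + amb_line G F p" and ?d = "amb_line G G"
  let ?s = "energy_sup lam"
  define x where "x = Re (l2inner lborel F G)"
  define y where "y = (l2norm lborel G)\<^sup>2"
  define z where "z = Re (l2inner nu ?a ?R)"
  have sq: "?a \<in> sqint nu" "amb_line F G \<in> sqint nu" "amb_line G F \<in> sqint nu" "?d \<in> sqint nu"
    by (intro amb_line_bound F G)+
  have R: "?R \<in> sqint nu" using sq by (intro sqint_add)
  have y: "0 \<le> y" by (simp add: y_def)
  have s0: "0 \<le> ?s" using F(3) energy_nonneg[of F] by simp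
  \<comment> \<open>A lower bound for the energy suffices: the squared norm of \<open>?q\<close> and
    the inner product of the diagonal terms are nonnegative and are dropped.\<close>
  have lower: "?s + 2 * t * z \<le> ?s / lam\<^sup>2 * (lam + 2 * t * x + t\<^sup>2 * y)\<^sup>2" for t
  proof -
    let ?tG = "\<lambda>k. complex_of_real t * G k"
    have tG: "?tG \<in> sqint lborel" using G by (rule sqint_cmult)
    let ?q = "\<lambda>p. (of_real t * ?R p) + of_real (t\<^sup>2) * ?d p"
    have q: "?q \<in> sqint nu" using R sq by (intro sqint_add sqint_cmult)
    have line: "amb_line (\<lambda>k. F k + ?tG k) (\<lambda>k. F k + ?tG k) = (\<lambda>p. ?a p + ?q p)"
      unfolding amb_line_add[OF F(1) tG]
      by (rule ext, simp only: amb_line_def amb_cmult_left amb_cmult_right complex_cnj_complex_of_real)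
        (simp add: algebra_simps power2_eq_square)
    have "?s + 2 * Re (l2inner nu ?a ?q) \<le> energy (\<lambda>k. F k + ?tG k)"
      unfolding energy_def line l2norm_add_sq[OF sq(1) q] using F(3) by (simp add: energy_def)
    moreover have "l2inner nu ?a ?q = of_real t * l2inner nu ?a ?R + of_real (t\<^sup>2) * l2inner nu ?a ?d"
      using l2inner_add_right[OF sqint_cmult[OF R] sqint_cmult[OF sq(4)] sq(1), of "of_real t" "of_real (t\<^sup>2)"]
      unfolding l2inner_cmult_right .
    moreover have "0 \<le> Re (of_real (t\<^sup>2) * l2inner nu ?a ?d)"
      unfolding l2norm_amb_line_cross(1)[OF F(1) G] of_real_mult[symmetric] by simp
    ultimately have "?s + 2 * (t * z) \<le> energy (\<lambda>k. F k + ?tG k)" by (simp add: z_def)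
    also have "\<dots> \<le> ?s / lam\<^sup>2 * ((l2norm lborel (\<lambda>k. F k + ?tG k))\<^sup>2)\<^sup>2"
      by (rule energy_sup_scaling[OF lam sqint_add[OF F(1) tG]])
    also have "(l2norm lborel (\<lambda>k. F k + ?tG k))\<^sup>2 = lam + 2 * t * x + t\<^sup>2 * y"
      unfolding l2norm_add_sq[OF F(1) tG] l2norm_cmult l2inner_cmult_right F(2) x_def y_def
      by (simp add: power_mult_distrib)
    finally show ?thesis by (simp add: mult.assoc)
  qed
  \<comment> \<open>Expanding the fourth power of the norm leaves a coefficient of t^2 that itself
    depends on t; for |t| \<le> 1 it is replaced by a constant bound.\<close>
  have "4 * (?s / lam) * x - 2 * z = 0"
  proof (rule quadratic_nonneg_imp_linear_coeff_zero[where a="?s / lam\<^sup>2 * (2 * lam * y + (2 * \<bar>x\<bar> + y)\<^sup>2)"])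
    fix t :: real assume t: "\<bar>t\<bar> \<le> 1"
    have e: "?s / lam\<^sup>2 * (lam + 2 * t * x + t\<^sup>2 * y)\<^sup>2 =
      ?s + t * (4 * (?s / lam) * x) + t\<^sup>2 * (?s / lam\<^sup>2 * (2 * lam * y + (2 * x + t * y)\<^sup>2))"
      using lam by (simp add: field_simps power2_eq_square)
    have "\<bar>2 * x + t * y\<bar> \<le> 2 * \<bar>x\<bar> + y"
    proof -
      have "\<bar>t * y\<bar> \<le> 1 * y" unfolding abs_mult using t y by (intro mult_mono) auto
      then show ?thesis by linarith
    qed
    then have "(2 * x + t * y)\<^sup>2 \<le> (2 * \<bar>x\<bar> + y)\<^sup>2" by (metis abs_ge_zero power2_abs power_mono)
    then have "t\<^sup>2 * (?s / lam\<^sup>2 * (2 * lam * y + (2 * x + t * y)\<^sup>2)) \<le> t\<^sup>2 * (?s / lam\<^sup>2 * (2 * lam * y + (2 * \<bar>x\<bar> + y)\<^sup>2))"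
      using s0 by (intro mult_left_mono add_left_mono divide_nonneg_nonneg) auto
    then show "0 \<le> t * (4 * (?s / lam) * x - 2 * z) + t\<^sup>2 * (?s / lam\<^sup>2 * (2 * lam * y + (2 * \<bar>x\<bar> + y)\<^sup>2))"
      using lower[of t] unfolding e by (simp add: right_diff_distrib)
  qed
  \<comment> \<open>The exchange of first and third argument makes the two mixed terms conjugate to
    each other.\<close>
  moreover have "z = 2 * Re (l2inner nu (amb_line F G) ?a)"
  proof -
    have "l2inner nu ?a ?R = l2inner nu ?a (amb_line F G) + l2inner nu ?a (amb_line G F)"
      by (rule l2inner_add_right[OF sq(2,3,1)])
    also have "l2inner nu ?a (amb_line G F) = l2inner nu (amb_line F G) ?a"
      by (rule l2inner_amb_line_swap[OF F(1) F(1) G F(1)])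
    also have "l2inner nu ?a (amb_line F G) = cnj (l2inner nu (amb_line F G) ?a)" by (simp add: l2inner_cnj)
    finally show ?thesis by (simp add: z_def)
  qed
  moreover have "Re (l2inner lborel G F) = x"
    unfolding x_def by (subst l2inner_cnj[symmetric]) simp
  ultimately show ?thesis by simp
qed

text \<open>The variation in the direction \<i> G supplies the imaginary part.\<close>

lemma Euler_Lagrange:
  assumes lam: "0 < lam" and F: "F \<in> sqint lborel" "(l2norm lborel F)\<^sup>2 = lam" "energy F = energy_sup lam"
    and G: "G \<in> sqint lborel"
  shows "l2inner nu (amb_line F G) (amb_line F F) = complex_of_real (energy_sup lam / lam) * l2inner lborel G F"
proof (rule complex_eqI)
  have r: "Re (complex_of_real c * w) = c * Re w" "Im (complex_of_real c * w) = c * Im w" for c w by simp_all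
  show "Re (l2inner nu (amb_line F G) (amb_line F F)) = Re (complex_of_real (energy_sup lam / lam) * l2inner lborel G F)"
    unfolding r by (rule Euler_Lagrange_Re[OF assms])
  have i: "amb_line F (\<lambda>k. \<i> * G k) = (\<lambda>p. \<i> * amb_line F G p)" by (simp add: amb_line_def amb_cmult_right fun_eq_iff)
  show "Im (l2inner nu (amb_line F G) (amb_line F F)) = Im (complex_of_real (energy_sup lam / lam) * l2inner lborel G F)"
    using Euler_Lagrange_Re[OF lam F sqint_cmult[OF G, of \<i>]] unfolding i l2inner_cmult_left r by simp
qed

section \<open>Return to the position side\<close>

lemma Pc_eq:
  assumes "0 < lam"
  shows "Pc mu lam = ereal (energy_sup lam / (2 * pi))"
proof -
  let ?A = "{F \<in> sqint lborel. (l2norm lborel F)\<^sup>2 = lam}"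
  \<comment> \<open>The transform preserves norms and is onto, so the supremum may be taken over
    transforms.\<close>
  have "{ereal (Re (Qc mu f f f f)) | f. f \<in> L2 \<and> L2norm_sq f = lam} = (\<lambda>F. ereal (energy F / (2 * pi))) ` ?A" (is "?L = ?R")
  proof
    show "?L \<subseteq> ?R"
    proof
      fix v assume "v \<in> ?L"
      then obtain f where f: "f \<in> sqint lborel" "(l2norm lborel f)\<^sup>2 = lam" "v = ereal (Re (Qc mu f f f f))"
        by (auto simp: L2_eq_sqint L2norm_sq_eq)
      obtain F where F: "is_fourier f F" using is_fourier_exists[OF f(1)] by blast
      have "F \<in> ?A" using is_fourier_sqint[OF F] is_fourier_norm[OF f(1) F] f(2) by simp
      moreover have "v = ereal (energy F / (2 * pi))" unfolding f(3) Qc_diagonal[OF f(1) F] by simp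
      ultimately show "v \<in> ?R" by blast
    qed
    show "?R \<subseteq> ?L"
    proof
      fix v assume "v \<in> ?R"
      then obtain F where F: "F \<in> sqint lborel" "(l2norm lborel F)\<^sup>2 = lam" "v = ereal (energy F / (2 * pi))" by auto
      obtain f where f: "f \<in> sqint lborel" "is_fourier f F" using Fourier_surjective[OF F(1)] by blast
      have "f \<in> L2 \<and> L2norm_sq f = lam" using f is_fourier_norm[OF f] F(2) by (simp add: L2_eq_sqint L2norm_sq_eq)
      moreover have "v = ereal (Re (Qc mu f f f f))" unfolding F(3) Qc_diagonal[OF f] by simp
      ultimately show "v \<in> ?L" by blast
    qed
  qed
  then have "Pc mu lam = (SUP F\<in>?A. ereal (energy F / (2 * pi)))" by (simp add: Pc_def)
  also have "\<dots> = ereal (energy_sup lam / (2 * pi))"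
  proof (rule antisym)
    show "(SUP F\<in>?A. ereal (energy F / (2 * pi))) \<le> ereal (energy_sup lam / (2 * pi))"
      by (rule SUP_least) (auto intro!: divide_right_mono energy_le_sup)
    show "ereal (energy_sup lam / (2 * pi)) \<le> (SUP F\<in>?A. ereal (energy F / (2 * pi)))"
    proof (rule ereal_le_epsilon2)
      fix e :: real assume e: "0 < e"
      have ne: "energy ` ?A \<noteq> {}" using exists_l2norm_sq[of lam] assms by auto
      have "energy_sup lam - e * (2 * pi) < Sup (energy ` ?A)" unfolding energy_sup_def[symmetric] using e by simp
      then obtain F where F: "F \<in> ?A" "energy_sup lam - e * (2 * pi) < energy F" using less_cSupD[OF ne] by blast
      have "energy_sup lam / (2 * pi) \<le> energy F / (2 * pi) + e"
      proof -
        have "energy_sup lam / (2 * pi) \<le> (energy F + e * (2 * pi)) / (2 * pi)" using F(2) by (intro divide_right_mono) auto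
        then show ?thesis by (simp add: add_divide_distrib)
      qed
      then have "ereal (energy_sup lam / (2 * pi)) \<le> ereal (energy F / (2 * pi)) + ereal e" by simp
      also have "\<dots> \<le> (SUP F\<in>?A. ereal (energy F / (2 * pi))) + ereal e"
        using F(1) by (intro add_right_mono SUP_upper)
      finally show "ereal (energy_sup lam / (2 * pi)) \<le> (SUP F\<in>?A. ereal (energy F / (2 * pi))) + ereal e" .
    qed
  qed
  finally show ?thesis .
qed

end

text \<open>\<open>Qc\<close> is a Bochner integral, with value 0 where its integrand is not
  integrable, so a finite \<open>Pc\<close> alone could be an artefact; part (i) therefore also
  asserts that the space-time integral of the fourth power is finite. As \<open>Pc\<close> is formed
  from real parts, part (ii) adds that the imaginary part of \<open>Qc\<close> vanishes at the
  maximizer.\<close>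

theorem theorem1p1:
  fixes \<psi> :: "real \<Rightarrow> real" and \<mu> :: "real measure"
  assumes psi_meas: "\<psi> \<in> borel_measurable lborel"
    and psi_nonneg: "\<And>t. \<psi> t \<ge> 0"
    and mu_def: "\<mu> = density lborel (\<lambda>t. ennreal (\<psi> t))"
    and mu_nonzero: "emeasure \<mu> (space \<mu>) \<noteq> 0"
    and psi_L2: "integrable lborel (\<lambda>t. (\<psi> t)\<^sup>2)"
  shows
    "(\<forall>lam>0. Pc \<mu> lam < \<infinity> \<and>
        (\<forall>f\<in>L2. L2norm_sq f = lam \<longrightarrow>
           (\<integral>\<^sup>+ r. (\<integral>\<^sup>+ x. ennreal ((cmod (schr_prop r f x)) ^ 4) \<partial>lborel) \<partial>\<mu>) < \<infinity>))
     \<and>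
     ((integrable lborel (\<lambda>t. (\<psi> t) ^ 4) \<and>
       integrable lborel (\<lambda>t. (\<psi> t) ^ 4 * t\<^sup>2)) \<longrightarrow>
      (\<forall>lam>0.
         (\<exists>f\<in>L2. L2norm_sq f = lam \<and>
            Im (Qc \<mu> f f f f) = 0 \<and> ereal (Re (Qc \<mu> f f f f)) = Pc \<mu> lam) \<and>
         (\<forall>f\<in>L2. L2norm_sq f = lam \<and> ereal (Re (Qc \<mu> f f f f)) = Pc \<mu> lam \<longrightarrow>
            (let \<omega> = real_of_ereal (Pc \<mu> lam) / lam in
               \<omega> > 0 \<and>
               (\<forall>g\<in>L2. complex_of_real \<omega> * L2inner g f = Qc \<mu> g f f f)))))"
proof -
  interpret D: dispersion_density \<psi> by unfold_locales (fact psi_meas psi_nonneg psi_L2)+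
  have mu: "\<mu> = D.mu" by (simp add: D.mu_def mu_def)
  have mu0: "emeasure D.mu (space D.mu) \<noteq> 0" using mu_nonzero unfolding mu .
  show ?thesis unfolding mu
  proof (intro conjI allI impI)
    fix lam :: real assume lam: "lam > 0"
    show "Pc D.mu lam < \<infinity>" unfolding D.Pc_eq[OF lam] by simp
    show "\<forall>f\<in>L2. L2norm_sq f = lam \<longrightarrow>
           (\<integral>\<^sup>+ r. (\<integral>\<^sup>+ x. ennreal ((cmod (schr_prop r f x)) ^ 4) \<partial>lborel) \<partial>D.mu) < \<infinity>"
      by (intro ballI impI le_less_trans[OF D.nn_integral_schr_prop_power4]) (simp_all add: L2_eq_sqint)
  next
    fix lam :: real assume lam: "lam > 0"
    obtain F where F: "F \<in> sqint lborel" "(l2norm lborel F)\<^sup>2 = lam" "D.energy F = D.energy_sup lam"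
      using D.energy_maximizer_exists[OF mu0 lam] by blast
    obtain f where f: "f \<in> sqint lborel" "is_fourier f F" using Fourier_surjective[OF F(1)] by blast
    show "\<exists>f\<in>L2. L2norm_sq f = lam \<and> Im (Qc D.mu f f f f) = 0 \<and> ereal (Re (Qc D.mu f f f f)) = Pc D.mu lam"
    proof (intro bexI conjI)
      show "f \<in> L2" using f(1) by (simp add: L2_eq_sqint)
      show "L2norm_sq f = lam" using is_fourier_norm[OF f] F(2) by (simp add: L2norm_sq_eq)
      show "Im (Qc D.mu f f f f) = 0" "ereal (Re (Qc D.mu f f f f)) = Pc D.mu lam"
        unfolding D.Qc_diagonal[OF f] D.Pc_eq[OF lam] F(3) by simp_all
    qed
  next
    fix lam :: real assume lam: "lam > 0"
    have w: "real_of_ereal (Pc D.mu lam) / lam = D.energy_sup lam / (2 * pi) / lam" unfolding D.Pc_eq[OF lam] by simp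
    show "\<forall>f\<in>L2. L2norm_sq f = lam \<and> ereal (Re (Qc D.mu f f f f)) = Pc D.mu lam \<longrightarrow>
            (let \<omega> = real_of_ereal (Pc D.mu lam) / lam in
               \<omega> > 0 \<and> (\<forall>g\<in>L2. complex_of_real \<omega> * L2inner g f = Qc D.mu g f f f))"
      unfolding w Let_def
    proof (intro ballI impI conjI)
      show "0 < D.energy_sup lam / (2 * pi) / lam"
        using D.energy_sup_pos[OF mu0 lam] lam by simp
      fix f g assume f: "f \<in> L2" "L2norm_sq f = lam \<and> ereal (Re (Qc D.mu f f f f)) = Pc D.mu lam" and g: "g \<in> L2"
      have fs: "f \<in> sqint lborel" and gs: "g \<in> sqint lborel" using f(1) g by (simp_all add: L2_eq_sqint)
      obtain F where F: "is_fourier f F" using is_fourier_exists[OF fs] by blast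
      obtain G where G: "is_fourier g G" using is_fourier_exists[OF gs] by blast
      have nF: "(l2norm lborel F)\<^sup>2 = lam" using f(2) is_fourier_norm[OF fs F] by (simp add: L2norm_sq_eq)
      have "D.energy F / (2 * pi) = D.energy_sup lam / (2 * pi)"
        using f(2) unfolding D.Qc_diagonal[OF fs F] D.Pc_eq[OF lam] by simp
      then have eF: "D.energy F = D.energy_sup lam" by simp
      have "Qc D.mu g f f f = complex_of_real (1 / (2 * pi)) * l2inner D.nu (amb_line F G) (amb_line F F)"
        by (rule D.Qc_eq_l2inner[OF gs G fs F fs F fs F])
      also have "\<dots> = complex_of_real (D.energy_sup lam / (2 * pi) / lam) * l2inner lborel G F"
        unfolding D.Euler_Lagrange[OF lam is_fourier_sqint[OF F] nF eF is_fourier_sqint[OF G]] by simp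
      also have "l2inner lborel G F = L2inner g f"
        unfolding L2inner_eq by (rule Parseval[OF gs G fs F])
      finally show "complex_of_real (D.energy_sup lam / (2 * pi) / lam) * L2inner g f = Qc D.mu g f f f" ..
    qed
  qed
qed

end
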